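(* Let $x$ and $y$ be two distinct singular moduli. Then $$|x-y|\ge 800\max\{|\Delta_x|,|\Delta_y|\}^{-4}.$$
   Context: A singular modulus is the $j$-invariant of an elliptic curve over $\mathbb{C}$ with complex multiplication; equivalently, a number $j(\tau)$ with $\tau$ an imaginary quadratic number in the upper half-plane, where $j$ is Klein's modular invariant. For a singular modulus $x$, $\Delta_x$ denotes the discriminant of the associated imaginary quadratic order (the endomorphism ring of the elliptic curve), so $\Delta_x<0$ and $\Delta_x\equiv 0,1 \pmod 4$. *)

theory Defs
  imports "HOL-Complex_Analysis.Complex_Analysis"
begin

definition lattice_span :: "complex \<Rightarrow> complex \<Rightarrow> complex set" where
  "lattice_span \<omega>1 \<omega>2 = {of_int m * \<omega>1 + of_int n * \<omega>2 | (m::int) (n::int). True}"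

definition weierstrass_g2 :: "complex set \<Rightarrow> complex" where
  "weierstrass_g2 \<Lambda> = 60 * (\<Sum>\<^sub>\<infinity>\<omega>\<in>\<Lambda> - {0}. 1 / \<omega> ^ 4)"

definition weierstrass_g3 :: "complex set \<Rightarrow> complex" where
  "weierstrass_g3 \<Lambda> = 140 * (\<Sum>\<^sub>\<infinity>\<omega>\<in>\<Lambda> - {0}. 1 / \<omega> ^ 6)"

text \<open>The j-invariant of the elliptic curve \<open>\<complex>/\<Lambda>\<close>, that is, of
  \<open>Y\<^sup>2 = 4 X\<^sup>3 - g\<^sub>2 X - g\<^sub>3\<close>. It is normalised so that the square lattice has
  invariant 1728.\<close>

definition j_invariant :: "complex set \<Rightarrow> complex" where
  "j_invariant \<Lambda> = 1728 * weierstrass_g2 \<Lambda> ^ 3 /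
     (weierstrass_g2 \<Lambda> ^ 3 - 27 * weierstrass_g3 \<Lambda> ^ 2)"

definition klein_j :: "complex \<Rightarrow> complex" where
  "klein_j \<tau> = j_invariant (lattice_span 1 \<tau>)"

text \<open>Imaginary quadratic numbers in the upper half-plane. As \<open>\<tau>\<close> is not real, a quadratic
  equation over \<open>\<int>\<close> with root \<open>\<tau>\<close> is irreducible over \<open>\<rat>\<close>.\<close>

definition imag_quadratic :: "complex \<Rightarrow> bool" where
  "imag_quadratic \<tau> \<longleftrightarrow> Im \<tau> > 0 \<and>
     (\<exists>a b c :: int. a \<noteq> 0 \<and> of_int a * \<tau> ^ 2 + of_int b * \<tau> + of_int c = 0)"

definition singular_modulus :: "complex \<Rightarrow> bool" where
  "singular_modulus x \<longleftrightarrow> (\<exists>\<tau>. imag_quadratic \<tau> \<and> x = klein_j \<tau>)"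

text \<open>The endomorphism ring of \<open>\<complex>/\<Lambda>\<close>, as a subring of \<open>\<complex>\<close>.\<close>

definition endo_ring :: "complex set \<Rightarrow> complex set" where
  "endo_ring \<Lambda> = {\<alpha>. \<forall>\<omega>\<in>\<Lambda>. \<alpha> * \<omega> \<in> \<Lambda>}"

text \<open>The discriminant of an imaginary quadratic order \<open>R \<subseteq> \<complex>\<close>: the square of the determinant
  formed by the two complex embeddings (the identity and conjugation) of a \<open>\<int>\<close>-basis of \<open>R\<close>.
  Two bases differ by an integer matrix of determinant \<open>\<plusminus>1\<close>, so the value does not depend on
  the basis. If \<open>R\<close> has rank 2, then any two generators of \<open>R\<close> form a basis.\<close>

definition order_discriminant :: "complex set \<Rightarrow> int" where
  "order_discriminant R = (THE D. \<exists>\<omega>1 \<omega>2. R = lattice_span \<omega>1 \<omega>2 \<and>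
     of_int D = (\<omega>1 * cnj \<omega>2 - \<omega>2 * cnj \<omega>1) ^ 2)"

text \<open>The discriminant \<open>\<Delta>\<^sub>x\<close> of a singular modulus. The choice of \<open>\<tau>\<close> is immaterial:
  \<open>j(\<tau>)\<close> determines the lattice \<open>\<int> + \<int>\<tau>\<close> up to homothety, and homothetic lattices have the
  same endomorphism ring.\<close>

definition sm_discriminant :: "complex \<Rightarrow> int" where
  "sm_discriminant x =
     order_discriminant (endo_ring (lattice_span 1 (SOME \<tau>. imag_quadratic \<tau> \<and> x = klein_j \<tau>)))"

end

theory Submission
  imports Defs
begin

text \<open>The roots \<open>e\<^sub>1, e\<^sub>2, e\<^sub>3\<close> of the Weierstrass cubic give the function
  \<open>s = 3 e\<^sub>1 / (e\<^sub>3 - e\<^sub>2)\<close>, a Hauptmodul of \<open>\<Gamma>(2)\<close> with \<open>j = 64 (s\<^sup>2 + 3)\<^sup>3 / (s\<^sup>2 - 1)\<^sup>2\<close>. In the nome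
  \<open>r = exp (i \<pi> \<tau>)\<close> one has \<open>8 s = 1 / r + E(r)\<close> where \<open>E\<close> has a small Lipschitz constant, so the
  separation of the imaginary quadratic points of discriminant at most \<open>d\<close> in absolute value
  gives \<open>|s(z) - s(w)| \<ge> 6 / d\<close>. On the standard fundamental domain \<open>Re s \<ge> 0\<close> and
  \<open>|s - 1| \<ge> 2\<close>; the difference of two values of \<open>j\<close> splits into six factors that are
  linear in each of \<open>s\<close> and \<open>t\<close>, at most three of them can be small at the same time, and each
  small one is again a difference of values of \<open>s\<close>. This gives
  \<open>|x - y| \<ge> 36/25 (6/d)\<^sup>3\<close>, which suffices because \<open>d \<ge> 3\<close>.\<close>

section \<open>The j-invariant as a function of the level-two Hauptmodul\<close>

text \<open>The invariant \<open>j\<close> ramifies over 0 and 1728, so a difference of its values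
  has no lower bound that is linear in the distance of the points; at the corner of the fundamental
  domain it behaves like a cube. The map to \<open>s\<close> is unramified and its pole term
  \<open>1 / r\<close> outweighs the rest, so there a linear bound is possible. The loss then
  becomes purely algebraic: it sits in the six factors, one for each coset of Gamma(2), and the cube
  in \<open>(6 / d) ^ 3\<close> is the order three of the corner. One factor resists,
  \<open>(s - 1) * (t - 1) - 4\<close>, which belongs to inversion. Its lower bound
  \<open>2 * norm (s - cnj t)\<close> compares the values of \<open>s\<close> at \<open>z\<close>
  and at \<open>- cnj w\<close>, and it is void when \<open>z = - cnj w\<close>. In that case the
  factor is the real number \<open>norm (s - 1) ^ 2 - 4\<close>, and it is controlled by the speed
  at which \<open>s\<close> leaves the circle of radius 2 about 1 when the point rises vertically
  from the unit circle.\<close>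

lemma norm_mult_minus_4_sq:
  fixes u v :: complex
  shows "(norm (u * v - 4))\<^sup>2 = 4 * (norm (u - cnj v))\<^sup>2 + ((norm u)\<^sup>2 - 4) * ((norm v)\<^sup>2 - 4)"
  unfolding cmod_power2 by (simp add: power2_eq_square algebra_simps)

lemma norm_mult_minus_4_ge:
  fixes u v :: complex
  assumes "norm u \<ge> 2" "norm v \<ge> 2"
  shows "norm (u * v - 4) \<ge> 2 * norm (u - cnj v)"
proof -
  have "(norm u)\<^sup>2 \<ge> 2\<^sup>2" "(norm v)\<^sup>2 \<ge> 2\<^sup>2"
    using assms by (intro power_mono; simp)+
  then have "((norm u)\<^sup>2 - 4) * ((norm v)\<^sup>2 - 4) \<ge> 0" by simp
  then have "(2 * norm (u - cnj v))\<^sup>2 \<le> (norm (u * v - 4))\<^sup>2"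
    unfolding norm_mult_minus_4_sq by (simp add: power_mult_distrib)
  then show ?thesis by (rule power2_le_imp_le) simp
qed

lemma norm_mult_plus_4_ge:
  fixes u v :: complex
  assumes "norm u \<ge> 2" "norm v \<ge> 2"
  shows "norm (u * v + 4) \<ge> 2 * norm (u + cnj v)"
proof -
  have "u * - v - 4 = - (u * v + 4)" by simp
  then have "norm (u * - v - 4) = norm (u * v + 4)" by (simp only: norm_minus_cancel)
  then show ?thesis using norm_mult_minus_4_ge[of u "-v"] assms by simp
qed

text \<open>For a product of modulus at least 8 the constant of modulus 4 takes away at most half;
  below 8 the bound \<open>k\<close> is used directly. The right-hand side is shaped to cancel
  against the denominator of a difference of values of \<open>j\<close>.\<close>

lemma norm_mult_pm_4_ratio:
  fixes u v e :: complex
  assumes "norm u \<ge> 2" "norm v \<ge> 2" "norm e = 4" "norm (u * v + e) \<ge> k" "k \<le> 4"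
  shows "norm (u * v + e) \<ge> k / 8 * (norm u * norm v)"
proof (cases "norm u * norm v \<ge> 8")
  case True
  have "norm u * norm v - 4 \<le> norm (u * v + e)"
    using norm_triangle_ineq2[of "u * v" "- e"] assms(3) by (simp add: norm_mult)
  moreover have "k / 8 * (norm u * norm v) \<le> 1/2 * (norm u * norm v)"
    using assms by (intro mult_right_mono) auto
  ultimately show ?thesis using True by simp
next
  case False
  show ?thesis
  proof (cases "k \<ge> 0")
    case True
    then have "k / 8 * (norm u * norm v) \<le> k / 8 * 8" using False by (intro mult_left_mono) auto
    then show ?thesis using assms by simp
  next
    case False
    then have "k / 8 * (norm u * norm v) \<le> 0" by (intro mult_nonpos_nonneg) auto
    then show ?thesis using norm_ge_zero order_trans by blast
  qed
qed

definition j_of_s :: "complex \<Rightarrow> complex" where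
  "j_of_s s = 64 * (s\<^sup>2 + 3) ^ 3 / (s\<^sup>2 - 1)\<^sup>2"

text \<open>The denominator \<open>(s^2 - 1)^2 * (t^2 - 1)^2\<close> is written as four products so
  that each bilinear factor of the numerator meets its own pair of linear factors.\<close>

lemma j_of_s_diff:
  assumes "s\<^sup>2 \<noteq> 1" "t\<^sup>2 \<noteq> 1"
  shows "j_of_s s - j_of_s t =
    64 * ((s - t) * (s + t) * ((s - 1) * (t + 1) + 4) * ((s - 1) * (t - 1) + (- 4))
          * ((s + 1) * (t + 1) + (- 4)) * ((s + 1) * (t - 1) + 4)) /
    ((s - 1) * (t + 1) * ((s - 1) * (t - 1)) * ((s + 1) * (t + 1)) * ((s + 1) * (t - 1)))"
proof -
  have den: "(s - 1) * (t + 1) * ((s - 1) * (t - 1)) * ((s + 1) * (t + 1)) * ((s + 1) * (t - 1))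
      = (s\<^sup>2 - 1)\<^sup>2 * (t\<^sup>2 - 1)\<^sup>2"
    by algebra
  have num: "(s\<^sup>2 + 3) ^ 3 * (t\<^sup>2 - 1)\<^sup>2 - (t\<^sup>2 + 3) ^ 3 * (s\<^sup>2 - 1)\<^sup>2 =
     (s - t) * (s + t) * ((s - 1) * (t + 1) + 4) * ((s - 1) * (t - 1) + (- 4))
          * ((s + 1) * (t + 1) + (- 4)) * ((s + 1) * (t - 1) + 4)"
    by algebra
  show ?thesis
    unfolding den num[symmetric] j_of_s_def using assms by (simp add: field_simps)
qed

text \<open>The six linear factors in the numerator above are, up to nonvanishing factors, the differences
  of \<open>s\<close> and the six images of \<open>t\<close> under the modular group modulo \<open>\<Gamma>(2)\<close>.\<close>

lemma j_of_s_separation: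
  fixes s t :: complex and m :: real
  assumes re: "Re s \<ge> 0" "Re t \<ge> 0"
    and far: "norm (s - 1) \<ge> 2" "norm (t - 1) \<ge> 2"
    and m: "0 < m" "m \<le> 2"
    and sep: "norm (s - t) \<ge> m" "norm (s + t) \<ge> m" "norm ((s - 1) * (t - 1) - 4) \<ge> 2 * m"
  shows "norm (j_of_s s - j_of_s t) \<ge> 36 / 25 * m ^ 3"
proof -
  let ?P = "norm (s - t) * norm (s + t)" and ?J = "norm (j_of_s s - j_of_s t)"
  have plus_ge: "(norm (w + 1))\<^sup>2 = (norm (w - 1))\<^sup>2 + 4 * Re w" for w
    unfolding cmod_power2 by (simp add: power2_eq_square algebra_simps)
  have far': "norm (w + 1) \<ge> 2" "w\<^sup>2 \<noteq> 1" "3 \<le> (norm w)\<^sup>2" "(norm (w + 1))\<^sup>2 - 4 \<ge> 4 * Re w"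
    if "Re w \<ge> 0" "norm (w - 1) \<ge> 2" for w
  proof -
    have sq: "(norm (w - 1))\<^sup>2 \<ge> 2\<^sup>2" using that by (intro power_mono) auto
    then show "(norm (w + 1))\<^sup>2 - 4 \<ge> 4 * Re w" using plus_ge[of w] by simp
    then have "2\<^sup>2 \<le> (norm (w + 1))\<^sup>2" using that by simp
    then show 2: "norm (w + 1) \<ge> 2" by (rule power2_le_imp_le) simp
    show "w\<^sup>2 \<noteq> 1" using that 2 by (auto simp: power2_eq_1_iff)
    have "(Re w - 1)\<^sup>2 + (Im w)\<^sup>2 \<ge> 4" using sq unfolding cmod_power2 by simp
    then show "3 \<le> (norm w)\<^sup>2" using that unfolding cmod_power2
      by (simp add: power2_eq_square algebra_simps)
  qed
  note fs = far'[OF re(1) far(1)] and ft = far'[OF re(2) far(2)]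
  define A where "A = (s - 1) * (t + 1) + 4"
  define B where "B = (s - 1) * (t - 1) + (- 4)"
  define C where "C = (s + 1) * (t + 1) + (- 4)"
  define D where "D = (s + 1) * (t - 1) + 4"
  have A: "norm A \<ge> 2 * norm (s + cnj t)"
    using norm_mult_plus_4_ge[of "s - 1" "t + 1"] far fs ft by (simp add: A_def)
  have D: "norm D \<ge> 2 * norm (s + cnj t)"
    using norm_mult_plus_4_ge[of "s + 1" "t - 1"] far fs ft by (simp add: D_def)
  have B: "norm B \<ge> 2 * norm (s - cnj t)"
    using norm_mult_minus_4_ge[of "s - 1" "t - 1"] far fs ft by (simp add: B_def)
  \<comment> \<open>The general bound would give \<open>s - cnj t\<close>. The excess
    \<open>norm (w + 1) ^ 2 - 4 >= 4 * Re w\<close> contributes \<open>16 * Re s * Re t\<close>,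
    exactly what turns the square of \<open>s - cnj t\<close> into that of
    \<open>s + t\<close>.\<close>
  have C: "norm C \<ge> 2 * norm (s + t)"
  proof -
    have "(4 * Re s) * (4 * Re t) \<le> ((norm (s + 1))\<^sup>2 - 4) * ((norm (t + 1))\<^sup>2 - 4)"
      using re fs ft by (intro mult_mono) auto
    then have "(2 * norm (s + t))\<^sup>2 \<le> (norm C)\<^sup>2"
      using norm_mult_minus_4_sq[of "s + 1" "t + 1"] unfolding C_def power_mult_distrib
      by (simp add: cmod_power2) (simp add: power2_eq_square algebra_simps)
    then show ?thesis by (rule power2_le_imp_le) simp
  qed
  have cs: "norm (s + cnj t) \<ge> norm (s - t)"
  proof -
    have "(norm (s - t))\<^sup>2 \<le> (norm (s + cnj t))\<^sup>2"
      using mult_nonneg_nonneg[OF re] unfolding cmod_power2 by (simp add: power2_eq_square algebra_simps)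
    then show ?thesis by (rule power2_le_imp_le) simp
  qed
  have mA: "norm A \<ge> 2 * m" and mD: "norm D \<ge> 2 * m" and mC: "norm C \<ge> 2 * m" and mB: "norm B \<ge> 2 * m"
    using A D C cs sep by (auto simp: B_def)
  \<comment> \<open>The four numbers are lower bounds for the four bilinear factors, capped at 4.
    The cases below decide which factors get a fixed bound and which only
    \<open>2 * m\<close>.\<close>
  have ratio: "?J \<ge> 64 * (?P * (a / 8) * (b / 8) * (c / 8) * (d / 8))"
    if "norm A \<ge> a" "norm B \<ge> b" "norm C \<ge> c" "norm D \<ge> d"
       "0 \<le> a" "a \<le> 4" "0 \<le> b" "b \<le> 4" "0 \<le> c" "c \<le> 4" "0 \<le> d" "d \<le> 4" for a b c d
  proof -
    define pA where "pA = norm (s - 1) * norm (t + 1)"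
    define pB where "pB = norm (s - 1) * norm (t - 1)"
    define pC where "pC = norm (s + 1) * norm (t + 1)"
    define pD where "pD = norm (s + 1) * norm (t - 1)"
    have pos: "pA > 0" "pB > 0" "pC > 0" "pD > 0"
      using far fs(1) ft(1) by (auto simp: pA_def pB_def pC_def pD_def intro!: mult_pos_pos)
    have r: "a / 8 * pA \<le> norm A" "b / 8 * pB \<le> norm B" "c / 8 * pC \<le> norm C" "d / 8 * pD \<le> norm D"
      using that far fs ft unfolding A_def B_def C_def D_def pA_def pB_def pC_def pD_def
      by (intro norm_mult_pm_4_ratio; simp)+
    have "?P * (a / 8 * pA) * (b / 8 * pB) * (c / 8 * pC) * (d / 8 * pD)
        \<le> ?P * norm A * norm B * norm C * norm D"
      using that pos by (intro mult_mono r mult_nonneg_nonneg order_refl) auto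
    then have "64 * (?P * (a / 8) * (b / 8) * (c / 8) * (d / 8)) * (pA * pB * pC * pD)
        \<le> 64 * (?P * norm A * norm B * norm C * norm D)"
      by (simp add: mult_ac)
    moreover have "?J = 64 * (?P * norm A * norm B * norm C * norm D) / (pA * pB * pC * pD)"
      unfolding j_of_s_diff[OF fs(2) ft(2)]
      by (simp add: norm_mult norm_divide A_def B_def C_def D_def pA_def pB_def pC_def pD_def)
    ultimately show ?thesis
      using pos by (simp add: pos_le_divide_eq)
  qed
  have sq6: "x \<ge> 2.4" if "x\<^sup>2 \<ge> 6" "x \<ge> 0" for x :: real
  proof (rule power2_le_imp_le[of "2.4"])
    show "2.4\<^sup>2 \<le> x\<^sup>2" using that by (simp add: power2_eq_square)
  qed (use that in auto)
  have pow: "m ^ 3 \<le> 2 * m\<^sup>2" using m by (simp add: power3_eq_cube power2_eq_square)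
  have re_mult: "Re s * Re t \<ge> 0" using re by simp
  show ?thesis
  \<comment> \<open>On the same side of the real axis \<open>s + t\<close>, and with it
    \<open>C\<close>, is bounded below; on opposite sides \<open>s + cnj t\<close> is, and with it
    \<open>A\<close> and \<open>D\<close>. In every case at least three of the six factors end up
    with a fixed bound.\<close>
  proof (cases "Im s * Im t \<ge> 0")
    case True
    have "(norm (s + t))\<^sup>2 \<ge> 6"
      using True re_mult fs(3) ft(3) unfolding cmod_power2 by (simp add: power2_eq_square algebra_simps)
    then have st: "norm (s + t) \<ge> 2.4" by (intro sq6) auto
    then have C4: "norm C \<ge> 4" using C by linarith
    show ?thesis
    \<comment> \<open>Near the corner value \<open>i * sqrt 3\<close> the factors
      \<open>s - t\<close>, \<open>A\<close> and \<open>D\<close> can be small together; this case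
      determines the constant, 64 * 2.4 * 0.3 * 0.5 / 16 = 36/25. Close to the real axis only
      \<open>s - t\<close> and \<open>B\<close> can be small.\<close>
    proof (cases "\<bar>Im s\<bar> \<ge> 1.2 \<or> \<bar>Im t\<bar> \<ge> 1.2")
      case True
      have "\<bar>Im s + Im t\<bar> \<ge> 1.2" using True \<open>Im s * Im t \<ge> 0\<close>
        by (auto simp: zero_le_mult_iff)
      then have "norm (s - cnj t) \<ge> 1.2"
        using abs_Im_le_cmod[of "s - cnj t"] by simp
      then have "norm B \<ge> 2.4" using B by linarith
      then have "?J \<ge> 64 * (?P * (2 * m / 8) * (2.4 / 8) * (4 / 8) * (2 * m / 8))"
        using m mA mD C4 by (intro ratio) auto
      moreover have "64 * (m * 2.4 * (2 * m / 8) * (2.4 / 8) * (4 / 8) * (2 * m / 8)) \<le>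
          64 * (?P * (2 * m / 8) * (2.4 / 8) * (4 / 8) * (2 * m / 8))"
        using m sep(1) st by (intro mult_mono mult_nonneg_nonneg order_refl) auto
      ultimately show ?thesis by (simp add: power3_eq_cube)
    next
      case False
      have re26: "Re w \<ge> 2" if "\<bar>Im w\<bar> < 1.2" "Re w \<ge> 0" "norm (w - 1) \<ge> 2" for w
      proof (rule ccontr)
        assume "\<not> ?thesis"
        then have "\<bar>Re w - 1\<bar> \<le> 1" using that by auto
        then have "(Re w - 1)\<^sup>2 \<le> 1" by (simp add: abs_square_le_1)
        moreover have "(Im w)\<^sup>2 \<le> 1.2\<^sup>2" using that by (intro abs_le_square_iff[THEN iffD1]) auto
        moreover have "(norm (w - 1))\<^sup>2 \<ge> 2\<^sup>2" using that by (intro power_mono) auto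
        ultimately show False unfolding cmod_power2 by (simp add: power2_eq_square)
      qed
      have "Re s \<ge> 2" "Re t \<ge> 2" using False re far by (auto intro!: re26)
      then have "norm (s + cnj t) \<ge> 4" using complex_Re_le_cmod[of "s + cnj t"] by simp
      then have AD: "norm A \<ge> 4" "norm D \<ge> 4" using A D by linarith+
      then have "?J \<ge> 64 * (?P * (4 / 8) * (2 * m / 8) * (4 / 8) * (4 / 8))"
        using m mB C4 by (intro ratio) auto
      moreover have "64 * (m * 2.4 * (4 / 8) * (2 * m / 8) * (4 / 8) * (4 / 8)) \<le>
          64 * (?P * (4 / 8) * (2 * m / 8) * (4 / 8) * (4 / 8))"
        using m sep(1) st by (intro mult_mono mult_nonneg_nonneg order_refl) auto
      ultimately have "?J \<ge> 24 / 5 * m\<^sup>2" by (simp add: power2_eq_square)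
      then show ?thesis using pow m zero_le_power2[of m] by linarith
    qed
  next
    case False
    have imt: "Im s * Im t < 0" using False by simp
    have "(norm (s + cnj t))\<^sup>2 \<ge> 6"
      using imt re_mult fs(3) ft(3) unfolding cmod_power2 by (simp add: power2_eq_square algebra_simps)
    then have "norm (s + cnj t) \<ge> 2.4" by (intro sq6) auto
    then have AD: "norm A \<ge> 4" "norm D \<ge> 4" using A D by linarith+
    have prod: "?P \<ge> 1.7 * m"
    proof -
      have "norm (s - t) + norm (s + t) \<ge> norm ((s - t) + (s + t))" by (rule norm_triangle_ineq)
      moreover have "(s - t) + (s + t) = 2 * s" by simp
      ultimately have "norm (s - t) + norm (s + t) \<ge> 2 * norm s"
        by (simp add: norm_mult)
      moreover have "norm s \<ge> 1.7"
        using fs(3) by (intro power2_le_imp_le[of "1.7"]) (auto simp: power2_eq_square)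
      ultimately consider "norm (s - t) \<ge> 1.7" | "norm (s + t) \<ge> 1.7" by linarith
      then show ?thesis
      proof cases
        case 1
        then show ?thesis using sep m by (intro mult_mono) auto
      next
        case 2
        have "?P \<ge> m * 1.7"
          using 2 sep m by (intro mult_mono) auto
        then show ?thesis by simp
      qed
    qed
    have "?J \<ge> 64 * (?P * (4 / 8) * (2 * m / 8) * (2 * m / 8) * (4 / 8))"
      using m mB mC AD by (intro ratio) auto
    moreover have "64 * ((1.7 * m) * (4 / 8) * (2 * m / 8) * (2 * m / 8) * (4 / 8)) \<le>
        64 * (?P * (4 / 8) * (2 * m / 8) * (2 * m / 8) * (4 / 8))"
      using m by (intro mult_left_mono mult_right_mono prod) auto
    ultimately have "?J \<ge> 17 / 10 * m ^ 3" by (simp add: power3_eq_cube)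
    moreover have "m ^ 3 \<ge> 0" using m by simp
    ultimately show ?thesis by linarith
  qed
qed

section \<open>Orders, discriminants and reduction\<close>

lemma lattice_spanI: "of_int m * a + of_int n * b \<in> lattice_span a b"
  unfolding lattice_span_def by blast

lemma lattice_spanE:
  assumes "x \<in> lattice_span a b"
  obtains m n :: int where "x = of_int m * a + of_int n * b"
  using assms unfolding lattice_span_def by blast

lemma int_coeffs_eq:
  assumes "Im t \<noteq> 0" "of_int m + of_int n * t = of_int m' + of_int n' * t"
  shows "m = m'" "n = n'"
proof -
  show n: "n = n'" using arg_cong[OF assms(2), of Im] assms(1) by simp
  show "m = m'" using assms(2) unfolding n by simp
qed

lemma primitive_quadratic:
  assumes "imag_quadratic t"
  obtains a b c :: int where "a > 0" "gcd a (gcd b c) = 1" "of_int a * t\<^sup>2 + of_int b * t + of_int c = 0"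
proof -
  from assms obtain a b c :: int where abc: "a \<noteq> 0" "of_int a * t\<^sup>2 + of_int b * t + of_int c = 0"
    unfolding imag_quadratic_def by blast
  define g where "g = gcd a (gcd b c)"
  have g: "g > 0" using abc by (simp add: g_def)
  define a' b' c' where "a' = a div g" and "b' = b div g" and "c' = c div g"
  have div: "a = g * a'" "b = g * b'" "c = g * c'"
    by (simp_all add: a'_def b'_def c'_def g_def gcd_dvdI2)
  have "g * gcd a' (gcd b' c') = g"
    using g unfolding div by (metis div g_def gcd_mult_distrib_int abs_of_pos)
  then have gcd: "gcd a' (gcd b' c') = 1" using g by simp
  have "of_int g * (of_int a' * t\<^sup>2 + of_int b' * t + of_int c') = 0"
    using abc(2) unfolding div by (simp add: algebra_simps)
  then have eq: "of_int a' * t\<^sup>2 + of_int b' * t + of_int c' = 0" using g by simp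
  show ?thesis
  proof (cases "a' > 0")
    case True
    then show ?thesis using that[of a' b' c'] gcd eq by simp
  next
    case False
    then have "-a' > 0" using div abc by auto
    moreover have "of_int (-a') * t\<^sup>2 + of_int (-b') * t + of_int (-c') = - (of_int a' * t\<^sup>2 + of_int b' * t + of_int c')"
      by simp
    ultimately show ?thesis using that[of "-a'" "-b'" "-c'"] gcd eq by simp
  qed
qed

text \<open>A multiplier of the lattice has the form \<open>m + n * t\<close>. Applying it to
  \<open>t\<close> and reducing by the quadratic equation forces \<open>a\<close> to divide
  \<open>n * b\<close> and \<open>n * c\<close>, and primitivity of the form then gives
  \<open>a dvd n\<close>. Conversely \<open>a * t\<close> maps \<open>t\<close> into the lattice
  because \<open>a * t^2 = - b * t - c\<close>.\<close>

lemma endo_ring_lattice_span: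
  fixes a b c :: int
  assumes "Im t > 0" "a > 0" "gcd a (gcd b c) = 1" "of_int a * t\<^sup>2 + of_int b * t + of_int c = 0"
  shows "endo_ring (lattice_span 1 t) = lattice_span 1 (of_int a * t)"
proof (intro equalityI subsetI)
  have at2: "of_int a * t\<^sup>2 = - of_int b * t - of_int c"
    using assms(4) by (simp add: algebra_simps eq_neg_iff_add_eq_0)
  fix x assume "x \<in> lattice_span 1 (of_int a * t)"
  then obtain m n where x: "x = of_int m + of_int n * (of_int a * t)"
    by (elim lattice_spanE) simp
  show "x \<in> endo_ring (lattice_span 1 t)"
    unfolding endo_ring_def
  proof safe
    fix w assume "w \<in> lattice_span 1 t"
    then obtain k l where w: "w = of_int k + of_int l * t" by (elim lattice_spanE) simp
    have "x * w = of_int (m * k) + of_int (m * l + n * a * k) * t + of_int (n * l) * (of_int a * t\<^sup>2)"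
      unfolding x w by (simp add: algebra_simps power2_eq_square)
    also have "\<dots> = of_int (m * k - n * l * c) * 1 + of_int (m * l + n * a * k - n * l * b) * t"
      unfolding at2 by (simp add: algebra_simps)
    finally show "x * w \<in> lattice_span 1 t" by (simp only: lattice_spanI)
  qed
next
  have at2: "of_int a * t\<^sup>2 = - of_int b * t - of_int c"
    using assms(4) by (simp add: algebra_simps eq_neg_iff_add_eq_0)
  fix x assume x: "x \<in> endo_ring (lattice_span 1 t)"
  have "1 \<in> lattice_span 1 t" "t \<in> lattice_span 1 t"
    using lattice_spanI[of 1 1 0 t] lattice_spanI[of 0 1 1 t] by simp_all
  then have "x * 1 \<in> lattice_span 1 t" "x * t \<in> lattice_span 1 t"
    using x unfolding endo_ring_def by blast+
  then obtain m n k l where mn: "x = of_int m + of_int n * t" and kl: "x * t = of_int k + of_int l * t"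
    by (elim lattice_spanE) auto
  have "of_int a * (x * t) = of_int (m * a) * t + of_int n * (of_int a * t\<^sup>2)"
    unfolding mn by (simp add: algebra_simps power2_eq_square)
  then have "of_int (- n * c) + of_int (m * a - n * b) * t = of_int a * (x * t)"
    unfolding at2 by (simp add: algebra_simps)
  also have "\<dots> = of_int (a * k) + of_int (a * l) * t"
    unfolding kl by (simp add: algebra_simps)
  finally have eq: "of_int (- n * c) + of_int (m * a - n * b) * t = of_int (a * k) + of_int (a * l) * t" .
  have "Im t \<noteq> 0" using assms(1) by simp
  note int_coeffs_eq[OF this eq]
  then have "n * c = a * (- k)" "n * b = a * (m - l)" by (simp_all add: algebra_simps)
  then have "a dvd n * c" "a dvd n * b" by (metis dvd_triv_left)+
  then have "a dvd gcd (n * b) (n * c)" by simp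
  then have "a dvd \<bar>n\<bar> * gcd b c" by (simp add: gcd_mult_distrib_int)
  moreover have "coprime a (gcd b c)" using assms(3) by (simp add: coprime_iff_gcd_eq_1)
  ultimately have "a dvd n" by (simp add: coprime_dvd_mult_left_iff)
  then obtain n' where "n = a * n'" ..
  then have "x = of_int m * 1 + of_int n' * (of_int a * t)" using mn by simp
  then show "x \<in> lattice_span 1 (of_int a * t)" by (simp only: lattice_spanI)
qed

text \<open>The content is uniqueness for \<open>THE\<close>: two pairs of generators of one lattice
  express each other, so the change matrix is invertible over the integers and its determinant has
  square 1.\<close>

lemma order_discriminant_lattice_span:
  assumes "Im w1 \<noteq> 0" "of_int D = (1 * cnj w1 - w1 * cnj 1)\<^sup>2"
  shows "order_discriminant (lattice_span 1 w1) = D"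
  unfolding order_discriminant_def
proof (rule the_equality)
  show "\<exists>x y. lattice_span 1 w1 = lattice_span x y \<and> of_int D = (x * cnj y - y * cnj x)\<^sup>2"
    using assms by blast
next
  fix D' assume "\<exists>x y. lattice_span 1 w1 = lattice_span x y \<and> of_int D' = (x * cnj y - y * cnj x)\<^sup>2"
  then obtain x y where span: "lattice_span 1 w1 = lattice_span x y"
    and D': "of_int D' = (x * cnj y - y * cnj x)\<^sup>2" by blast
  have "x \<in> lattice_span x y" "y \<in> lattice_span x y"
    using lattice_spanI[of 1 x 0 y] lattice_spanI[of 0 x 1 y] by simp_all
  then have "x \<in> lattice_span 1 w1" "y \<in> lattice_span 1 w1" using span by simp_all
  then obtain p q r s where x: "x = of_int p + of_int q * w1" and y: "y = of_int r + of_int s * w1"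
    by (elim lattice_spanE) simp
  have "1 \<in> lattice_span 1 w1" "w1 \<in> lattice_span 1 w1"
    using lattice_spanI[of 1 1 0 w1] lattice_spanI[of 0 1 1 w1] by simp_all
  then have "1 \<in> lattice_span x y" "w1 \<in> lattice_span x y" using span by simp_all
  then obtain p' q' r' s' where 1: "1 = of_int p' * x + of_int q' * y"
    and w1: "w1 = of_int r' * x + of_int s' * y"
    by (elim lattice_spanE)
  have "of_int 1 + of_int 0 * w1 = of_int (p' * p + q' * r) + of_int (p' * q + q' * s) * w1"
    using 1 unfolding x y by (simp add: algebra_simps)
  note e1 = int_coeffs_eq[OF assms(1) this]
  have "of_int 0 + of_int 1 * w1 = of_int (r' * p + s' * r) + of_int (r' * q + s' * s) * w1"
    using w1 unfolding x y by (simp add: algebra_simps)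
  note e2 = int_coeffs_eq[OF assms(1) this]
  have "(p' * s' - q' * r') * (p * s - q * r) = (p' * p + q' * r) * (r' * q + s' * s) - (p' * q + q' * s) * (r' * p + s' * r)"
    by algebra
  also have "\<dots> = 1" unfolding e1[symmetric] e2[symmetric] by simp
  finally have "p * s - q * r dvd 1" by (metis dvd_triv_right)
  then have "\<bar>p * s - q * r\<bar>\<^sup>2 = 1" by simp
  then have sq: "(p * s - q * r)\<^sup>2 = 1" by (simp only: power2_abs)
  have "x * cnj y - y * cnj x = of_int (p * s - q * r) * (1 * cnj w1 - w1 * cnj 1)"
    unfolding x y by (simp add: algebra_simps)
  then have "of_int D' = (of_int ((p * s - q * r)\<^sup>2) :: complex) * of_int D"
    unfolding D' assms(2) by (simp add: power_mult_distrib)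
  then show "D' = D" unfolding sq by simp
qed

lemma quadratic_disc:
  fixes a b c :: int
  assumes "Im t > 0" "a > 0" "of_int a * t\<^sup>2 + of_int b * t + of_int c = 0"
  shows "Re t = - b / (2 * a)" "4 * (a * Im t)\<^sup>2 = 4 * a * c - b\<^sup>2" "a * (norm t)\<^sup>2 = c"
proof -
  have "Im (of_int a * t\<^sup>2 + of_int b * t + of_int c) = 0" "Re (of_int a * t\<^sup>2 + of_int b * t + of_int c) = 0"
    using assms by simp_all
  then have "Im t * (2 * a * Re t + b) = 0" and re: "a * ((Re t)\<^sup>2 - (Im t)\<^sup>2) + b * Re t + c = 0"
    by (simp_all add: power2_eq_square algebra_simps)
  then have b: "of_int b = - 2 * a * Re t" using assms by (simp add: add_eq_0_iff)
  show "Re t = - b / (2 * a)" using b assms by (simp add: field_simps)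
  have c: "c = a * ((Re t)\<^sup>2 + (Im t)\<^sup>2)" using re unfolding b by (simp add: power2_eq_square algebra_simps)
  show "4 * (a * Im t)\<^sup>2 = 4 * a * c - b\<^sup>2" by (simp add: b c power2_eq_square algebra_simps)
  show "a * (norm t)\<^sup>2 = c" unfolding c cmod_power2 by simp
qed

lemma order_discriminant_endo_ring:
  fixes a b c :: int
  assumes "Im t > 0" "a > 0" "gcd a (gcd b c) = 1" "of_int a * t\<^sup>2 + of_int b * t + of_int c = 0"
  shows "order_discriminant (endo_ring (lattice_span 1 t)) = b\<^sup>2 - 4 * a * c"
proof -
  have "1 * cnj (of_int a * t) - of_int a * t * cnj 1 = - 2 * \<i> * of_real (a * Im t)"
    by (simp add: complex_eq_iff)
  also have "\<dots>\<^sup>2 = of_real (- (4 * (a * Im t)\<^sup>2))" by (simp add: power_mult_distrib)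
  also have "\<dots> = of_real (of_int (b\<^sup>2 - 4 * a * c))" using quadratic_disc(2)[OF assms(1,2,4)] by simp
  also have "\<dots> = of_int (b\<^sup>2 - 4 * a * c)" by (simp only: of_real_of_int_eq)
  finally have "of_int (b\<^sup>2 - 4 * a * c) = (1 * cnj (of_int a * t) - of_int a * t * cnj 1)\<^sup>2" ..
  then show ?thesis
    unfolding endo_ring_lattice_span[OF assms]
    using assms by (intro order_discriminant_lattice_span) auto
qed

section \<open>Modular invariance of j and reduction to the fundamental domain\<close>

lemma lattice_span_translate: "lattice_span 1 (t + of_int n) = lattice_span 1 t"
proof (intro equalityI subsetI)
  fix x assume "x \<in> lattice_span 1 (t + of_int n)"
  then obtain k l where "x = of_int k * 1 + of_int l * (t + of_int n)" by (elim lattice_spanE)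
  then have "x = of_int (k + l * n) * 1 + of_int l * t" by (simp add: algebra_simps)
  then show "x \<in> lattice_span 1 t" by (simp only: lattice_spanI)
next
  fix x assume "x \<in> lattice_span 1 t"
  then obtain k l where "x = of_int k * 1 + of_int l * t" by (elim lattice_spanE)
  then have "x = of_int (k - l * n) * 1 + of_int l * (t + of_int n)" by (simp add: algebra_simps)
  then show "x \<in> lattice_span 1 (t + of_int n)" by (simp only: lattice_spanI)
qed

lemma lattice_span_invert:
  assumes "t \<noteq> 0"
  shows "lattice_span 1 t = (\<lambda>x. t * x) ` lattice_span 1 (- 1 / t)"
proof (intro equalityI subsetI)
  fix x assume "x \<in> lattice_span 1 t"
  then obtain k l where "x = of_int k * 1 + of_int l * t" by (elim lattice_spanE)
  then have "x = t * (of_int l * 1 + of_int (-k) * (- 1 / t))" using assms by (simp add: field_simps)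
  then show "x \<in> (\<lambda>x. t * x) ` lattice_span 1 (- 1 / t)" using lattice_spanI by blast
next
  fix x assume "x \<in> (\<lambda>x. t * x) ` lattice_span 1 (- 1 / t)"
  then obtain y where "x = t * y" "y \<in> lattice_span 1 (- 1 / t)" by blast
  from this(2) obtain k l where "y = of_int k * 1 + of_int l * (- 1 / t)" by (elim lattice_spanE)
  then have "x = t * (of_int k * 1 + of_int l * (- 1 / t))" using \<open>x = t * y\<close> by simp
  then have "x = of_int (-l) * 1 + of_int k * t" using assms by (simp add: right_diff_distrib)
  then show "x \<in> lattice_span 1 t" by (simp only: lattice_spanI)
qed

lemma eisenstein_sum_scale:
  fixes L :: "complex set"
  assumes "c \<noteq> 0"
  shows "(\<Sum>\<^sub>\<infinity>w\<in>(\<lambda>x. c * x) ` L - {0}. 1 / w ^ k) = (\<Sum>\<^sub>\<infinity>w\<in>L - {0}. 1 / w ^ k) / c ^ k"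
proof -
  have "(\<lambda>x. c * x) ` L - {0} = (\<lambda>x. c * x) ` (L - {0})" using assms by auto
  moreover have "inj_on (\<lambda>x. c * x) (L - {0})" using assms by (auto simp: inj_on_def)
  ultimately have "(\<Sum>\<^sub>\<infinity>w\<in>(\<lambda>x. c * x) ` L - {0}. 1 / w ^ k) = (\<Sum>\<^sub>\<infinity>w\<in>L - {0}. 1 / (c * w) ^ k)"
    by (simp add: infsum_reindex o_def)
  also have "\<dots> = (\<Sum>\<^sub>\<infinity>w\<in>L - {0}. (1 / w ^ k) * (1 / c ^ k))"
    by (simp add: power_mult_distrib mult_ac)
  also have "\<dots> = (\<Sum>\<^sub>\<infinity>w\<in>L - {0}. 1 / w ^ k) * (1 / c ^ k)"
    by (rule infsum_cmult_left')
  finally show ?thesis by simp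
qed

lemma j_invariant_scale:
  assumes "c \<noteq> 0"
  shows "j_invariant ((\<lambda>x. c * x) ` L) = j_invariant L"
proof -
  have g2: "weierstrass_g2 ((\<lambda>x. c * x) ` L) = weierstrass_g2 L / c ^ 4"
    and g3: "weierstrass_g3 ((\<lambda>x. c * x) ` L) = weierstrass_g3 L / c ^ 6"
    unfolding weierstrass_g2_def weierstrass_g3_def eisenstein_sum_scale[OF assms] by simp_all
  have "1728 * (weierstrass_g2 L / c ^ 4) ^ 3 = (1728 * weierstrass_g2 L ^ 3) / c ^ 12"
    "(weierstrass_g2 L / c ^ 4) ^ 3 - 27 * (weierstrass_g3 L / c ^ 6)\<^sup>2
      = (weierstrass_g2 L ^ 3 - 27 * weierstrass_g3 L ^ 2) / c ^ 12"
    by (simp_all add: power_divide diff_divide_distrib flip: power_mult)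
  then show ?thesis
    unfolding j_invariant_def g2 g3 using assms by simp
qed

lemma klein_j_translate: "klein_j (t + of_int n) = klein_j t"
  unfolding klein_j_def lattice_span_translate ..

lemma klein_j_invert:
  assumes "t \<noteq> 0"
  shows "klein_j (- 1 / t) = klein_j t"
  proof -
  have "klein_j t = j_invariant ((\<lambda>x. t * x) ` lattice_span 1 (- 1 / t))"
    by (simp only: klein_j_def lattice_span_invert[OF assms, symmetric])
  also have "\<dots> = klein_j (- 1 / t)"
    by (simp only: klein_j_def j_invariant_scale[OF assms])
  finally show ?thesis ..
qed

text \<open>Gauss reduction, by induction on the leading coefficient: once the real part is rounded
  away, inverting a point inside the unit circle replaces \<open>a\<close> by
  \<open>a * (norm u)^2\<close>, a smaller positive integer. Both moves preserve
  \<open>klein_j\<close> and the discriminant.\<close>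

lemma reduce_quadratic:
  fixes a b c :: int
  assumes "Im t > 0" "a > 0" "of_int a * t\<^sup>2 + of_int b * t + of_int c = 0"
  shows "\<exists>t' (a'::int) b' c'. Im t' > 0 \<and> a' > 0 \<and> of_int a' * t'\<^sup>2 + of_int b' * t' + of_int c' = 0
    \<and> klein_j t' = klein_j t \<and> b'\<^sup>2 - 4 * a' * c' = b\<^sup>2 - 4 * a * c \<and> \<bar>Re t'\<bar> \<le> 1 / 2 \<and> norm t' \<ge> 1"
  using assms
proof (induction "nat a" arbitrary: t a b c rule: less_induct)
  case less
  define n where "n = round (Re t)"
  define u where "u = t + of_int (- n)"
  define b1 where "b1 = b + 2 * a * n"
  define c1 where "c1 = a * n\<^sup>2 + b * n + c"
  have Im: "Im u > 0" using less by (simp add: u_def)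
  have Re: "\<bar>Re u\<bar> \<le> 1 / 2"
    using of_int_round_abs_le[of "Re t"] by (simp add: u_def n_def abs_minus_commute)
  have "of_int a * u\<^sup>2 + of_int b1 * u + of_int c1 = of_int a * t\<^sup>2 + of_int b * t + of_int c"
    by (simp add: u_def b1_def c1_def power2_eq_square algebra_simps)
  then have eq: "of_int a * u\<^sup>2 + of_int b1 * u + of_int c1 = 0" using less by simp
  have disc: "b1\<^sup>2 - 4 * a * c1 = b\<^sup>2 - 4 * a * c"
    by (simp add: b1_def c1_def power2_eq_square algebra_simps)
  have j: "klein_j u = klein_j t" unfolding u_def by (rule klein_j_translate)
  show ?case
  proof (cases "norm u \<ge> 1")
    case True
    then show ?thesis using less Im Re eq disc j by blast
  next
    case False
    have u0: "u \<noteq> 0" using Im by auto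
    define v where "v = - 1 / u"
    have "Im v = Im u / (norm u)\<^sup>2"
      unfolding v_def by (simp add: Im_divide cmod_power2)
    then have Imv: "Im v > 0" using Im u0 by simp
    have nc: "a * (norm u)\<^sup>2 = c1" using quadratic_disc(3)[OF Im less(3) eq] .
    have "(norm u)\<^sup>2 < 1" using False by (simp add: abs_square_less_1)
    then have "real_of_int a * (norm u)\<^sup>2 < a"
      using mult_strict_left_mono[of "(norm u)\<^sup>2" 1 "real_of_int a"] less by simp
    then have "c1 < a" using nc by simp
    moreover have "real_of_int a * (norm u)\<^sup>2 > 0" using less u0 by simp
    then have "c1 > 0" using nc by simp
    moreover have "of_int c1 * v\<^sup>2 + of_int (- b1) * v + of_int a = (of_int a * u\<^sup>2 + of_int b1 * u + of_int c1) / u\<^sup>2"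
      using u0 by (simp add: v_def power2_eq_square field_simps)
    then have "of_int c1 * v\<^sup>2 + of_int (- b1) * v + of_int a = 0" using eq by simp
    moreover have "klein_j v = klein_j u" unfolding v_def using u0 by (rule klein_j_invert)
    moreover have "nat c1 < nat a" using calculation by simp
    ultimately show ?thesis
      using less(1)[of c1 v "- b1" a] Imv disc j by (simp add: mult.commute mult.left_commute)
  qed
qed

text \<open>The reduction starts from the very point that \<open>SOME\<close> picks in
  \<open>sm_discriminant\<close>. Its primitive form has the discriminant of the endomorphism ring,
  and the reduced form inherits that value.\<close>

lemma singular_modulus_reduced:
  assumes "singular_modulus x"
  obtains t and a b c :: int where "Im t > 0" "a > 0" "of_int a * t\<^sup>2 + of_int b * t + of_int c = 0"
    "\<bar>Re t\<bar> \<le> 1 / 2" "norm t \<ge> 1" "x = klein_j t" "\<bar>sm_discriminant x\<bar> = 4 * a * c - b\<^sup>2"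
proof -
  define t0 where "t0 = (SOME t. imag_quadratic t \<and> x = klein_j t)"
  have "imag_quadratic t0 \<and> x = klein_j t0"
    unfolding t0_def using assms unfolding singular_modulus_def by (rule someI_ex)
  then have t0: "imag_quadratic t0" "x = klein_j t0" by auto
  then have Im: "Im t0 > 0" by (simp add: imag_quadratic_def)
  from t0(1) obtain a b c :: int where abc: "a > 0" "gcd a (gcd b c) = 1" "of_int a * t0\<^sup>2 + of_int b * t0 + of_int c = 0"
    by (rule primitive_quadratic)
  have sm: "sm_discriminant x = b\<^sup>2 - 4 * a * c"
    unfolding sm_discriminant_def t0_def[symmetric] by (rule order_discriminant_endo_ring[OF Im abc])
  have "0 \<le> 4 * (a * Im t0)\<^sup>2" by simp
  also have "\<dots> = real_of_int (4 * a * c - b\<^sup>2)" using quadratic_disc(2)[OF Im abc(1,3)] by simp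
  finally have "0 \<le> 4 * a * c - b\<^sup>2" by (simp only: of_int_0_le_iff)
  then have "\<bar>sm_discriminant x\<bar> = 4 * a * c - b\<^sup>2" unfolding sm by simp
  moreover obtain t and a' b' c' :: int where "Im t > 0" "a' > 0" "of_int a' * t\<^sup>2 + of_int b' * t + of_int c' = 0"
    "klein_j t = klein_j t0" "b'\<^sup>2 - 4 * a' * c' = b\<^sup>2 - 4 * a * c" "\<bar>Re t\<bar> \<le> 1 / 2" "norm t \<ge> 1"
    using reduce_quadratic[OF Im abc(1,3)] by blast
  ultimately show ?thesis using t0(2) that[of t a' b' c'] by simp
qed

section \<open>The Weierstrass function\<close>

lemma UNIV_int_split: "(UNIV :: int set) = range int \<union> range (\<lambda>n. - int n - 1)"
proof -
  have "m \<in> range int \<union> range (\<lambda>n. - int n - 1)" for m :: int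
  proof (cases "m \<ge> 0")
    case True
    then have "m = int (nat m)" by simp
    then show ?thesis by blast
  next
    case False
    then have "m = - int (nat (- m - 1)) - 1" by simp
    then show ?thesis by blast
  qed
  then show ?thesis by blast
qed

lemma summable_on_intI:
  fixes f :: "int \<Rightarrow> real"
  assumes "\<And>m. f m \<ge> 0" "summable (\<lambda>n. f (int n))" "summable (\<lambda>n. f (- int n - 1))"
  shows "f summable_on UNIV"
proof -
  have "(\<lambda>n. f (int n)) summable_on UNIV" "(\<lambda>n. f (- int n - 1)) summable_on UNIV"
    using assms by (auto intro!: norm_summable_imp_summable_on)
  then have "f summable_on range int" "f summable_on range (\<lambda>n. - int n - 1)"
    by (subst summable_on_reindex; simp add: inj_def o_def)+
  then show ?thesis unfolding UNIV_int_split by (rule summable_on_union)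
qed

lemma summable_on_int_powr: "(\<lambda>m::int. (1 + \<bar>m\<bar>) powr (- 3 / 2)) summable_on UNIV"
proof -
  have "summable (\<lambda>n. real n powr (- 3 / 2))" by (subst summable_real_powr_iff) simp
  then have 1: "summable (\<lambda>n. real (Suc n) powr (- 3 / 2))" by (subst summable_Suc_iff)
  then have 2: "summable (\<lambda>n. real (Suc (Suc n)) powr (- 3 / 2))"
    by (subst summable_Suc_iff[of "\<lambda>n. real (Suc n) powr (- 3 / 2)"])
  show ?thesis
    using 1 2 by (intro summable_on_intI) (simp_all add: algebra_simps)
qed

text \<open>Shifted by 1 so that its reciprocal is meaningful at the origin as well; distances to
  lattice points are bounded below by multiples of it.\<close>

definition lat_size :: "int \<times> int \<Rightarrow> real" where
  "lat_size p = 1 + \<bar>fst p\<bar> + \<bar>snd p\<bar>"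

lemma lat_size_ge_1: "lat_size p \<ge> 1" by (simp add: lat_size_def)

text \<open>Both \<open>1 + |m|\<close> and \<open>1 + |n|\<close> are at most the size, so its cube
  dominates the product of their powers with exponent 3/2, and the double series is majorised by a
  product of two convergent ones.\<close>

lemma summable_lat_size: "(\<lambda>p. 1 / lat_size p ^ 3) summable_on UNIV"
proof -
  define g where "g = (\<lambda>m::int. (1 + \<bar>m\<bar>) powr (- 3 / 2))"
  have g: "g summable_on UNIV" unfolding g_def by (rule summable_on_int_powr)
  have "(\<lambda>p. g (fst p) * g (snd p)) summable_on UNIV \<times> UNIV"
  proof (rule summable_on_SigmaI)
    show "((\<lambda>y. g (fst (x, y)) * g (snd (x, y))) has_sum g x * infsum g UNIV) UNIV" for x
      using g by (auto intro!: has_sum_cmult_right)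
    show "(\<lambda>x. g x * infsum g UNIV) summable_on UNIV" using g by (rule summable_on_cmult_left)
  qed (simp add: g_def)
  then have "(\<lambda>p. g (fst p) * g (snd p)) summable_on UNIV" by simp
  then show ?thesis
  proof (rule summable_on_comparison_test)
    fix p :: "int \<times> int"
    define a b where "a = 1 + \<bar>real_of_int (fst p)\<bar>" and "b = 1 + \<bar>real_of_int (snd p)\<bar>"
    have ab: "a \<ge> 1" "b \<ge> 1" by (simp_all add: a_def b_def)
    have "a powr (3/2) * b powr (3/2) \<le> lat_size p powr (3/2) * lat_size p powr (3/2)"
      using ab by (intro mult_mono powr_mono2) (auto simp: a_def b_def lat_size_def)
    also have "\<dots> = lat_size p ^ 3"
      using lat_size_ge_1[of p] by (simp flip: powr_add powr_numeral)
    finally have "1 / lat_size p ^ 3 \<le> 1 / (a powr (3/2) * b powr (3/2))"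
      using ab by (intro divide_left_mono mult_pos_pos) (auto simp: lat_size_def intro!: zero_less_power)
    also have "\<dots> = g (fst p) * g (snd p)"
      unfolding g_def a_def b_def by (simp add: powr_minus_divide)
    finally show "1 / lat_size p ^ 3 \<le> g (fst p) * g (snd p)" .
  qed (simp add: lat_size_def)
qed

lemma finite_lat_size: "finite {p. lat_size p < K}"
proof (rule finite_subset)
  show "{p. lat_size p < K} \<subseteq> {-\<lceil>K\<rceil>..\<lceil>K\<rceil>} \<times> {-\<lceil>K\<rceil>..\<lceil>K\<rceil>}"
    by (auto simp: lat_size_def; linarith)
qed auto

text \<open>The Weierstrass M-test for an unordered sum: the net of finite partial sums converges
  uniformly on the closed ball, since every tail is bounded by the corresponding tail of
  \<open>M\<close>.\<close>

lemma holomorphic_infsum: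
  fixes f :: "'i \<Rightarrow> complex \<Rightarrow> complex"
  assumes M: "M summable_on A" and r: "r > 0"
    and bound: "\<And>i v. i \<in> A \<Longrightarrow> v \<in> cball u r \<Longrightarrow> norm (f i v) \<le> M i"
    and hol: "\<And>i. i \<in> A \<Longrightarrow> f i holomorphic_on cball u r"
  shows "(\<lambda>v. \<Sum>\<^sub>\<infinity>i\<in>A. f i v) holomorphic_on ball u r"
proof -
  have summ: "(\<lambda>i. f i v) summable_on B" "(\<lambda>i. norm (f i v)) summable_on B"
    if "v \<in> cball u r" "B \<subseteq> A" for v B
  proof -
    have "(\<lambda>i. norm (f i v)) summable_on A"
      using M bound that by (intro Infinite_Sum.abs_summable_on_comparison_test'[of M]) auto
    then show "(\<lambda>i. norm (f i v)) summable_on B"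
      using that(2) by (rule summable_on_subset_banach)
    then show "(\<lambda>i. f i v) summable_on B" by (rule abs_summable_summable)
  qed
  have ulim: "uniform_limit (cball u r) (\<lambda>X v. \<Sum>i\<in>X. f i v) (\<lambda>v. \<Sum>\<^sub>\<infinity>i\<in>A. f i v) (finite_subsets_at_top A)"
  proof (rule uniform_limitI)
    fix e :: real assume e: "e > 0"
    have "(sum M \<longlongrightarrow> infsum M A) (finite_subsets_at_top A)"
      using M by (rule infsum_tendsto)
    then have "eventually (\<lambda>X. dist (sum M X) (infsum M A) < e) (finite_subsets_at_top A)"
      using e by (rule tendstoD)
    moreover have "eventually (\<lambda>X. finite X \<and> X \<subseteq> A) (finite_subsets_at_top A)"
      by (rule eventually_finite_subsets_at_top_weakI) auto
    ultimately show "eventually (\<lambda>X. \<forall>v\<in>cball u r. dist (\<Sum>i\<in>X. f i v) (\<Sum>\<^sub>\<infinity>i\<in>A. f i v) < e) (finite_subsets_at_top A)"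
    proof eventually_elim
      case (elim X)
      show ?case
      proof
        fix v assume v: "v \<in> cball u r"
        have A: "A = X \<union> (A - X)" using elim by auto
        have "(\<Sum>\<^sub>\<infinity>i\<in>A. f i v) = (\<Sum>i\<in>X. f i v) + (\<Sum>\<^sub>\<infinity>i\<in>A-X. f i v)"
          using elim summ[OF v] by (subst A, subst infsum_Un_disjoint) auto
        then have "dist (\<Sum>i\<in>X. f i v) (\<Sum>\<^sub>\<infinity>i\<in>A. f i v) = norm (\<Sum>\<^sub>\<infinity>i\<in>A-X. f i v)"
          by (simp add: dist_norm)
        also have "\<dots> \<le> (\<Sum>\<^sub>\<infinity>i\<in>A-X. norm (f i v))"
          using summ[OF v] by (intro norm_infsum_bound) auto
        also have "\<dots> \<le> infsum M (A - X)"
          using summ[OF v] M bound v by (intro infsum_mono summable_on_subset_banach[OF M]) auto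
        also have "\<dots> = infsum M A - sum M X"
        proof -
          have "infsum M A = sum M X + infsum M (A - X)"
            using elim M by (subst A, subst infsum_Un_disjoint) (auto intro: summable_on_subset_banach)
          then show ?thesis by simp
        qed
        also have "\<dots> < e" using elim by (auto simp: dist_real_def)
        finally show "dist (\<Sum>i\<in>X. f i v) (\<Sum>\<^sub>\<infinity>i\<in>A. f i v) < e" .
      qed
    qed
  qed
  have cont: "eventually (\<lambda>X. continuous_on (cball u r) (\<lambda>v. \<Sum>i\<in>X. f i v) \<and> (\<lambda>v. \<Sum>i\<in>X. f i v) holomorphic_on ball u r) (finite_subsets_at_top A)"
  proof (rule eventually_finite_subsets_at_top_weakI)
    fix X assume "finite X" "X \<subseteq> A"
    then have "(\<lambda>v. \<Sum>i\<in>X. f i v) holomorphic_on cball u r"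
      using hol by (intro holomorphic_intros) auto
    then show "continuous_on (cball u r) (\<lambda>v. \<Sum>i\<in>X. f i v) \<and> (\<lambda>v. \<Sum>i\<in>X. f i v) holomorphic_on ball u r"
      using holomorphic_on_imp_continuous_on holomorphic_on_subset ball_subset_cball by blast
  qed
  show ?thesis
    by (rule holomorphic_uniform_limit[OF cont ulim]) auto
qed

section \<open>Period lattices and distances to their points\<close>

definition lat :: "complex \<Rightarrow> int \<times> int \<Rightarrow> complex" where
  "lat \<tau> p = of_int (fst p) + of_int (snd p) * \<tau>"

lemma lattice_span_eq_range: "lattice_span 1 \<tau> = range (lat \<tau>)"
  by (auto simp: lattice_span_def lat_def image_iff) blast

lemma lat_0 [simp]: "lat \<tau> (0, 0) = 0" by (simp add: lat_def)

lemma lat_add: "lat \<tau> (p + q) = lat \<tau> p + lat \<tau> q"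
  by (simp add: lat_def algebra_simps)

lemma lat_uminus: "lat \<tau> (- p) = - lat \<tau> p"
  by (simp add: lat_def)

locale period_lattice =
  fixes \<tau> :: complex
  assumes Im_pos: "Im \<tau> > 0"
begin

abbreviation L where "L \<equiv> lat \<tau>"

lemma lat_eq_iff: "L p = L q \<longleftrightarrow> p = q"
proof
  assume eq: "L p = L q"
  have "snd p = snd q" using arg_cong[OF eq, of Im] Im_pos by (simp add: lat_def)
  moreover from this have "fst p = fst q" using eq by (simp add: lat_def)
  ultimately show "p = q" by (simp add: prod_eq_iff)
qed simp

lemma lat_eq_0_iff: "L p = 0 \<longleftrightarrow> p = (0, 0)"
  using lat_eq_iff[of p "(0, 0)"] by simp

lemma lat_lower_bound:
  obtains c where "c > 0" "\<And>p. norm (L p) \<ge> c * (lat_size p - 1)"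
proof -
  \<comment> \<open>The imaginary part of \<open>m + n * \<tau>\<close> gives
    \<open>|n| <= norm (L p) / Im \<tau>\<close>, and then
    \<open>|m| <= norm (L p) + |n| * norm \<tau>\<close>; \<open>K\<close> adds up the two resulting
    factors.\<close>
  define K where "K = 1 + (norm \<tau> + 1) / Im \<tau>"
  have K: "K > 0" using Im_pos by (auto simp: K_def intro!: add_pos_pos divide_pos_pos add_nonneg_pos)
  have "lat_size p - 1 \<le> K * norm (L p)" for p
  proof -
    have "\<bar>snd p\<bar> * Im \<tau> = \<bar>Im (L p)\<bar>" using Im_pos by (simp add: lat_def abs_mult)
    also have "\<dots> \<le> norm (L p)" by (rule abs_Im_le_cmod)
    finally have n: "\<bar>snd p\<bar> \<le> norm (L p) / Im \<tau>" using Im_pos by (simp add: field_simps)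
    have "\<bar>fst p\<bar> = norm (L p - of_int (snd p) * \<tau>)" by (simp add: lat_def)
    also have "\<dots> \<le> norm (L p) + \<bar>snd p\<bar> * norm \<tau>"
      by (rule order_trans[OF norm_triangle_ineq4]) (simp add: norm_mult)
    also have "\<dots> \<le> norm (L p) + norm (L p) / Im \<tau> * norm \<tau>"
      using n by (intro add_left_mono mult_right_mono) auto
    finally have m: "\<bar>fst p\<bar> \<le> norm (L p) + norm (L p) / Im \<tau> * norm \<tau>" .
    show ?thesis using add_mono[OF m n] Im_pos unfolding lat_size_def K_def by (simp add: field_simps)
  qed
  then show ?thesis using K by (intro that[of "1 / K"]) (auto simp: field_simps)
qed

lemma lat_distance:
  obtains c where "c > 0" "\<And>p. L p \<noteq> u \<Longrightarrow> norm (u - L p) \<ge> c * lat_size p"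
proof -
  obtain c0 where c0: "c0 > 0" "\<And>p. norm (L p) \<ge> c0 * (lat_size p - 1)"
    using lat_lower_bound by blast
  \<comment> \<open>From this size on, \<open>c0 * (lat_size p - 1) - norm u\<close> is at least
    half of \<open>c0 * lat_size p\<close>; the finitely many smaller points enter through a
    minimum.\<close>
  define F where "F = {p. lat_size p < 2 + 2 * norm u / c0} - {p. L p = u}"
  have F: "finite F" unfolding F_def by (intro finite_Diff finite_lat_size)
  define c where "c = Min (insert (c0 / 2) ((\<lambda>p. norm (u - L p) / lat_size p) ` F))"
  have size: "lat_size p > 0" for p using lat_size_ge_1[of p] by simp
  have "c > 0" unfolding c_def
    using F c0 size by (subst Min_gr_iff) (auto simp: F_def intro!: divide_pos_pos)
  moreover have "norm (u - L p) \<ge> c * lat_size p" if "L p \<noteq> u" for p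
  proof (cases "p \<in> F")
    case True
    then have "c \<le> norm (u - L p) / lat_size p" unfolding c_def using F by (intro Min_le) auto
    then show ?thesis using size[of p] by (simp add: field_simps)
  next
    case False
    then have "lat_size p \<ge> 2 + 2 * norm u / c0" using that by (auto simp: F_def)
    then have "c0 * lat_size p \<ge> 2 * c0 + 2 * norm u" using c0 by (simp add: field_simps)
    moreover have "norm (L p) - norm u \<le> norm (u - L p)"
      by (metis norm_minus_commute norm_triangle_ineq2)
    moreover have "c0 * lat_size p - c0 \<le> norm (L p)" using c0(2)[of p] by (simp add: algebra_simps)
    moreover have "c * lat_size p \<le> c0 / 2 * lat_size p"
      unfolding c_def using F size[of p] by (intro mult_right_mono Min_le) auto
    ultimately show ?thesis by (simp add: algebra_simps)
  qed
  ultimately show ?thesis by (rule that)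
qed

lemma lat_distance_uniform:
  obtains c r where "c > 0" "r > 0"
    "\<And>p v. v \<in> cball u r \<Longrightarrow> L p \<noteq> u \<Longrightarrow> norm (v - L p) \<ge> c * lat_size p"
proof -
  obtain c where c: "c > 0" "\<And>p. L p \<noteq> u \<Longrightarrow> norm (u - L p) \<ge> c * lat_size p"
    using lat_distance[of u] by blast
  have "norm (v - L p) \<ge> c / 2 * lat_size p" if "v \<in> cball u (c / 2)" "L p \<noteq> u" for p v
  proof -
    have "norm (u - L p) \<le> norm (u - v) + norm (v - L p)"
      using norm_triangle_ineq[of "u - v" "v - L p"] by simp
    moreover have "norm (u - v) \<le> c / 2 * lat_size p"
    proof -
      have "norm (u - v) \<le> c / 2 * 1" using that by (simp add: dist_norm)
      also have "\<dots> \<le> c / 2 * lat_size p" using c(1) lat_size_ge_1[of p] by (intro mult_left_mono) auto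
      finally show ?thesis .
    qed
    ultimately show ?thesis using c(2)[OF that(2)] by linarith
  qed
  then show ?thesis using c(1) by (intro that[of "c / 2" "c / 2"]) auto
qed

lemma open_lattice_compl: "open (- range L)"
  unfolding open_contains_ball
proof
  fix u assume u: "u \<in> - range L"
  obtain c r where cr: "c > 0" "r > 0"
    "\<And>p v. v \<in> cball u r \<Longrightarrow> L p \<noteq> u \<Longrightarrow> norm (v - L p) \<ge> c * lat_size p"
    using lat_distance_uniform[of u] by blast
  have "v \<noteq> L p" if "v \<in> cball u r" for v p
  proof -
    have "L p \<noteq> u" using u by auto
    then have "norm (v - L p) \<ge> c * lat_size p" using cr(3) that by blast
    moreover have "c * lat_size p > 0" using cr(1) lat_size_ge_1[of p] by simp
    ultimately show ?thesis by auto
  qed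
  then have "ball u r \<subseteq> - range L" using ball_subset_cball[of u r] by blast
  then show "\<exists>e>0. ball u e \<subseteq> - range L"
    using cr(2) by blast
qed


text \<open>Here and below \<open>1 / 0 = 0\<close>: the summand at the origin is \<open>1 / u\<^sup>2\<close>.\<close>

definition wp :: "complex \<Rightarrow> complex" where
  "wp u = (\<Sum>\<^sub>\<infinity>p. 1 / (u - L p)\<^sup>2 - 1 / (L p)\<^sup>2)"

definition wp' :: "complex \<Rightarrow> complex" where
  "wp' u = (\<Sum>\<^sub>\<infinity>p. - 2 / (u - L p) ^ 3)"

definition eis :: "nat \<Rightarrow> complex" where
  "eis k = (\<Sum>\<^sub>\<infinity>p. 1 / L p ^ k)"

text \<open>Subtracting \<open>1 / (L p)^2\<close> improves the decay from the second to the third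
  power of the size, which is what makes the series absolutely convergent. At the origin the
  subtracted term is 0 and the size is 1; this case accounts for the part \<open>1 / c^2\<close> of
  the constant.\<close>

lemma wp_summand_bound:
  assumes c: "c > 0" and v: "norm (v - L p) \<ge> c * lat_size p"
    and p: "L p \<noteq> 0 \<Longrightarrow> norm (L p) \<ge> c * lat_size p"
  shows "norm (1 / (v - L p)\<^sup>2 - 1 / (L p)\<^sup>2) \<le> (2 * norm v / c ^ 3 + 1 / c\<^sup>2) * (1 / lat_size p ^ 3)"
proof (cases "L p = 0")
  case True
  then have 1: "lat_size p = 1" by (simp add: lat_eq_0_iff lat_size_def)
  have "1 / (norm v)\<^sup>2 \<le> 1 / c\<^sup>2"
    using v c True 1 by (intro divide_left_mono power_mono mult_pos_pos zero_less_power) auto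
  moreover have "0 \<le> 2 * norm v / c ^ 3" using c by simp
  ultimately show ?thesis using True 1 by (simp add: norm_divide norm_power)
next
  case False
  define w where "w = L p"
  define n where "n = lat_size p"
  have n: "n \<ge> 1" unfolding n_def by (rule lat_size_ge_1)
  have cn: "0 < c * n" using c n by simp
  have w: "norm w \<ge> c * n" "w \<noteq> 0" and vw: "norm (v - w) \<ge> c * n"
    using p v False by (auto simp: w_def n_def)
  have vw0: "v - w \<noteq> 0" using vw cn by (metis norm_zero not_less)
  have "1 / (v - w)\<^sup>2 - 1 / w\<^sup>2 = - v * (1 / (w\<^sup>2 * (v - w)) - 1 / (w * (v - w)\<^sup>2))"
    using w vw0 by (simp add: divide_simps) algebra
  also have "norm \<dots> \<le> norm v * (1 / ((norm w)\<^sup>2 * norm (v - w)) + 1 / (norm w * (norm (v - w))\<^sup>2))"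
    unfolding norm_mult norm_minus_cancel
    by (intro mult_left_mono order_trans[OF norm_triangle_ineq4]) (auto simp: norm_divide norm_mult norm_power)
  also have "\<dots> \<le> norm v * (1 / ((c * n)\<^sup>2 * (c * n)) + 1 / ((c * n) * (c * n)\<^sup>2))"
    using w vw cn vw0 c n
    by (intro mult_left_mono add_mono divide_left_mono mult_mono power_mono mult_pos_pos) auto
  also have "\<dots> = 2 * norm v / c ^ 3 * (1 / n ^ 3)"
    using c n by (simp add: power2_eq_square power3_eq_cube field_simps)
  also have "\<dots> \<le> (2 * norm v / c ^ 3 + 1 / c\<^sup>2) * (1 / n ^ 3)"
    using c n by (intro mult_right_mono) auto
  finally show ?thesis by (simp add: w_def n_def)
qed

lemma wp'_summand_bound:
  assumes c: "c > 0" and v: "norm (v - L p) \<ge> c * lat_size p"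
  shows "norm (- 2 / (v - L p) ^ 3) \<le> 2 / c ^ 3 * (1 / lat_size p ^ 3)"
proof -
  have "0 < c * lat_size p" using c lat_size_ge_1[of p] by simp
  then have "2 / norm (v - L p) ^ 3 \<le> 2 / (c * lat_size p) ^ 3"
    using v by (intro frac_le power_mono zero_less_power) linarith+
  then show ?thesis by (simp add: norm_divide norm_power power_mult_distrib)
qed

text \<open>A common radius and constant for three estimates. The quadratic one is too weak for a
  sum over the whole lattice; it serves single rows and columns.\<close>

lemma wp_bounds_near:
  assumes "u \<notin> range L"
  obtains K r where "r > 0" "cball u r \<subseteq> - range L"
    "\<And>p v. v \<in> cball u r \<Longrightarrow> norm (1 / (v - L p)\<^sup>2 - 1 / (L p)\<^sup>2) \<le> K * (1 / lat_size p ^ 3)"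
    "\<And>p v. v \<in> cball u r \<Longrightarrow> norm (- 2 / (v - L p) ^ 3) \<le> K * (1 / lat_size p ^ 3)"
    "\<And>p v. v \<in> cball u r \<Longrightarrow> norm (1 / (v - L p)\<^sup>2) \<le> K * (1 / lat_size p ^ 2)"
proof -
  obtain c1 r where c1: "c1 > 0" "r > 0"
    "\<And>p v. v \<in> cball u r \<Longrightarrow> L p \<noteq> u \<Longrightarrow> norm (v - L p) \<ge> c1 * lat_size p"
    using lat_distance_uniform[of u] by blast
  obtain c2 where c2: "c2 > 0" "\<And>p. L p \<noteq> 0 \<Longrightarrow> norm (0 - L p) \<ge> c2 * lat_size p"
    using lat_distance[of 0] by blast
  define c where "c = min c1 c2"
  have c: "c > 0" using c1 c2 by (simp add: c_def)
  have size: "c * lat_size p \<le> c1 * lat_size p" "c * lat_size p \<le> c2 * lat_size p" for p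
    using lat_size_ge_1[of p] by (auto simp: c_def intro!: mult_right_mono)
  have 1: "norm (v - L p) \<ge> c * lat_size p" if "v \<in> cball u r" for v p
  proof -
    have "L p \<noteq> u" using assms by auto
    then show ?thesis using c1(3)[OF that, of p] size(1)[of p] by linarith
  qed
  have 2: "norm (L p) \<ge> c * lat_size p" if "L p \<noteq> 0" for p
    using c2(2)[OF that] size(2)[of p] by simp
  define K where "K = (2 * (norm u + r) / c ^ 3 + 1 / c\<^sup>2) + 2 / c ^ 3"
  have "v \<notin> range L" if "v \<in> cball u r" for v
  proof
    assume "v \<in> range L"
    then obtain p where "v = L p" by blast
    then have "c * lat_size p \<le> 0" using 1[OF that, of p] by simp
    then show False using c lat_size_ge_1[of p] by (simp add: mult_le_0_iff)
  qed
  then have "cball u r \<subseteq> - range L" by blast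
  moreover have "norm (1 / (v - L p)\<^sup>2 - 1 / (L p)\<^sup>2) \<le> K * (1 / lat_size p ^ 3)" if "v \<in> cball u r" for p v
  proof -
    have "norm v \<le> norm u + r" using that norm_triangle_ineq3[of v u] by (auto simp: dist_norm norm_minus_commute)
    then have "2 * norm v / c ^ 3 + 1 / c\<^sup>2 \<le> K"
      unfolding K_def using c by (simp add: divide_right_mono add_increasing2)
    then have "(2 * norm v / c ^ 3 + 1 / c\<^sup>2) * (1 / lat_size p ^ 3) \<le> K * (1 / lat_size p ^ 3)"
      using lat_size_ge_1[of p] by (intro mult_right_mono) auto
    then show ?thesis using wp_summand_bound[OF c 1[OF that] 2] by (rule order_trans[rotated])
  qed
  moreover have "norm (- 2 / (v - L p) ^ 3) \<le> K * (1 / lat_size p ^ 3)" if "v \<in> cball u r" for p v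
  proof -
    have "2 / c ^ 3 * (1 / lat_size p ^ 3) \<le> K * (1 / lat_size p ^ 3)"
      unfolding K_def using lat_size_ge_1[of p] c c1(2) by (intro mult_right_mono) (auto intro!: add_increasing)
    then show ?thesis using wp'_summand_bound[OF c 1[OF that]] by (rule order_trans[rotated])
  qed
  moreover have "norm (1 / (v - L p)\<^sup>2) \<le> K * (1 / lat_size p ^ 2)" if "v \<in> cball u r" for p v
  proof -
    have "0 < c * lat_size p" using c lat_size_ge_1[of p] by simp
    then have "1 / norm (v - L p) ^ 2 \<le> 1 / (c * lat_size p) ^ 2"
      using 1[OF that, of p] by (intro frac_le power_mono zero_less_power) linarith+
    also have "\<dots> = 1 / c\<^sup>2 * (1 / lat_size p ^ 2)" by (simp add: power_mult_distrib)
    also have "\<dots> \<le> K * (1 / lat_size p ^ 2)"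
      unfolding K_def using lat_size_ge_1[of p] c c1(2) by (intro mult_right_mono) (auto intro!: add_increasing add_increasing2)
    finally show ?thesis by (simp add: norm_divide norm_power)
  qed
  ultimately show ?thesis using that[of r K] c1(2) by blast
qed

lemma summable_wp:
  assumes "u \<notin> range L"
  shows "(\<lambda>p. 1 / (u - L p)\<^sup>2 - 1 / (L p)\<^sup>2) summable_on A" "(\<lambda>p. - 2 / (u - L p) ^ 3) summable_on A"
proof -
  from assms obtain K r where *: "r > 0"
    "\<And>p v. v \<in> cball u r \<Longrightarrow> norm (1 / (v - L p)\<^sup>2 - 1 / (L p)\<^sup>2) \<le> K * (1 / lat_size p ^ 3)"
    "\<And>p v. v \<in> cball u r \<Longrightarrow> norm (- 2 / (v - L p) ^ 3) \<le> K * (1 / lat_size p ^ 3)"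
    by (rule wp_bounds_near) blast
  have u: "u \<in> cball u r" using * by simp
  have M: "(\<lambda>p. K * (1 / lat_size p ^ 3)) summable_on UNIV"
    using summable_lat_size by (rule summable_on_cmult_right)
  have "(\<lambda>p. 1 / (u - L p)\<^sup>2 - 1 / (L p)\<^sup>2) summable_on UNIV"
    by (rule abs_summable_summable, rule Infinite_Sum.abs_summable_on_comparison_test'[OF M], rule *(2)[OF u])
  then show "(\<lambda>p. 1 / (u - L p)\<^sup>2 - 1 / (L p)\<^sup>2) summable_on A"
    by (rule summable_on_subset_banach) simp
  have "(\<lambda>p. - 2 / (u - L p) ^ 3) summable_on UNIV"
    by (rule abs_summable_summable, rule Infinite_Sum.abs_summable_on_comparison_test'[OF M], rule *(3)[OF u])
  then show "(\<lambda>p. - 2 / (u - L p) ^ 3) summable_on A"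
    by (rule summable_on_subset_banach) simp
qed

lemma holomorphic_wp: "wp holomorphic_on - range L" "wp' holomorphic_on - range L"
proof -
  have M: "(\<lambda>p. K * (1 / lat_size p ^ 3)) summable_on UNIV" for K
    using summable_lat_size by (rule summable_on_cmult_right)
  have "wp holomorphic_on ball u r \<and> wp' holomorphic_on ball u r"
    if "r > 0" "cball u r \<subseteq> - range L"
    "\<And>p v. v \<in> cball u r \<Longrightarrow> norm (1 / (v - L p)\<^sup>2 - 1 / (L p)\<^sup>2) \<le> K * (1 / lat_size p ^ 3)"
    "\<And>p v. v \<in> cball u r \<Longrightarrow> norm (- 2 / (v - L p) ^ 3) \<le> K * (1 / lat_size p ^ 3)" for u r K
  proof -
    have 0: "v - L p \<noteq> 0" if "v \<in> cball u r" for v p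
      using that \<open>cball u r \<subseteq> - range L\<close> by auto
    have c: "(\<lambda>v. 1 / (L p)\<^sup>2) holomorphic_on cball u r" for p by (rule holomorphic_on_const)
    have "wp holomorphic_on ball u r"
      unfolding wp_def[abs_def] using 0 that
      by (intro holomorphic_infsum[OF M]) (auto intro!: holomorphic_on_diff[OF _ c] holomorphic_intros)
    moreover have "wp' holomorphic_on ball u r"
      unfolding wp'_def[abs_def] using 0 that
      by (intro holomorphic_infsum[OF M]) (auto intro!: holomorphic_intros)
    ultimately show ?thesis ..
  qed
  then have "\<exists>r>0. wp holomorphic_on ball u r \<and> wp' holomorphic_on ball u r" if "u \<notin> range L" for u
    using wp_bounds_near[OF that] by metis
  then have "wp field_differentiable (at u)" "wp' field_differentiable (at u)" if "u \<notin> range L" for u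
    using that by (metis centre_in_ball holomorphic_on_imp_differentiable_at open_ball)+
  then show "wp holomorphic_on - range L" "wp' holomorphic_on - range L"
    by (auto simp: holomorphic_on_def intro: field_differentiable_at_within)
qed

end

section \<open>Liouville's theorem and periodicity\<close>

lemma lat_diff: "lat \<tau> (p - q) = lat \<tau> p - lat \<tau> q"
  by (simp add: lat_def algebra_simps)

lemma infsum_diff_complex:
  fixes f g :: "'i \<Rightarrow> complex"
  assumes "f summable_on A" "g summable_on A"
  shows "(\<Sum>\<^sub>\<infinity>i\<in>A. f i - g i) = infsum f A - infsum g A" "(\<lambda>i. f i - g i) summable_on A"
proof -
  have "(\<lambda>i. - g i) summable_on A" using assms(2) by (simp add: summable_on_uminus)
  then have "(\<Sum>\<^sub>\<infinity>i\<in>A. f i + - g i) = infsum f A + (\<Sum>\<^sub>\<infinity>i\<in>A. - g i)" "(\<lambda>i. f i + - g i) summable_on A"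
    using infsum_add[OF assms(1)] summable_on_add[OF assms(1)] by blast+
  then show "(\<Sum>\<^sub>\<infinity>i\<in>A. f i - g i) = infsum f A - infsum g A" "(\<lambda>i. f i - g i) summable_on A"
    by (simp_all add: infsum_uminus)
qed

text \<open>Liouville's theorem for elliptic functions. The limit removes the singularity at 0, the
  periods carry this to every lattice point, and the entire extension is bounded because all its
  values occur on a compact period parallelogram.\<close>

lemma (in period_lattice) elliptic_const:
  assumes hol: "f holomorphic_on - range L"
    and per: "\<And>u. u \<notin> range L \<Longrightarrow> f (u + 1) = f u" "\<And>u. u \<notin> range L \<Longrightarrow> f (u + \<tau>) = f u"
    and lim: "(f \<longlongrightarrow> l) (at 0)"
    and u: "u \<notin> range L"
  shows "f u = l"
proof -
  define g where "g = (\<lambda>u. if u \<in> range L then l else f u)"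
  have lat_shift: "u + L q \<in> range L \<longleftrightarrow> u \<in> range L" for u q
  proof
    assume "u + L q \<in> range L"
    then obtain p where "u + L q = L p" by blast
    then have "u = L (p - q)" by (simp add: lat_diff eq_diff_eq)
    then show "u \<in> range L" by blast
  next
    assume "u \<in> range L"
    then obtain p where "u = L p" by blast
    then have "u + L q = L (p + q)" by (simp add: lat_add)
    then show "u + L q \<in> range L" by blast
  qed
  have g1: "g (u + 1) = g u" for u
    using lat_shift[of u "(1, 0)"] per(1)[of u] by (simp add: g_def lat_def)
  have g2: "g (u + \<tau>) = g u" for u
    using lat_shift[of u "(0, 1)"] per(2)[of u] by (simp add: g_def lat_def)
  have g1n: "g (u + of_nat n) = g u" for u n
  proof (induction n)
    case (Suc n)
    have "u + of_nat (Suc n) = (u + of_nat n) + 1" by simp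
    then show ?case using Suc g1 by metis
  qed simp
  have g2n: "g (u + of_nat n * \<tau>) = g u" for u n
  proof (induction n)
    case (Suc n)
    have "u + of_nat (Suc n) * \<tau> = (u + of_nat n * \<tau>) + \<tau>" by (simp add: algebra_simps)
    then show ?case using Suc g2 by metis
  qed simp
  have g1z: "g (u + of_int m) = g u" for u m
    using g1n[of u "nat m"] g1n[of "u + of_int m" "nat (- m)"] by (cases "m \<ge> 0") auto
  have g2z: "g (u + of_int m * \<tau>) = g u" for u m
    using g2n[of u "nat m"] g2n[of "u + of_int m * \<tau>" "nat (- m)"] by (cases "m \<ge> 0") auto
  have glat: "g (u + L p) = g u" for u p
    unfolding lat_def add.assoc[symmetric] g2z g1z ..
  obtain r where r: "r > 0" "\<And>v. v \<in> cball 0 r \<Longrightarrow> v \<noteq> 0 \<Longrightarrow> v \<notin> range L"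
  proof -
    obtain c r where cr: "c > 0" "r > 0"
      "\<And>p v. v \<in> cball 0 r \<Longrightarrow> L p \<noteq> 0 \<Longrightarrow> norm (v - L p) \<ge> c * lat_size p"
      using lat_distance_uniform[of 0] by blast
    have "v \<noteq> L p" if "v \<in> cball 0 r" "v \<noteq> 0" for v p
    proof
      assume v: "v = L p"
      then have "norm (v - L p) \<ge> c * lat_size p" using cr(3) that by blast
      moreover have "c * lat_size p > 0" using cr(1) lat_size_ge_1[of p] by simp
      ultimately show False using v by auto
    qed
    then show ?thesis using that[of r] cr(2) by blast
  qed
  have "ball 0 r - {0} \<subseteq> - range L"
  proof
    fix v :: complex assume "v \<in> ball 0 r - {0}"
    then show "v \<in> - range L" using r(2)[of v] by simp
  qed
  then have "(\<lambda>y. if y = 0 then l else f y) holomorphic_on ball 0 r"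
    using lim holomorphic_on_subset[OF hol] by (intro removable_singularity) auto
  moreover have "(if v = 0 then l else f v) = g v" if "v \<in> ball 0 r" for v
  proof (cases "v = 0")
    case True
    then have "v \<in> range L" using lat_0[of \<tau>] by (metis rangeI)
    then show ?thesis using True by (simp add: g_def)
  next
    case False
    then have "v \<notin> range L" using that r(2) by simp
    then show ?thesis using False by (simp add: g_def)
  qed
  ultimately have "g holomorphic_on ball 0 r" by (rule holomorphic_transform)
  then have g0: "g field_differentiable at 0"
    by (rule holomorphic_on_imp_differentiable_at) (use r(1) in auto)
  have "g field_differentiable at u" for u
  proof (cases "u \<in> range L")
    case True
    then obtain p where p: "u = L p" by blast
    have "g = g \<circ> (\<lambda>v. v + L (- p))" using glat by (auto simp: o_def)
    moreover have "g \<circ> (\<lambda>v. v + L (- p)) field_differentiable at u"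
      using g0 by (intro field_differentiable_compose) (auto simp: p lat_uminus intro!: derivative_intros)
    ultimately show ?thesis by simp
  next
    case False
    have "g holomorphic_on - range L"
      using hol by (rule holomorphic_transform) (auto simp: g_def)
    then show ?thesis using False open_lattice_compl holomorphic_on_imp_differentiable_at by blast
  qed
  then have holg: "g holomorphic_on UNIV"
    by (auto simp: holomorphic_on_def intro: field_differentiable_at_within)
  have "bounded (range g)"
  proof -
    define S where "S = (\<lambda>(s, t). complex_of_real s + of_real t * \<tau>) ` ({0..1} \<times> {0..1})"
    have "compact S" unfolding S_def case_prod_beta
      by (intro compact_continuous_image continuous_intros compact_Times) auto
    moreover have "continuous_on S g"
      using holg holomorphic_on_imp_continuous_on continuous_on_subset by blast
    ultimately have "bounded (g ` S)"
      by (intro compact_imp_bounded compact_continuous_image)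
    moreover have "g u \<in> g ` S" for u
    proof -
      define t where "t = Im u / Im \<tau>"
      define s where "s = Re u - t * Re \<tau>"
      have "u = of_real s + of_real t * \<tau>"
        using Im_pos by (simp add: complex_eq_iff s_def t_def)
      then have "u = (of_real (frac s) + of_real (frac t) * \<tau>) + L (\<lfloor>s\<rfloor>, \<lfloor>t\<rfloor>)"
        by (simp add: frac_def lat_def algebra_simps)
      then have "g u = g (of_real (frac s) + of_real (frac t) * \<tau>)" by (metis glat)
      moreover have "of_real (frac s) + of_real (frac t) * \<tau> \<in> S"
        unfolding S_def by (intro image_eqI[of _ _ "(frac s, frac t)"]) (auto simp: frac_lt_1 less_imp_le)
      ultimately show ?thesis by (metis imageI)
    qed
    ultimately show ?thesis by (auto intro: bounded_subset)
  qed
  then have "g constant_on UNIV" using holg by (intro Liouville_theorem)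
  then have "g u = g 0" by (auto simp: constant_on_def)
  moreover have "0 \<in> range L" using lat_0[of \<tau>] by (metis rangeI)
  ultimately show ?thesis using u by (simp add: g_def)
qed

lemma summable_on_int_inverse_square: "(\<lambda>m::int. 1 / (1 + \<bar>real_of_int m\<bar>)\<^sup>2) summable_on UNIV"
proof (rule summable_on_comparison_test[OF summable_on_int_powr])
  fix m :: int
  have "1 / (1 + \<bar>real_of_int m\<bar>)\<^sup>2 = (1 + \<bar>m\<bar>) powr (- 2)"
    by (simp add: powr_minus_divide)
  also have "\<dots> \<le> (1 + \<bar>m\<bar>) powr (- 3 / 2)" by (intro powr_mono) auto
  finally show "1 / (1 + \<bar>real_of_int m\<bar>)\<^sup>2 \<le> (1 + \<bar>m\<bar>) powr (- 3 / 2)" by simp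
qed auto

text \<open>Shifting the integer index permutes each row. The sum is taken row by row because
  \<open>h\<close> is assumed summable only along rows, while its differences are summable over all
  pairs.\<close>

lemma infsum_int_telescope:
  fixes h :: "int \<Rightarrow> 'b \<Rightarrow> complex"
  assumes "\<And>n. (\<lambda>m. h m n) summable_on UNIV"
    and "(\<lambda>(n, m). h (m - 1) n - h m n) summable_on UNIV"
  shows "(\<Sum>\<^sub>\<infinity>(n, m). h (m - 1) n - h m n) = 0"
proof -
  have shift: "(\<Sum>\<^sub>\<infinity>m. h (m - 1) n) = (\<Sum>\<^sub>\<infinity>m. h m n)" "(\<lambda>m. h (m - 1) n) summable_on UNIV" for n
  proof -
    show "(\<Sum>\<^sub>\<infinity>m. h (m - 1) n) = (\<Sum>\<^sub>\<infinity>m. h m n)"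
      by (rule infsum_reindex_bij_witness[of _ "\<lambda>m. m + 1" "\<lambda>m. m - 1"]) auto
    show "(\<lambda>m. h (m - 1) n) summable_on UNIV"
      using assms(1)[of n] by (subst summable_on_reindex_bij_witness[of _ "\<lambda>m. m + 1" "\<lambda>m. m - 1"]) auto
  qed
  have "(\<Sum>\<^sub>\<infinity>(n, m). h (m - 1) n - h m n) = (\<Sum>\<^sub>\<infinity>n. \<Sum>\<^sub>\<infinity>m. h (m - 1) n - h m n)"
    using assms(2) infsum_Sigma'_banach[of "\<lambda>n m. h (m - 1) n - h m n" UNIV "\<lambda>_. UNIV"] by simp
  also have "(\<Sum>\<^sub>\<infinity>m. h (m - 1) n - h m n) = 0" for n
    using shift[of n] assms(1)[of n] by (subst infsum_diff_complex) auto
  then have "(\<Sum>\<^sub>\<infinity>n. \<Sum>\<^sub>\<infinity>m. h (m - 1) n - h m n) = 0" by simp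
  finally show ?thesis .
qed

context period_lattice
begin

lemma not_lat_add:
  assumes "u \<notin> range L"
  shows "u + L q \<notin> range L"
proof
  assume "u + L q \<in> range L"
  then obtain p where "u + L q = L p" by blast
  then have "u = L (p - q)" by (simp add: lat_diff eq_diff_eq)
  then show False using assms by blast
qed

lemma not_lat_uminus:
  assumes "u \<notin> range L"
  shows "- u \<notin> range L"
proof
  assume "- u \<in> range L"
  then obtain p where "- u = L p" by blast
  then have "u = L (- p)" by (metis lat_uminus minus_minus)
  then show False using assms by blast
qed

lemma inverse_square_bound:
  assumes "u \<notin> range L"
  obtains K where "\<And>p. norm (1 / (u - L p)\<^sup>2) \<le> K * (1 / lat_size p ^ 2)"
proof -
  from assms obtain K r where "r > 0"
    "\<And>p v. v \<in> cball u r \<Longrightarrow> norm (1 / (v - L p)\<^sup>2) \<le> K * (1 / lat_size p ^ 2)"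
    by (rule wp_bounds_near) blast
  then show ?thesis using that[of K] by simp
qed

lemma summable_inverse_square:
  assumes "u \<notin> range L"
  shows "(\<lambda>m. 1 / (u - L (m, n))\<^sup>2) summable_on UNIV" "(\<lambda>n. 1 / (u - L (m, n))\<^sup>2) summable_on UNIV"
proof -
  obtain K where K: "\<And>p. norm (1 / (u - L p)\<^sup>2) \<le> K * (1 / lat_size p ^ 2)"
    using inverse_square_bound[OF assms] by blast
  have K0: "K \<ge> 0" using order_trans[OF norm_ge_zero K[of "(0, 0)"]] by (simp add: lat_size_def)
  have le: "K * (1 / (lat_size p)\<^sup>2) \<le> K * (1 / (1 + \<bar>real_of_int (fst p)\<bar>)\<^sup>2)"
    "K * (1 / (lat_size p)\<^sup>2) \<le> K * (1 / (1 + \<bar>real_of_int (snd p)\<bar>)\<^sup>2)" for p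
    using K0 by (auto intro!: mult_left_mono divide_left_mono power_mono simp: lat_size_def zero_less_mult_iff)
  have M: "(\<lambda>m::int. K * (1 / (1 + \<bar>real_of_int m\<bar>)\<^sup>2)) summable_on UNIV"
    using summable_on_int_inverse_square by (rule summable_on_cmult_right)
  show "(\<lambda>m. 1 / (u - L (m, n))\<^sup>2) summable_on UNIV"
    using order_trans[OF K le(1)]
    by (intro abs_summable_summable[OF Infinite_Sum.abs_summable_on_comparison_test'[OF M]]) (metis fst_conv)
  show "(\<lambda>n. 1 / (u - L (m, n))\<^sup>2) summable_on UNIV"
    using order_trans[OF K le(2)]
    by (intro abs_summable_summable[OF Infinite_Sum.abs_summable_on_comparison_test'[OF M]]) (metis snd_conv)
qed

lemma wp_diff:
  assumes "u \<notin> range L" "v \<notin> range L"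
  shows "(\<lambda>p. 1 / (u - L p)\<^sup>2 - 1 / (v - L p)\<^sup>2) summable_on UNIV"
    and "wp u - wp v = (\<Sum>\<^sub>\<infinity>p. 1 / (u - L p)\<^sup>2 - 1 / (v - L p)\<^sup>2)"
proof -
  note s = summable_wp(1)[OF assms(1), of UNIV] summable_wp(1)[OF assms(2), of UNIV]
  show "(\<lambda>p. 1 / (u - L p)\<^sup>2 - 1 / (v - L p)\<^sup>2) summable_on UNIV"
    using infsum_diff_complex(2)[OF s] by simp
  show "wp u - wp v = (\<Sum>\<^sub>\<infinity>p. 1 / (u - L p)\<^sup>2 - 1 / (v - L p)\<^sup>2)"
    unfolding wp_def using infsum_diff_complex(1)[OF s] by simp
qed

lemma infsum_swap_pair:
  fixes f :: "'x \<times> 'y \<Rightarrow> complex"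
  shows "(\<Sum>\<^sub>\<infinity>p. f p) = (\<Sum>\<^sub>\<infinity>(n, m). f (m, n))" "f summable_on UNIV \<longleftrightarrow> (\<lambda>(n, m). f (m, n)) summable_on UNIV"
proof -
  show "(\<Sum>\<^sub>\<infinity>p. f p) = (\<Sum>\<^sub>\<infinity>(n, m). f (m, n))"
    by (rule infsum_reindex_bij_witness[of _ prod.swap prod.swap]) auto
  show "f summable_on UNIV \<longleftrightarrow> (\<lambda>(n, m). f (m, n)) summable_on UNIV"
    by (rule summable_on_reindex_bij_witness[of _ prod.swap prod.swap]) auto
qed

text \<open>Adding a period to \<open>u\<close> shifts one index of the lattice, so the difference
  of the two series telescopes: along \<open>m\<close> for the period 1 and along \<open>n\<close>
  for \<open>\<tau>\<close>.\<close>

lemma wp_periodic: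
  assumes u: "u \<notin> range L"
  shows "wp (u + 1) = wp u" "wp (u + \<tau>) = wp u"
proof -
  define h where "h m n = 1 / (u - L (m, n))\<^sup>2" for m n
  have u1: "u + 1 \<notin> range L" using not_lat_add[OF u, of "(1, 0)"] by (simp add: lat_def)
  have ut: "u + \<tau> \<notin> range L" using not_lat_add[OF u, of "(0, 1)"] by (simp add: lat_def)
  have e1: "(\<lambda>p. 1 / (u + 1 - L p)\<^sup>2 - 1 / (u - L p)\<^sup>2) = (\<lambda>(m, n). h (m - 1) n - h m n)"
    by (auto simp: h_def lat_def fun_eq_iff algebra_simps)
  have et: "(\<lambda>p. 1 / (u + \<tau> - L p)\<^sup>2 - 1 / (u - L p)\<^sup>2) = (\<lambda>(m, n). h m (n - 1) - h m n)"
    by (auto simp: h_def lat_def fun_eq_iff algebra_simps)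
  have "(\<Sum>\<^sub>\<infinity>(n, m). h (m - 1) n - h m n) = 0"
    by (rule infsum_int_telescope)
      (use wp_diff(1)[OF u1 u] summable_inverse_square(1)[OF u] in
        \<open>simp_all add: e1 infsum_swap_pair(2)[of "\<lambda>(m, n). h (m - 1) n - h m n"] flip: h_def\<close>)
  then show "wp (u + 1) = wp u"
    using wp_diff(2)[OF u1 u] unfolding e1 infsum_swap_pair(1)[of "\<lambda>(m, n). h (m - 1) n - h m n"] by simp
  have "(\<Sum>\<^sub>\<infinity>(m, n). h m (n - 1) - h m n) = 0"
    by (rule infsum_int_telescope[of "\<lambda>n m. h m n"])
      (use wp_diff(1)[OF ut u] summable_inverse_square(2)[OF u] in \<open>simp_all add: et flip: h_def\<close>)
  then show "wp (u + \<tau>) = wp u"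
    using wp_diff(2)[OF ut u] unfolding et by simp
qed

lemma wp'_periodic: "wp' (u + L q) = wp' u"
proof -
  have eq: "u + L q - L p = u - L (p - q)" for p by (simp add: lat_diff)
  show ?thesis
    unfolding wp'_def eq by (rule infsum_reindex_bij_witness[of _ "\<lambda>p. p + q" "\<lambda>p. p - q"]) simp_all
qed

lemma wp_even: "wp (- u) = wp u"
proof -
  have "(- u - L p)\<^sup>2 = (u - L (- p))\<^sup>2" "(L p)\<^sup>2 = (L (- p))\<^sup>2" for p
    by (simp_all add: lat_uminus power2_eq_square algebra_simps)
  then show ?thesis
    unfolding wp_def by (intro infsum_reindex_bij_witness[of _ uminus uminus]) auto
qed

lemma wp'_odd: "wp' (- u) = - wp' u"
proof -
  have "(\<Sum>\<^sub>\<infinity>p. - 2 / (- u - L p) ^ 3) = (\<Sum>\<^sub>\<infinity>p. - (- 2 / (u - L p) ^ 3))"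
  proof (rule infsum_reindex_bij_witness[of _ uminus uminus])
    fix p
    have "(- u - L p) = - (u - L (- p))" by (simp add: lat_uminus)
    then have "(- u - L p) ^ 3 = - ((u - L (- p)) ^ 3)" by (metis power_minus_odd odd_numeral)
    then show "- (- 2 / (u - L (- p)) ^ 3) = - 2 / (- u - L p) ^ 3" by simp
  qed auto
  then show ?thesis unfolding wp'_def by (simp only: infsum_uminus)
qed

end

section \<open>Laurent expansions at 0 and the differential equation\<close>

lemma inverse_powers_bound:
  fixes x y :: real
  assumes "0 < c" "1 \<le> n" "c * n \<le> x" "c * n \<le> y" "i + j = 7"
  shows "1 / (x ^ i * y ^ j) \<le> 1 / c ^ 7 * (1 / n ^ 3)"
proof -
  have cn: "0 < c * n" using assms by simp
  have "c ^ 7 * n ^ 3 \<le> c ^ 7 * n ^ 7"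
    using assms by (intro mult_left_mono power_increasing) auto
  also have "\<dots> = (c * n) ^ (i + j)" unfolding assms(5) by (simp add: power_mult_distrib)
  also have "\<dots> = (c * n) ^ i * (c * n) ^ j" by (simp add: power_add)
  also have "\<dots> \<le> x ^ i * y ^ j"
    using assms cn by (intro mult_mono power_mono zero_le_power) linarith+
  finally have le: "c ^ 7 * n ^ 3 \<le> x ^ i * y ^ j" .
  have "1 / (x ^ i * y ^ j) \<le> 1 / (c ^ 7 * n ^ 3)"
    by (rule frac_le) (use le assms in auto)
  then show ?thesis by simp
qed

lemma has_sum_linear5:
  fixes f :: "'i \<Rightarrow> complex"
  assumes "(f has_sum S) A" "(g1 has_sum S1) A" "(g2 has_sum S2) A" "(g3 has_sum S3) A" "(g4 has_sum S4) A"
  shows "((\<lambda>p. f p - (c1 * g1 p + c2 * g2 p + c3 * g3 p + c4 * g4 p)) has_sum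
     (S - (c1 * S1 + c2 * S2 + c3 * S3 + c4 * S4))) A"
proof -
  have "((\<lambda>p. c1 * g1 p + c2 * g2 p + c3 * g3 p + c4 * g4 p) has_sum (c1 * S1 + c2 * S2 + c3 * S3 + c4 * S4)) A"
    using assms by (intro has_sum_add has_sum_cmult_right)
  then have "((\<lambda>p. - (c1 * g1 p + c2 * g2 p + c3 * g3 p + c4 * g4 p)) has_sum - (c1 * S1 + c2 * S2 + c3 * S3 + c4 * S4)) A"
    by (simp only: has_sum_uminus minus_minus)
  from has_sum_add[OF assms(1) this] show ?thesis by (simp only: diff_conv_add_uminus)
qed

context period_lattice
begin

lemma summable_eis:
  assumes "k \<ge> 3"
  shows "(\<lambda>p. 1 / L p ^ k) summable_on UNIV"
proof -
  obtain c where c: "c > 0" "\<And>p. L p \<noteq> 0 \<Longrightarrow> norm (0 - L p) \<ge> c * lat_size p"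
    using lat_distance[of 0] by blast
  have M: "(\<lambda>p. 1 / c ^ k * (1 / lat_size p ^ 3)) summable_on UNIV"
    using summable_lat_size by (rule summable_on_cmult_right)
  show ?thesis
  proof (intro abs_summable_summable[OF Infinite_Sum.abs_summable_on_comparison_test'[OF M]])
    fix p
    note n = lat_size_ge_1[of p]
    show "norm (1 / L p ^ k) \<le> 1 / c ^ k * (1 / lat_size p ^ 3)"
    proof (cases "L p = 0")
      case True
      then show ?thesis using assms c n by (simp add: power_0_left)
    next
      case False
      then have "c * lat_size p \<le> norm (L p)" using c(2) by simp
      then have "(c * lat_size p) ^ k \<le> norm (L p) ^ k" using c n by (intro power_mono) auto
      moreover have "c ^ k * lat_size p ^ 3 \<le> c ^ k * lat_size p ^ k"
        using c n assms by (intro mult_left_mono power_increasing) auto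
      ultimately have le: "c ^ k * lat_size p ^ 3 \<le> norm (L p) ^ k" by (simp add: power_mult_distrib)
      have "1 / norm (L p) ^ k \<le> 1 / (c ^ k * lat_size p ^ 3)"
        by (rule frac_le) (use le c n in auto)
      then show ?thesis by (simp add: norm_divide norm_power)
    qed
  qed
qed

lemma eis_odd:
  assumes "odd k"
  shows "eis k = 0"
proof -
  have "eis k = (\<Sum>\<^sub>\<infinity>p. - (1 / L p ^ k))"
    unfolding eis_def
  proof (rule infsum_reindex_bij_witness[of _ uminus uminus])
    show "- (1 / L (- p) ^ k) = 1 / L p ^ k" for p
      using assms by (simp add: lat_uminus power_minus_odd)
  qed auto
  also have "\<dots> = - eis k" unfolding eis_def by (rule infsum_uminus)
  finally show ?thesis by simp
qed

lemma eis_has_sum: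
  assumes "k \<ge> 3"
  shows "((\<lambda>p. 1 / L p ^ k) has_sum eis k) (UNIV - {(0, 0)})"
proof -
  have "((\<lambda>p. 1 / L p ^ k) has_sum eis k) UNIV"
    unfolding eis_def using summable_eis[OF assms] by (rule has_sum_infsum)
  then show ?thesis
    using assms by (subst has_sum_cong_neutral[of UNIV _ _ "\<lambda>p. 1 / L p ^ k"]) auto
qed

lemma weierstrass_g_eis:
  "weierstrass_g2 (lattice_span 1 \<tau>) = 60 * eis 4" "weierstrass_g3 (lattice_span 1 \<tau>) = 140 * eis 6"
proof -
  have "(\<Sum>\<^sub>\<infinity>w\<in>lattice_span 1 \<tau> - {0}. 1 / w ^ k) = eis k" if "k \<ge> 3" for k
  proof -
    have "lattice_span 1 \<tau> - {0} = L ` (UNIV - {(0, 0)})"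
      unfolding lattice_span_eq_range using lat_eq_0_iff by auto
    moreover have "inj_on L (UNIV - {(0, 0)})" using lat_eq_iff by (auto intro: inj_onI)
    ultimately show ?thesis
      using infsumI[OF eis_has_sum[OF that]] by (simp add: infsum_reindex o_def)
  qed
  then show "weierstrass_g2 (lattice_span 1 \<tau>) = 60 * eis 4" "weierstrass_g3 (lattice_span 1 \<tau>) = 140 * eis 6"
    unfolding weierstrass_g2_def weierstrass_g3_def by simp_all
qed

text \<open>Each summand is expanded in powers of \<open>u / L p\<close> and the expansion is summed
  over the lattice, where odd weights give 0. Orders 5 and 4 are the precision at which the errors,
  multiplied by the poles \<open>1 / u^4\<close> and \<open>1 / u^3\<close> of the differential
  equation, still tend to 0.\<close>

lemma wp_laurent:
  obtains K r where "r > 0"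
    "\<And>u. 0 < norm u \<Longrightarrow> norm u \<le> r \<Longrightarrow> norm (wp u - 1 / u\<^sup>2 - (3 * eis 4 * u\<^sup>2 + 5 * eis 6 * u ^ 4)) \<le> K * norm u ^ 5"
    "\<And>u. 0 < norm u \<Longrightarrow> norm u \<le> r \<Longrightarrow> norm (wp' u + 2 / u ^ 3 - (6 * eis 4 * u + 20 * eis 6 * u ^ 3)) \<le> K * norm u ^ 4"
proof -
  obtain c r where cr: "c > 0" "r > 0"
    "\<And>p v. v \<in> cball 0 r \<Longrightarrow> L p \<noteq> 0 \<Longrightarrow> norm (v - L p) \<ge> c * lat_size p"
    using lat_distance_uniform[of 0] by blast
  define A where "A = UNIV - {(0, 0) :: int \<times> int}"
  define q where "q p = 1 / c ^ 7 * (1 / lat_size p ^ 3)" for p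
  define M where "M = infsum q A"
  have M: "(q has_sum M) A"
    unfolding M_def q_def[abs_def]
    by (intro has_sum_infsum summable_on_subset_banach[OF summable_on_cmult_right[OF summable_lat_size]]) simp
  have "M \<ge> 0" unfolding M_def q_def using cr lat_size_ge_1
    by (intro infsum_nonneg) (auto simp: lat_size_def)
  have A0: "L p \<noteq> 0" if "p \<in> A" for p using that by (auto simp: A_def lat_eq_0_iff)
  have wp: "norm (wp u - 1 / u\<^sup>2 - (3 * eis 4 * u\<^sup>2 + 5 * eis 6 * u ^ 4)) \<le> 30 * M * norm u ^ 5
     \<and> norm (wp' u + 2 / u ^ 3 - (6 * eis 4 * u + 20 * eis 6 * u ^ 3)) \<le> 30 * M * norm u ^ 4"
    if u: "0 < norm u" "norm u \<le> r" for u
  proof -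
    have low: "c * lat_size p \<le> norm (L p)" "c * lat_size p \<le> norm (L p - u)" "L p - u \<noteq> 0"
      if "p \<in> A" for p
    proof -
      show "c * lat_size p \<le> norm (L p)" using cr(3)[of 0 p] A0[OF that] cr(2) by simp
      show *: "c * lat_size p \<le> norm (L p - u)"
        using cr(3)[of u p] A0[OF that] u by (simp add: norm_minus_commute)
      have "0 < c * lat_size p" using cr lat_size_ge_1[of p] by simp
      then show "L p - u \<noteq> 0" using * by auto
    qed
    have u_notin: "u \<notin> range L"
    proof
      assume "u \<in> range L"
      then obtain p where p: "u = L p" by blast
      then have "p \<in> A" using u(1) by (auto simp: A_def)
      then show False using low(3)[of p] p by simp
    qed
    have UN: "UNIV = insert (0, 0) A" by (auto simp: A_def)
    have s: "((\<lambda>p. 1 / (u - L p)\<^sup>2 - 1 / (L p)\<^sup>2) has_sum (wp u - 1 / u\<^sup>2)) A"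
    proof -
      have "wp u = 1 / u\<^sup>2 + (\<Sum>\<^sub>\<infinity>p\<in>A. 1 / (u - L p)\<^sup>2 - 1 / (L p)\<^sup>2)"
        unfolding wp_def UN using summable_wp(1)[OF u_notin] by (subst infsum_insert) (auto simp: A_def)
      then show ?thesis using has_sum_infsum[OF summable_wp(1)[OF u_notin, of A]] by simp
    qed
    have s': "((\<lambda>p. - 2 / (u - L p) ^ 3) has_sum (wp' u + 2 / u ^ 3)) A"
    proof -
      have "wp' u = - 2 / u ^ 3 + (\<Sum>\<^sub>\<infinity>p\<in>A. - 2 / (u - L p) ^ 3)"
        unfolding wp'_def UN using summable_wp(2)[OF u_notin] by (subst infsum_insert) (auto simp: A_def)
      then show ?thesis using has_sum_infsum[OF summable_wp(2)[OF u_notin, of A]] by simp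
    qed
    have e: "((\<lambda>p. 1 / L p ^ 3) has_sum 0) A" "((\<lambda>p. 1 / L p ^ 4) has_sum eis 4) A"
      "((\<lambda>p. 1 / L p ^ 5) has_sum 0) A" "((\<lambda>p. 1 / L p ^ 6) has_sum eis 6) A"
      using eis_has_sum[of 3] eis_has_sum[of 4] eis_has_sum[of 5] eis_has_sum[of 6]
      by (simp_all add: A_def eis_odd)
    note sum1 = has_sum_linear5[OF s e, of "2 * u" "3 * u\<^sup>2" "4 * u ^ 3" "5 * u ^ 4"]
    note sum2 = has_sum_linear5[OF s' e, of "2" "6 * u" "12 * u\<^sup>2" "20 * u ^ 3"]
    have bound1: "norm (1 / (u - L p)\<^sup>2 - 1 / (L p)\<^sup>2 -
        (2 * u * (1 / L p ^ 3) + 3 * u\<^sup>2 * (1 / L p ^ 4) + 4 * u ^ 3 * (1 / L p ^ 5) + 5 * u ^ 4 * (1 / L p ^ 6)))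
       \<le> 30 * norm u ^ 5 * q p" if p: "p \<in> A" for p
    proof -
      define w where "w = L p"
      define d where "d = w - u"
      have w: "w \<noteq> 0" and d: "d \<noteq> 0" using A0[OF p] low(3)[OF p] by (auto simp: w_def d_def)
      have u_eq: "u = w - d" by (simp add: d_def)
      have "1 / (u - w)\<^sup>2 - 1 / w\<^sup>2 - (2 * u * (1 / w ^ 3) + 3 * u\<^sup>2 * (1 / w ^ 4) + 4 * u ^ 3 * (1 / w ^ 5) + 5 * u ^ 4 * (1 / w ^ 6))
        = (1 / d\<^sup>2 - 1 / w\<^sup>2 - (2 * u * (1 / w ^ 3) + 3 * u\<^sup>2 * (1 / w ^ 4) + 4 * u ^ 3 * (1 / w ^ 5) + 5 * u ^ 4 * (1 / w ^ 6)))"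
        by (simp add: d_def power2_commute)
      \<comment> \<open>The exact Taylor remainder of \<open>1 / (w - u)^2\<close>. All its terms
        have total degree 7 in \<open>w\<close> and \<open>d\<close>, the form that
        \<open>inverse_powers_bound\<close> reduces to the summable cube; the same holds for the
        cubic series below.\<close>
      also have "\<dots> = u ^ 5 * (5 * (1 / (w ^ 6 * d ^ 1)) + 1 / (w ^ 5 * d ^ 2))"
        unfolding u_eq using w d by (simp add: divide_simps) algebra
      also have "norm \<dots> = norm u ^ 5 * norm (5 * (1 / (w ^ 6 * d ^ 1)) + 1 / (w ^ 5 * d ^ 2))"
        by (simp only: norm_mult norm_power)
      also have "\<dots> \<le> norm u ^ 5 * (5 * (1 / (norm w ^ 6 * norm d ^ 1)) + 1 / (norm w ^ 5 * norm d ^ 2))"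
        by (intro mult_left_mono order_trans[OF norm_triangle_ineq]) (auto simp: norm_mult norm_divide norm_power)
      also have "\<dots> \<le> norm u ^ 5 * (5 * q p + q p)"
        unfolding q_def using low[OF p] cr(1) lat_size_ge_1[of p]
        by (intro mult_left_mono add_mono inverse_powers_bound) (auto simp: w_def d_def)
      also have "\<dots> \<le> 30 * norm u ^ 5 * q p"
      proof -
        have "0 \<le> norm u ^ 5 * q p" using cr(1) lat_size_ge_1[of p] by (simp add: q_def)
        then show ?thesis by (simp add: algebra_simps)
      qed
      finally show ?thesis by (simp only: w_def)
    qed
    have bound2: "norm (- 2 / (u - L p) ^ 3 -
        (2 * (1 / L p ^ 3) + 6 * u * (1 / L p ^ 4) + 12 * u\<^sup>2 * (1 / L p ^ 5) + 20 * u ^ 3 * (1 / L p ^ 6)))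
       \<le> 30 * norm u ^ 4 * q p" if p: "p \<in> A" for p
    proof -
      define w where "w = L p"
      define d where "d = w - u"
      have w: "w \<noteq> 0" and d: "d \<noteq> 0" using A0[OF p] low(3)[OF p] by (auto simp: w_def d_def)
      have u_eq: "u = w - d" by (simp add: d_def)
      have "(u - w) ^ 3 = - (d ^ 3)" by (simp add: d_def power3_eq_cube algebra_simps)
      then have "- 2 / (u - w) ^ 3 - (2 * (1 / w ^ 3) + 6 * u * (1 / w ^ 4) + 12 * u\<^sup>2 * (1 / w ^ 5) + 20 * u ^ 3 * (1 / w ^ 6))
        = (2 / d ^ 3 - (2 * (1 / w ^ 3) + 6 * u * (1 / w ^ 4) + 12 * u\<^sup>2 * (1 / w ^ 5) + 20 * u ^ 3 * (1 / w ^ 6)))"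
        by simp
      also have "\<dots> = u ^ 4 * (20 * (1 / (w ^ 6 * d ^ 1)) + (8 * (1 / (w ^ 5 * d ^ 2)) + 2 * (1 / (w ^ 4 * d ^ 3))))"
        unfolding u_eq using w d by (simp add: divide_simps) algebra
      also have "norm \<dots> = norm u ^ 4 * norm (20 * (1 / (w ^ 6 * d ^ 1)) + (8 * (1 / (w ^ 5 * d ^ 2)) + 2 * (1 / (w ^ 4 * d ^ 3))))"
        by (simp only: norm_mult norm_power)
      also have "\<dots> \<le> norm u ^ 4 * (20 * (1 / (norm w ^ 6 * norm d ^ 1)) + (8 * (1 / (norm w ^ 5 * norm d ^ 2)) + 2 * (1 / (norm w ^ 4 * norm d ^ 3))))"
        by (intro mult_left_mono norm_triangle_le add_mono) (auto simp: norm_mult norm_divide norm_power)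
      also have "\<dots> \<le> norm u ^ 4 * (20 * q p + (8 * q p + 2 * q p))"
        unfolding q_def using low[OF p] cr(1) lat_size_ge_1[of p]
        by (intro mult_left_mono add_mono inverse_powers_bound) (auto simp: w_def d_def)
      also have "\<dots> = 30 * norm u ^ 4 * q p"
        by (simp add: algebra_simps)
      finally show ?thesis by (simp only: w_def)
    qed
    show ?thesis
    proof
      have "norm (wp u - 1 / u\<^sup>2 - (2 * u * 0 + 3 * u\<^sup>2 * eis 4 + 4 * u ^ 3 * 0 + 5 * u ^ 4 * eis 6)) \<le> 30 * norm u ^ 5 * M"
        by (rule norm_infsum_le[OF sum1 has_sum_cmult_right[OF M] bound1])
      then show "norm (wp u - 1 / u\<^sup>2 - (3 * eis 4 * u\<^sup>2 + 5 * eis 6 * u ^ 4)) \<le> 30 * M * norm u ^ 5"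
        by (simp add: mult_ac)
      have "norm (wp' u + 2 / u ^ 3 - (2 * 0 + 6 * u * eis 4 + 12 * u\<^sup>2 * 0 + 20 * u ^ 3 * eis 6)) \<le> 30 * norm u ^ 4 * M"
        by (rule norm_infsum_le[OF sum2 has_sum_cmult_right[OF M] bound2])
      then show "norm (wp' u + 2 / u ^ 3 - (6 * eis 4 * u + 20 * eis 6 * u ^ 3)) \<le> 30 * M * norm u ^ 4"
        by (simp add: mult_ac)
    qed
  qed
  then show ?thesis using that[of r "30 * M"] cr(2) by blast
qed

text \<open>The difference of the two sides is elliptic and tends to 0 at the origin, hence
  vanishes; 60 and 140 are the coefficients for which the pole and the constant term cancel.\<close>

lemma wp_ode:
  assumes "u \<notin> range L"
  shows "(wp' u)\<^sup>2 = 4 * wp u ^ 3 - 60 * eis 4 * wp u - 140 * eis 6"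
proof -
  define h where "h u = (wp' u)\<^sup>2 - 4 * wp u ^ 3 + 60 * eis 4 * wp u + 140 * eis 6" for u
  have "h u = 0"
  proof (rule elliptic_const[OF _ _ _ _ assms])
    show "h holomorphic_on - range L"
      unfolding h_def[abs_def] by (intro holomorphic_intros holomorphic_wp)
    show "h (u + 1) = h u" if "u \<notin> range L" for u
      using wp_periodic(1)[OF that] wp'_periodic[of u "(1, 0)"] by (simp add: h_def lat_def)
    show "h (u + \<tau>) = h u" if "u \<notin> range L" for u
      using wp_periodic(2)[OF that] wp'_periodic[of u "(0, 1)"] by (simp add: h_def lat_def)
    obtain K r where Kr: "r > 0"
      "\<And>u. 0 < norm u \<Longrightarrow> norm u \<le> r \<Longrightarrow> norm (wp u - 1 / u\<^sup>2 - (3 * eis 4 * u\<^sup>2 + 5 * eis 6 * u ^ 4)) \<le> K * norm u ^ 5"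
      "\<And>u. 0 < norm u \<Longrightarrow> norm u \<le> r \<Longrightarrow> norm (wp' u + 2 / u ^ 3 - (6 * eis 4 * u + 20 * eis 6 * u ^ 3)) \<le> K * norm u ^ 4"
      by (rule wp_laurent) blast
    define G4 G6 where "G4 = eis 4" and "G6 = eis 6"
    define x where "x u = (wp u - 1 / u\<^sup>2 - (3 * G4 * u\<^sup>2 + 5 * G6 * u ^ 4)) / u ^ 4" for u
    define y where "y u = (wp' u + 2 / u ^ 3 - (6 * G4 * u + 20 * G6 * u ^ 3)) / u ^ 3" for u
    have ev: "eventually (\<lambda>u. 0 < norm u \<and> norm u \<le> r) (at (0::complex))"
      unfolding eventually_at using Kr(1) by (intro exI[of _ r]) (auto simp: dist_norm)
    have lim0: "((\<lambda>u. K * norm u) \<longlongrightarrow> 0) (at (0::complex))"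
      by (rule tendsto_eq_intros refl tendsto_norm_zero | simp)+
    have "eventually (\<lambda>u. norm (x u) \<le> K * norm u) (at 0)"
      using ev
    proof eventually_elim
      case (elim u)
      have "norm (x u) \<le> (K * norm u ^ 5) / norm u ^ 4"
        unfolding x_def norm_divide norm_power G4_def G6_def
        using Kr(2)[of u] elim by (intro divide_right_mono) auto
      also have "\<dots> = K * norm u" using elim by (simp add: field_simps eval_nat_numeral)
      finally show ?case .
    qed
    then have x: "(x \<longlongrightarrow> 0) (at 0)" using lim0 by (rule Lim_null_comparison)
    have "eventually (\<lambda>u. norm (y u) \<le> K * norm u) (at 0)"
      using ev
    proof eventually_elim
      case (elim u)
      have "norm (y u) \<le> (K * norm u ^ 4) / norm u ^ 3"
        unfolding y_def norm_divide norm_power G4_def G6_def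
        using Kr(3)[of u] elim by (intro divide_right_mono) auto
      also have "\<dots> = K * norm u" using elim by (simp add: field_simps eval_nat_numeral)
      finally show ?case .
    qed
    then have y: "(y \<longlongrightarrow> 0) (at 0)" using lim0 by (rule Lim_null_comparison)
    \<comment> \<open>Chosen so that \<open>wp u = 1 / u^2 + u^2 * a u\<close> and
      \<open>wp' u = - 2 / u^3 + u * b u\<close>, with \<open>a\<close> and \<open>b\<close>
      convergent at 0. After substitution the negative powers of \<open>u\<close> cancel, and
      \<open>g\<close> is what remains of \<open>h\<close>.\<close>
    define a where "a u = 3 * G4 + 5 * G6 * u\<^sup>2 + u\<^sup>2 * x u" for u
    define b where "b u = 6 * G4 + 20 * G6 * u\<^sup>2 + u\<^sup>2 * y u" for u
    define g where "g u = - (4 * y u + 12 * x u) + u\<^sup>2 * (b u)\<^sup>2 - 12 * u\<^sup>2 * (a u)\<^sup>2 - 4 * u ^ 6 * (a u) ^ 3 + 60 * G4 * u\<^sup>2 * a u" for u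
    have "(g
       \<longlongrightarrow> - (4 * 0 + 12 * 0) + 0\<^sup>2 * (6 * G4 + 20 * G6 * 0\<^sup>2 + 0\<^sup>2 * 0)\<^sup>2 - 12 * 0\<^sup>2 * (3 * G4 + 5 * G6 * 0\<^sup>2 + 0\<^sup>2 * 0)\<^sup>2
         - 4 * 0 ^ 6 * (3 * G4 + 5 * G6 * 0\<^sup>2 + 0\<^sup>2 * 0) ^ 3 + 60 * G4 * 0\<^sup>2 * (3 * G4 + 5 * G6 * 0\<^sup>2 + 0\<^sup>2 * 0)) (at 0)"
      unfolding g_def[abs_def] a_def b_def by (intro tendsto_intros x y)
    then have "(g \<longlongrightarrow> 0) (at 0)" by simp
    moreover have "eventually (\<lambda>u. g u = h u) (at 0)"
      using ev
    proof eventually_elim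
      case (elim u)
      then have u: "u \<noteq> 0" by auto
      have wp: "wp u = 1 / u\<^sup>2 + u\<^sup>2 * a u"
        using u by (simp add: a_def x_def field_simps power_numeral_reduce)
      have wp': "wp' u = - 2 / u ^ 3 + u * b u"
        using u by (simp add: b_def y_def field_simps power_numeral_reduce)
      have ab: "4 * b u + 12 * a u = 60 * G4 + 140 * G6 * u\<^sup>2 + u\<^sup>2 * (4 * y u + 12 * x u)"
        by (simp add: a_def b_def algebra_simps)
      have "h u = - (4 * b u + 12 * a u - 60 * G4) / u\<^sup>2 + 140 * G6 + u\<^sup>2 * (b u)\<^sup>2 - 12 * u\<^sup>2 * (a u)\<^sup>2 - 4 * u ^ 6 * (a u) ^ 3 + 60 * G4 * u\<^sup>2 * a u"
        unfolding h_def wp wp' G4_def[symmetric] G6_def[symmetric] using u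
        by (simp add: divide_simps) algebra
      also have "- (4 * b u + 12 * a u - 60 * G4) / u\<^sup>2 = - 140 * G6 - (4 * y u + 12 * x u)"
        unfolding ab using u by (simp add: field_simps)
      finally show ?case by (simp add: g_def)
    qed
    ultimately show "(h \<longlongrightarrow> 0) (at 0)" by (rule Lim_transform_eventually)
  qed
  then show ?thesis unfolding h_def by algebra
qed

lemma half_period_not_lat:
  assumes "p \<noteq> (0, 0)" "fst p \<in> {0, 1}" "snd p \<in> {0, 1}"
  shows "L p / 2 \<notin> range L"
proof
  assume "L p / 2 \<in> range L"
  then obtain q where "L p / 2 = L q" by blast
  then have "L p = L (q + q)" by (simp add: lat_add field_simps)
  then have "p = q + q" by (simp only: lat_eq_iff)
  then have "fst p = 2 * fst q" "snd p = 2 * snd q" by simp_all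
  then show False using assms by (auto simp: prod_eq_iff)
qed

text \<open>\<open>wp'\<close> is odd and has the period \<open>L p\<close>, so it vanishes at
  \<open>L p / 2\<close>, and the differential equation becomes the cubic.\<close>

lemma wp_half_period_root:
  assumes "p \<noteq> (0, 0)" "fst p \<in> {0, 1}" "snd p \<in> {0, 1}"
  shows "4 * wp (L p / 2) ^ 3 - 60 * eis 4 * wp (L p / 2) - 140 * eis 6 = 0"
proof -
  have "wp' (L p / 2) = wp' (- (L p / 2) + L p)" by simp
  also have "\<dots> = - wp' (L p / 2)" unfolding wp'_periodic wp'_odd ..
  finally have "wp' (L p / 2) = 0" by simp
  then show ?thesis using wp_ode[OF half_period_not_lat[OF assms]] by simp
qed

definition e1 where "e1 = wp (1 / 2)"
definition e2 where "e2 = wp (\<tau> / 2)"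
definition e3 where "e3 = wp ((1 + \<tau>) / 2)"

lemma e_roots:
  assumes "e \<in> {e1, e2, e3}"
  shows "4 * e ^ 3 - 60 * eis 4 * e - 140 * eis 6 = 0"
  using assms wp_half_period_root[of "(1, 0)"] wp_half_period_root[of "(0, 1)"] wp_half_period_root[of "(1, 1)"]
  by (auto simp: e1_def e2_def e3_def lat_def)

end

lemma cubic_vieta:
  fixes a b c p q :: "'a :: field"
  assumes "a \<noteq> b" "a \<noteq> c" "b \<noteq> c" "a ^ 3 - p * a - q = 0" "b ^ 3 - p * b - q = 0" "c ^ 3 - p * c - q = 0"
  shows "a + b + c = 0" "p = - (a * b + a * c + b * c)" "q = a * b * c"
proof -
  have "(a - b) * (a\<^sup>2 + a * b + b\<^sup>2 - p) = 0" using assms(4,5) by algebra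
  then have ab: "a\<^sup>2 + a * b + b\<^sup>2 = p" using assms by simp
  have "(a - c) * (a\<^sup>2 + a * c + c\<^sup>2 - p) = 0" using assms(4,6) by algebra
  then have ac: "a\<^sup>2 + a * c + c\<^sup>2 = p" using assms by simp
  have "(b - c) * (a + b + c) = (a\<^sup>2 + a * b + b\<^sup>2) - (a\<^sup>2 + a * c + c\<^sup>2)"
    by (simp add: power2_eq_square algebra_simps)
  then have "(b - c) * (a + b + c) = 0" using ab ac by simp
  then show sum: "a + b + c = 0" using assms by simp
  then have c: "c = - a - b" by (simp add: eq_neg_iff_add_eq_0 algebra_simps)
  show p: "p = - (a * b + a * c + b * c)" unfolding ab[symmetric] c by (simp add: power2_eq_square algebra_simps)
  have "q = a ^ 3 - p * a" using assms(4) by simp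
  then show "q = a * b * c" unfolding p c by (simp add: power3_eq_cube algebra_simps)
qed

section \<open>Row sums over the lattice\<close>

lemma not_Ints_imp_not_nonpos_Ints: "(z::complex) \<notin> \<int> \<Longrightarrow> z \<notin> \<int>\<^sub>\<le>\<^sub>0"
  using nonpos_Ints_subset_Ints by blast

lemma sin_pi_eq_0_iff: "sin (of_real pi * z) = 0 \<longleftrightarrow> (z::complex) \<in> \<int>"
proof
  assume "sin (of_real pi * z) = 0"
  then obtain n :: int where "of_real pi * z = of_real (n * pi)" by (auto simp: sin_eq_0)
  then have "of_real pi * z = of_real pi * of_int n" by (simp add: mult.commute)
  then show "z \<in> \<int>" by simp
next
  assume "z \<in> \<int>"
  then obtain n where "z = of_int n" by (rule Ints_cases)
  then show "sin (of_real pi * z) = 0" by (auto simp: sin_eq_0 mult.commute)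
qed

text \<open>The logarithmic derivative of the reflection formula for \<open>Gamma\<close>.\<close>

lemma Digamma_reflection:
  fixes z :: complex
  assumes "z \<notin> \<int>"
  shows "Digamma z - Digamma (1 - z) = - of_real pi * cos (of_real pi * z) / sin (of_real pi * z)"
proof -
  have z1: "1 - z \<notin> \<int>" using assms by (metis Ints_1 Ints_diff diff_diff_eq2 add_diff_cancel_left')
  have nz: "z \<notin> \<int>\<^sub>\<le>\<^sub>0" "1 - z \<notin> \<int>\<^sub>\<le>\<^sub>0" using assms z1 by (simp_all add: not_Ints_imp_not_nonpos_Ints)
  have s: "sin (of_real pi * z) \<noteq> 0" using assms by (simp add: sin_pi_eq_0_iff)
  have "((\<lambda>z. Gamma z * Gamma (1 - z)) has_field_derivative
      (Gamma z * Digamma z * Gamma (1 - z) + (Gamma (1 - z) * Digamma (1 - z)) * (- 1) * Gamma z)) (at z)"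
    using nz by (auto intro!: derivative_eq_intros)
  moreover have "(\<lambda>z. Gamma z * Gamma (1 - z)) = (\<lambda>z::complex. of_real pi / sin (of_real pi * z))"
    using Gamma_reflection_complex by auto
  ultimately have 1: "((\<lambda>z. of_real pi / sin (of_real pi * z)) has_field_derivative
      (Gamma z * Gamma (1 - z)) * (Digamma z - Digamma (1 - z))) (at z)"
    by (simp add: algebra_simps)
  have "((\<lambda>z. of_real pi / sin (of_real pi * z)) has_field_derivative
      (of_real pi / sin (of_real pi * z)) * (- of_real pi * cos (of_real pi * z) / sin (of_real pi * z))) (at z)"
    using s by (auto intro!: derivative_eq_intros simp: field_simps power2_eq_square)
  from DERIV_unique[OF 1 this] have "(of_real pi / sin (of_real pi * z)) * (Digamma z - Digamma (1 - z)) =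
    (of_real pi / sin (of_real pi * z)) * (- of_real pi * cos (of_real pi * z) / sin (of_real pi * z))"
    unfolding Gamma_reflection_complex .
  moreover have "of_real pi / sin (of_real pi * z) \<noteq> 0" using s by simp
  ultimately show ?thesis by (simp only: mult_cancel_left) simp
qed

text \<open>The derivative of the previous formula. Combined with the series for
  \<open>Polygamma 1\<close> it is the partial fraction expansion of the squared cosecant over all
  integers.\<close>

lemma Polygamma_1_reflection:
  fixes z :: complex
  assumes "z \<notin> \<int>"
  shows "Polygamma 1 z + Polygamma 1 (1 - z) = (of_real pi / sin (of_real pi * z))\<^sup>2"
proof -
  have z1: "1 - z \<notin> \<int>" using assms by (metis Ints_1 Ints_diff diff_diff_eq2 add_diff_cancel_left')
  have nz: "z \<notin> \<int>\<^sub>\<le>\<^sub>0" "1 - z \<notin> \<int>\<^sub>\<le>\<^sub>0" using assms z1 by (simp_all add: not_Ints_imp_not_nonpos_Ints)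
  have s: "sin (of_real pi * z) \<noteq> 0" using assms by (simp add: sin_pi_eq_0_iff)
  have "((\<lambda>z. Digamma z - Digamma (1 - z)) has_field_derivative (Polygamma 1 z + Polygamma 1 (1 - z))) (at z)"
    using nz by (auto intro!: derivative_eq_intros)
  moreover have "eventually (\<lambda>z. Digamma z - Digamma (1 - z) = - of_real pi * cos (of_real pi * z) / sin (of_real pi * z)) (nhds z)"
  proof -
    have "open (- (\<int> :: complex set))" by (simp add: closed_Ints open_Compl)
    then have "eventually (\<lambda>z::complex. z \<in> - \<int>) (nhds z)" using assms by (intro eventually_nhds_in_open) auto
    then show ?thesis by eventually_elim (rule Digamma_reflection, simp)
  qed
  ultimately have 1: "((\<lambda>z. - of_real pi * cos (of_real pi * z) / sin (of_real pi * z)) has_field_derivative (Polygamma 1 z + Polygamma 1 (1 - z))) (at z)"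
    by (subst (asm) DERIV_cong_ev[OF refl _ refl]) auto
  have sc: "cos (z * of_real pi) * cos (z * of_real pi) + sin (z * of_real pi) * sin (z * of_real pi) = 1"
    by (rule sin_cos_squared_add3)
  have "((\<lambda>z. - of_real pi * cos (of_real pi * z) / sin (of_real pi * z)) has_field_derivative
      (of_real pi / sin (of_real pi * z))\<^sup>2) (at z)"
    using s by (auto intro!: derivative_eq_intros simp: field_simps power2_eq_square) (use sc in algebra)
  from DERIV_unique[OF 1 this] show ?thesis .
qed

lemma infsum_int_split:
  fixes f :: "int \<Rightarrow> complex"
  assumes "f summable_on UNIV"
  shows "infsum f UNIV = (\<Sum>n. f (int n)) + (\<Sum>n. f (- int n - 1))"
proof -
  have s: "f summable_on range int" "f summable_on range (\<lambda>n. - int n - 1)"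
    using assms by (auto intro: summable_on_subset_banach)
  have inj: "inj int" "inj (\<lambda>n. - int n - 1)" by (auto simp: inj_def)
  have "(f \<circ> int) summable_on UNIV" "(f \<circ> (\<lambda>n. - int n - 1)) summable_on UNIV"
    using s inj by (simp_all add: summable_on_reindex)
  then have "infsum (f \<circ> int) UNIV = (\<Sum>n. f (int n))" "infsum (f \<circ> (\<lambda>n. - int n - 1)) UNIV = (\<Sum>n. f (- int n - 1))"
    using has_sum_imp_sums sums_unique by (metis (no_types, lifting) comp_apply ext has_sum_infsum)+
  moreover have "infsum f UNIV = infsum f (range int) + infsum f (range (\<lambda>n. - int n - 1))"
    by (subst UNIV_int_split, rule infsum_Un_disjoint[OF s]) auto
  ultimately show ?thesis using inj by (simp add: infsum_reindex)
qed

definition csc2 :: "complex \<Rightarrow> complex" where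
  "csc2 u = (of_real pi / sin (of_real pi * u))\<^sup>2"

context period_lattice
begin

lemma row_sum:
  assumes "u \<notin> range L"
  shows "(\<Sum>\<^sub>\<infinity>m. 1 / (u - L (m, n))\<^sup>2) = csc2 (u - of_int n * \<tau>)"
proof -
  define v where "v = u - of_int n * \<tau>"
  have v: "v \<notin> \<int>"
  proof
    assume "v \<in> \<int>"
    then obtain m where "v = of_int m" by (rule Ints_cases)
    then have "u = L (m, n)" by (simp add: v_def lat_def algebra_simps)
    then show False using assms by blast
  qed
  have eq: "u - L (m, n) = v - of_int m" for m by (simp add: v_def lat_def)
  have "(\<lambda>m. 1 / (v - of_int m)\<^sup>2) summable_on UNIV"
    using summable_inverse_square(1)[OF assms, of n] unfolding eq .
  then have "(\<Sum>\<^sub>\<infinity>m. 1 / (v - of_int m)\<^sup>2) = (\<Sum>k. 1 / (v - of_int (int k))\<^sup>2) + (\<Sum>k. 1 / (v - of_int (- int k - 1))\<^sup>2)"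
    by (rule infsum_int_split)
  also have "(\<lambda>k. 1 / (v - of_int (int k))\<^sup>2) = (\<lambda>k. inverse ((- v + of_nat k) ^ 2))"
    by (simp add: inverse_eq_divide power2_eq_square algebra_simps)
  also have "(\<lambda>k. 1 / (v - of_int (- int k - 1))\<^sup>2) = (\<lambda>k. inverse (((1 - - v) + of_nat k) ^ 2))"
    by (simp add: inverse_eq_divide algebra_simps)
  also have "(\<Sum>k. inverse ((- v + of_nat k) ^ 2)) + (\<Sum>k. inverse (((1 - - v) + of_nat k) ^ 2)) = Polygamma 1 (- v) + Polygamma 1 (1 - - v)"
    by (simp add: Polygamma_def numeral_2_eq_2)
  also have "\<dots> = csc2 v"
    using v by (subst Polygamma_1_reflection) (auto simp: csc2_def power_divide)
  finally show ?thesis unfolding eq v_def .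
qed

text \<open>In the difference the terms \<open>1 / (L p)^2\<close> cancel and absolute summability
  over pairs is kept, so the sum may be evaluated row by row.\<close>

lemma wp_diff_csc2:
  assumes "u \<notin> range L" "v \<notin> range L"
  shows "wp u - wp v = (\<Sum>\<^sub>\<infinity>n. csc2 (u - of_int n * \<tau>) - csc2 (v - of_int n * \<tau>))"
    and "(\<lambda>n. csc2 (u - of_int n * \<tau>) - csc2 (v - of_int n * \<tau>)) summable_on UNIV"
proof -
  have s: "(\<lambda>(n, m). 1 / (u - L (m, n))\<^sup>2 - 1 / (v - L (m, n))\<^sup>2) summable_on UNIV \<times> UNIV"
    using wp_diff(1)[OF assms] by (subst (asm) infsum_swap_pair(2)) simp
  then have "(\<Sum>\<^sub>\<infinity>n. \<Sum>\<^sub>\<infinity>m. 1 / (u - L (m, n))\<^sup>2 - 1 / (v - L (m, n))\<^sup>2) =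
     (\<Sum>\<^sub>\<infinity>(n, m)\<in>UNIV \<times> UNIV. 1 / (u - L (m, n))\<^sup>2 - 1 / (v - L (m, n))\<^sup>2)"
    by (rule infsum_Sigma'_banach)
  also have "\<dots> = wp u - wp v"
    using infsum_swap_pair(1)[of "\<lambda>p. 1 / (u - L p)\<^sup>2 - 1 / (v - L p)\<^sup>2"] wp_diff(2)[OF assms] by simp
  finally have sums: "wp u - wp v = (\<Sum>\<^sub>\<infinity>n. \<Sum>\<^sub>\<infinity>m. 1 / (u - L (m, n))\<^sup>2 - 1 / (v - L (m, n))\<^sup>2)" ..
  have rows: "(\<Sum>\<^sub>\<infinity>m. 1 / (u - L (m, n))\<^sup>2 - 1 / (v - L (m, n))\<^sup>2) = csc2 (u - of_int n * \<tau>) - csc2 (v - of_int n * \<tau>)" for n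
    using infsum_diff_complex(1)[OF summable_inverse_square(1)[OF assms(1), of n] summable_inverse_square(1)[OF assms(2), of n]]
    by (simp only: row_sum[OF assms(1)] row_sum[OF assms(2)])
  show "wp u - wp v = (\<Sum>\<^sub>\<infinity>n. csc2 (u - of_int n * \<tau>) - csc2 (v - of_int n * \<tau>))"
    unfolding sums rows ..
  show "(\<lambda>n. csc2 (u - of_int n * \<tau>) - csc2 (v - of_int n * \<tau>)) summable_on UNIV"
    using summable_on_Sigma_banach[OF s] by (simp add: rows)
qed

text \<open>Equal to \<open>3 * e1 / (e3 - e2)\<close> once the roots are known to sum to 0. It is
  written with differences because the row sums only give differences of values of
  \<open>wp\<close>.\<close>

definition s_par where "s_par = (2 * e1 - e2 - e3) / (e3 - e2)"

lemma s_par_pm_1: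
  assumes "e3 \<noteq> e2"
  shows "s_par - 1 = 2 * (e1 - e3) / (e3 - e2)" "s_par + 1 = 2 * (e1 - e2) / (e3 - e2)"
  using assms by (simp_all add: s_par_def field_simps)

text \<open>Vieta's formulas express both Weierstrass coefficients through \<open>e1\<close> and
  \<open>d = e3 - e2\<close>. In these variables \<open>j\<close> is homogeneous of degree 0, hence
  a function of \<open>3 * e1 / d\<close>. The assumptions say that the three roots are distinct, as
  Vieta requires.\<close>

lemma klein_j_eq_j_of_s:
  assumes "e3 \<noteq> e2" "s_par \<noteq> 1" "s_par \<noteq> - 1"
  shows "klein_j \<tau> = j_of_s s_par"
proof -
  have "s_par - 1 \<noteq> 0" "s_par + 1 \<noteq> 0" using assms by (simp_all add: eq_neg_iff_add_eq_0)
  then have ne: "e1 \<noteq> e3" "e1 \<noteq> e2" unfolding s_par_pm_1[OF assms(1)] by auto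
  define d where "d = e3 - e2"
  have root: "e ^ 3 - 15 * eis 4 * e - 35 * eis 6 = 0" if "e \<in> {e1, e2, e3}" for e
  proof -
    have "4 * (e ^ 3 - 15 * eis 4 * e - 35 * eis 6) = 4 * e ^ 3 - 60 * eis 4 * e - 140 * eis 6"
      by (simp add: algebra_simps)
    from this e_roots[OF that] have "4 * (e ^ 3 - 15 * eis 4 * e - 35 * eis 6) = 0" by (rule trans)
    then show ?thesis by (simp only: mult_eq_0_iff) simp
  qed
  have "e1 + e2 + e3 = 0" and p: "15 * eis 4 = - (e1 * e2 + e1 * e3 + e2 * e3)" and q: "35 * eis 6 = e1 * e2 * e3"
    using cubic_vieta[of e1 e2 e3 "15 * eis 4" "35 * eis 6"] root ne assms(1) by auto
  then have e23: "e2 = (- e1 - d) / 2" "e3 = (- e1 + d) / 2"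
    by (simp_all add: d_def field_simps)
  have d: "d \<noteq> 0" using assms(1) by (simp add: d_def)
  have P: "15 * eis 4 = (3 * e1\<^sup>2 + d\<^sup>2) / 4" unfolding p e23 by (simp add: power2_eq_square field_simps)
  have Q: "35 * eis 6 = e1 * (e1\<^sup>2 - d\<^sup>2) / 4" unfolding q e23 by (simp add: power2_eq_square field_simps)
  have s: "s_par = 3 * e1 / d"
  proof -
    have "2 * e1 - e2 - e3 = 3 * e1" unfolding e23 by (simp add: field_simps)
    then show ?thesis by (simp add: s_par_def d_def)
  qed
  have g2: "weierstrass_g2 (lattice_span 1 \<tau>) = 3 * e1\<^sup>2 + d\<^sup>2"
  proof -
    have "weierstrass_g2 (lattice_span 1 \<tau>) = 4 * (15 * eis 4)" by (simp add: weierstrass_g_eis)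
    also have "\<dots> = 4 * ((3 * e1\<^sup>2 + d\<^sup>2) / 4)" by (simp only: P)
    also have "\<dots> = 3 * e1\<^sup>2 + d\<^sup>2" by simp
    finally show ?thesis .
  qed
  have g3: "weierstrass_g3 (lattice_span 1 \<tau>) = e1 * (e1\<^sup>2 - d\<^sup>2)"
  proof -
    have "weierstrass_g3 (lattice_span 1 \<tau>) = 4 * (35 * eis 6)" by (simp add: weierstrass_g_eis)
    also have "\<dots> = 4 * (e1 * (e1\<^sup>2 - d\<^sup>2) / 4)" by (simp only: Q)
    also have "\<dots> = e1 * (e1\<^sup>2 - d\<^sup>2)" by simp
    finally show ?thesis .
  qed
  have disc: "(3 * e1\<^sup>2 + d\<^sup>2) ^ 3 - 27 * (e1 * (e1\<^sup>2 - d\<^sup>2))\<^sup>2 = d\<^sup>2 * (9 * e1\<^sup>2 - d\<^sup>2)\<^sup>2"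
    by algebra
  have s3: "s_par\<^sup>2 + 3 = 3 * (3 * e1\<^sup>2 + d\<^sup>2) / d\<^sup>2" and s1: "s_par\<^sup>2 - 1 = (9 * e1\<^sup>2 - d\<^sup>2) / d\<^sup>2"
    unfolding s using d by (simp_all add: power_divide field_simps power_mult_distrib)
  have "(s_par - 1) * (s_par + 1) \<noteq> 0" using \<open>s_par - 1 \<noteq> 0\<close> \<open>s_par + 1 \<noteq> 0\<close> by simp
  then have "s_par\<^sup>2 - 1 \<noteq> 0" by (simp add: power2_eq_square algebra_simps)
  then have n: "9 * e1\<^sup>2 - d\<^sup>2 \<noteq> 0" unfolding s1 by auto
  have "j_of_s s_par = 64 * (3 * (3 * e1\<^sup>2 + d\<^sup>2) / d\<^sup>2) ^ 3 / ((9 * e1\<^sup>2 - d\<^sup>2) / d\<^sup>2)\<^sup>2"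
    unfolding j_of_s_def s3 s1 ..
  also have "\<dots> = 1728 * (3 * e1\<^sup>2 + d\<^sup>2) ^ 3 / (d\<^sup>2 * (9 * e1\<^sup>2 - d\<^sup>2)\<^sup>2)"
  proof -
    have gen: "64 * (3 * X / D) ^ 3 / (N / D)\<^sup>2 = 1728 * X ^ 3 / (D * N\<^sup>2)" if "D \<noteq> 0" "N \<noteq> 0" for X D N :: complex
      using that by (simp add: field_simps power2_eq_square power3_eq_cube)
    have "d\<^sup>2 \<noteq> 0" using d by simp
    from gen[OF this n] show ?thesis .
  qed
  also have "\<dots> = klein_j \<tau>"
    unfolding klein_j_def j_invariant_def g2 g3 disc ..
  finally show ?thesis ..
qed

end

text \<open>The lattice of \<open>- 1 / \<tau>\<close> is that of \<open>\<tau>\<close> divided by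
  \<open>\<tau>\<close>, with indices rotated, and \<open>wp\<close> is homogeneous of degree
  -2.\<close>

lemma (in period_lattice) wp_invert:
  "period_lattice.wp (- 1 / \<tau>) (u / \<tau>) = \<tau>\<^sup>2 * wp u"
proof -
  have t0: "\<tau> \<noteq> 0" using Im_pos by auto
  have "Im (- 1 / \<tau>) = Im \<tau> / (norm \<tau>)\<^sup>2" by (simp add: Im_divide cmod_power2)
  then interpret inv: period_lattice "- 1 / \<tau>" using Im_pos t0 by unfold_locales simp
  have eq: "lat (- 1 / \<tau>) (m, n) = L (- n, m) / \<tau>" for m n
    using t0 by (simp add: lat_def field_simps)
  have summand: "1 / (u / \<tau> - lat (- 1 / \<tau>) (m, n))\<^sup>2 - 1 / (lat (- 1 / \<tau>) (m, n))\<^sup>2 =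
     \<tau>\<^sup>2 * (1 / (u - L (- n, m))\<^sup>2 - 1 / (L (- n, m))\<^sup>2)" for m n
    unfolding eq diff_divide_distrib[symmetric] using t0 by (simp add: power_divide algebra_simps)
  have "inv.wp (u / \<tau>) = (\<Sum>\<^sub>\<infinity>p. \<tau>\<^sup>2 * (1 / (u - L p)\<^sup>2 - 1 / (L p)\<^sup>2))"
    unfolding inv.wp_def
  proof (rule infsum_reindex_bij_witness[of _ "\<lambda>(k, l). (l, - k)" "\<lambda>(m, n). (- n, m)"])
    fix p :: "int \<times> int"
    obtain m n where "p = (m, n)" by (cases p)
    then show "\<tau>\<^sup>2 * (1 / (u - L (case p of (m, n) \<Rightarrow> (- n, m)))\<^sup>2 - 1 / (L (case p of (m, n) \<Rightarrow> (- n, m)))\<^sup>2) =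
      1 / (u / \<tau> - lat (- 1 / \<tau>) p)\<^sup>2 - 1 / (lat (- 1 / \<tau>) p)\<^sup>2"
      using summand[of m n] by simp
  qed auto
  also have "\<dots> = \<tau>\<^sup>2 * wp u" unfolding wp_def by (rule infsum_cmult_right')
  finally show ?thesis .
qed

lemma (in period_lattice) e_invert:
  "period_lattice.e1 (- 1 / \<tau>) = \<tau>\<^sup>2 * e2"
  "period_lattice.e2 (- 1 / \<tau>) = \<tau>\<^sup>2 * e1"
  "period_lattice.e3 (- 1 / \<tau>) = \<tau>\<^sup>2 * e3"
proof -
  have t0: "\<tau> \<noteq> 0" using Im_pos by auto
  have "Im (- 1 / \<tau>) = Im \<tau> / (norm \<tau>)\<^sup>2" by (simp add: Im_divide cmod_power2)
  then interpret inv: period_lattice "- 1 / \<tau>" using Im_pos t0 by unfold_locales simp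
  show "inv.e1 = \<tau>\<^sup>2 * e2"
    unfolding inv.e1_def e2_def using wp_invert[of "\<tau> / 2"] t0 by simp
  show "inv.e2 = \<tau>\<^sup>2 * e1"
    unfolding inv.e2_def e1_def using wp_invert[of "- (1 / 2)"] by (simp add: wp_even mult.commute)
  have "inv.e3 = inv.wp (- ((1 + - 1 / \<tau>) / 2))" unfolding inv.e3_def inv.wp_even ..
  also have "\<dots> = inv.wp (- ((1 + - 1 / \<tau>) / 2) + lat (- 1 / \<tau>) (1, 0))"
    using inv.wp_periodic(1)[OF inv.not_lat_uminus[OF inv.half_period_not_lat[of "(1, 1)"]]]
    by (simp add: lat_def)
  also have "- ((1 + - 1 / \<tau>) / 2) + lat (- 1 / \<tau>) (1, 0) = ((1 + \<tau>) / 2) / \<tau>"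
    using t0 by (simp add: lat_def field_simps)
  also have "inv.wp \<dots> = \<tau>\<^sup>2 * e3" unfolding wp_invert e3_def ..
  finally show "inv.e3 = \<tau>\<^sup>2 * e3" .
qed

text \<open>Inversion exchanges \<open>e1\<close> and \<open>e2\<close> up to the factor
  \<open>\<tau>^2\<close>, which drops out of the ratio. On \<open>s\<close> it therefore acts as
  \<open>1 + 4 / (s - 1)\<close>, and this is where the circle \<open>norm (s - 1) = 2\<close> comes
  from.\<close>

lemma (in period_lattice) s_par_invert:
  assumes "e3 \<noteq> e2" "s_par \<noteq> 1"
  shows "(period_lattice.s_par (- 1 / \<tau>) - 1) * (s_par - 1) = 4"
proof -
  have t0: "\<tau> \<noteq> 0" using Im_pos by auto
  have "Im (- 1 / \<tau>) = Im \<tau> / (norm \<tau>)\<^sup>2" by (simp add: Im_divide cmod_power2)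
  then interpret inv: period_lattice "- 1 / \<tau>" using Im_pos t0 by unfold_locales simp
  have "s_par - 1 \<noteq> 0" using assms by simp
  then have ne: "e1 \<noteq> e3" unfolding s_par_pm_1[OF assms(1)] by auto
  then have "inv.e3 \<noteq> inv.e2" using e_invert t0 by simp
  from inv.s_par_pm_1(1)[OF this]
  have "inv.s_par - 1 = 2 * (\<tau>\<^sup>2 * (e2 - e3)) / (\<tau>\<^sup>2 * (e3 - e1))"
    unfolding e_invert by (simp add: algebra_simps)
  also have "\<dots> = 2 * (e2 - e3) / (e3 - e1)" using t0 by simp
  finally have s: "inv.s_par - 1 = 2 * (e2 - e3) / (e3 - e1)" .
  have "2 * (e2 - e3) / (e3 - e1) * (2 * (e1 - e3) / (e3 - e2)) = 4"
    using assms(1) ne by (simp add: divide_simps) (simp add: algebra_simps)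
  then show ?thesis unfolding s s_par_pm_1(1)[OF assms(1)] .
qed

section \<open>Lambert series in the nome\<close>

lemma norm_power_diff_le:
  fixes x y :: complex
  assumes "norm x \<le> c" "norm y \<le> c"
  shows "norm (x ^ n - y ^ n) \<le> n * c ^ (n - 1) * norm (x - y)"
proof -
  have eq: "norm (x ^ n - y ^ n) = norm (x - y) * norm (\<Sum>i<n. y ^ (n - Suc i) * x ^ i)"
    by (simp add: diff_power_eq_sum norm_mult power_diff_sumr2)
  have "norm (\<Sum>i<n. y ^ (n - Suc i) * x ^ i) \<le> (\<Sum>i<n. c ^ (n - 1))"
  proof (rule sum_norm_le)
    fix i assume "i \<in> {..<n}"
    then have "n - 1 = (n - Suc i) + i" by simp
    then have "c ^ (n - 1) = c ^ (n - Suc i) * c ^ i" by (metis power_add)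
    moreover have "norm y ^ (n - Suc i) * norm x ^ i \<le> c ^ (n - Suc i) * c ^ i"
      using assms order_trans[OF norm_ge_zero assms(1)] by (intro mult_mono power_mono) auto
    ultimately show "norm (y ^ (n - Suc i) * x ^ i) \<le> c ^ (n - 1)" by (simp add: norm_mult norm_power)
  qed
  then have "norm (x - y) * norm (\<Sum>i<n. y ^ (n - Suc i) * x ^ i) \<le> norm (x - y) * (\<Sum>i<n. c ^ (n - 1))"
    by (intro mult_left_mono) auto
  then show ?thesis unfolding eq by (simp add: mult_ac)
qed

text \<open>All series below converge on the disc of radius \<open>1/15\<close>, which contains the nomes
  \<open>exp (i\<pi>\<tau>)\<close> for \<open>\<tau>\<close> in the standard fundamental domain.\<close>

lemma term_lipschitz:
  fixes x y :: complex
  assumes xy: "norm x \<le> 1/15" "norm y \<le> 1/15"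
    and h: "\<And>u. norm u \<le> 1/225 \<Longrightarrow> norm (h u) \<le> H"
      "\<And>u v. norm u \<le> 1/225 \<Longrightarrow> norm v \<le> 1/225 \<Longrightarrow> norm (h u - h v) \<le> H' * norm (u - v)"
    and i: "2 * k + 1 \<le> i" "i \<le> 7 ^ k" and l: "2 \<le> l" "l \<le> 2 * 7 ^ k"
  shows "norm (x ^ i * h (x ^ l) - y ^ i * h (y ^ l)) \<le> (H + 2 * H' / 225) * (1/32) ^ k * norm (x - y)"
proof -
  have pl: "norm (z ^ l) \<le> 1/225" if "norm z \<le> 1/15" for z :: complex
  proof -
    have "norm (z ^ l) \<le> (1/15) ^ l" using that by (simp add: norm_power power_mono)
    also have "\<dots> \<le> (1/15) ^ 2" using l by (intro power_decreasing) auto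
    finally show ?thesis by (simp add: power2_eq_square)
  qed
  have H: "H \<ge> 0" using order_trans[OF norm_ge_zero h(1)[of 0]] by simp
  have H': "H' \<ge> 0" using order_trans[OF norm_ge_zero h(2)[of "1/225" 0]] by simp
  have pi: "(1/15) ^ (i - 1) \<le> (1/225 :: real) ^ k"
  proof -
    have "(1/15 :: real) ^ (i - 1) \<le> (1/15) ^ (2 * k)" using i by (intro power_decreasing) auto
    also have "\<dots> = (1/225) ^ k" by (simp add: power_mult power2_eq_square)
    finally show ?thesis .
  qed
  \<comment> \<open>225 / 7 exceeds 32: the growth \<open>7 ^ k\<close> allowed for the exponents is
    absorbed by the decay \<open>(1/225) ^ k\<close>, and the ratio 1/32 is what remains.\<close>
  have k7: "7 ^ k * (1/225) ^ k \<le> (1/32 :: real) ^ k"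
    unfolding power_mult_distrib[symmetric] by (intro power_mono) auto
  have i_bd: "i * (1/15) ^ (i - 1) \<le> (1/32 :: real) ^ k"
  proof -
    have "real i \<le> 7 ^ k" using i(2) by (metis of_nat_le_iff of_nat_numeral of_nat_power)
    then have "i * (1/15) ^ (i - 1) \<le> 7 ^ k * (1/225 :: real) ^ k"
      using pi by (intro mult_mono) auto
    then show ?thesis using k7 by simp
  qed
  have l_bd: "(1/15) ^ i * (l * (1/15) ^ (l - 1)) \<le> 2 / 225 * (1/32 :: real) ^ k"
  proof -
    have "real l \<le> 2 * 7 ^ k" using l(2) by (metis of_nat_le_iff of_nat_numeral of_nat_power of_nat_mult)
    moreover have "(1/15 :: real) ^ l \<le> (1/15) ^ 2" using l by (intro power_decreasing) auto
    ultimately have "(1/15) ^ (i - 1) * (l * (1/15) ^ l) \<le> (1/225 :: real) ^ k * ((2 * 7 ^ k) * (1/225))"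
      using pi by (intro mult_mono) (auto simp: power2_eq_square)
    also have "\<dots> = 2 / 225 * (7 ^ k * (1/225) ^ k)" by simp
    also have "\<dots> \<le> 2 / 225 * (1/32) ^ k" using k7 by (intro mult_left_mono) auto
    finally have "(1/15) ^ (i - 1) * (l * (1/15) ^ l) \<le> 2 / 225 * (1/32 :: real) ^ k" .
    moreover have "(1/15 :: real) ^ i = 1/15 * (1/15) ^ (i - 1)" "(1/15 :: real) ^ l = 1/15 * (1/15) ^ (l - 1)"
      using i l by (simp_all flip: power_Suc)
    then have "(1/15 :: real) ^ i * (l * (1/15) ^ (l - 1)) = (1/15) ^ (i - 1) * (l * (1/15) ^ l)"
      by (simp only: mult_ac)
    ultimately show ?thesis by (simp only:)
  qed
  have "x ^ i * h (x ^ l) - y ^ i * h (y ^ l) = (x ^ i - y ^ i) * h (x ^ l) + y ^ i * (h (x ^ l) - h (y ^ l))"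
    by (simp add: algebra_simps)
  also have "norm \<dots> \<le> norm (x ^ i - y ^ i) * norm (h (x ^ l)) + norm (y ^ i) * norm (h (x ^ l) - h (y ^ l))"
    by (rule order_trans[OF norm_triangle_ineq]) (simp add: norm_mult)
  also have "\<dots> \<le> (i * (1/15) ^ (i - 1) * norm (x - y)) * H + (1/15) ^ i * (H' * (l * (1/15) ^ (l - 1) * norm (x - y)))"
  proof (intro add_mono mult_mono)
    show "norm (x ^ i - y ^ i) \<le> i * (1/15) ^ (i - 1) * norm (x - y)" using xy by (rule norm_power_diff_le)
    show "norm (h (x ^ l)) \<le> H" using pl xy by (intro h)
    show "norm (y ^ i) \<le> (1/15) ^ i" using xy by (simp add: norm_power power_mono)
    have "norm (h (x ^ l) - h (y ^ l)) \<le> H' * norm (x ^ l - y ^ l)" using pl xy by (intro h)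
    also have "\<dots> \<le> H' * (l * (1/15) ^ (l - 1) * norm (x - y))"
      using H' xy by (intro mult_left_mono norm_power_diff_le) auto
    finally show "norm (h (x ^ l) - h (y ^ l)) \<le> H' * (l * (1/15) ^ (l - 1) * norm (x - y))" .
  qed auto
  also have "\<dots> = H * norm (x - y) * (i * (1/15) ^ (i - 1)) + H' * norm (x - y) * ((1/15) ^ i * (l * (1/15) ^ (l - 1)))"
    by (simp add: mult_ac)
  also have "\<dots> \<le> H * norm (x - y) * (1/32) ^ k + H' * norm (x - y) * (2 / 225 * (1/32) ^ k)"
    using H H' i_bd l_bd by (intro add_mono mult_left_mono) auto
  also have "\<dots> = (H + 2 * H' / 225) * (1/32) ^ k * norm (x - y)" by (simp add: algebra_simps)
  finally show ?thesis .
qed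

text \<open>The Lipschitz constants of the terms form a geometric series of ratio 1/32, with sum
  factor 32/31. Comparing with the value at 0 yields summability.\<close>

lemma series_lipschitz:
  fixes t :: "nat \<Rightarrow> complex \<Rightarrow> complex"
  assumes t: "\<And>k x y. norm x \<le> 1/15 \<Longrightarrow> norm y \<le> 1/15 \<Longrightarrow> norm (t k x - t k y) \<le> C * (1/32) ^ k * norm (x - y)"
    and t0: "\<And>k. t k 0 = 0" and x: "norm x \<le> 1/15"
  shows "summable (\<lambda>k. t k x)"
    and "norm y \<le> 1/15 \<Longrightarrow> norm ((\<Sum>k. t k x) - (\<Sum>k. t k y)) \<le> C * (32/31) * norm (x - y)"
proof -
  have geo: "(\<lambda>k. C * (1/32) ^ k * c) sums (C * (32/31) * c)" for c
  proof -
    have "(\<lambda>k. (1/32 :: real) ^ k) sums (1 / (1 - 1/32))" by (rule geometric_sums) simp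
    then have "(\<lambda>k. C * c * (1/32) ^ k) sums (C * c * (1 / (1 - 1/32)))" by (rule sums_mult)
    then show ?thesis by (simp add: mult_ac)
  qed
  have s: "summable (\<lambda>k. t k x)" if "norm x \<le> 1/15" for x
  proof (rule summable_comparison_test[OF _ sums_summable[OF geo[of "norm x"]]])
    show "\<exists>N. \<forall>n\<ge>N. norm (t n x) \<le> C * (1/32) ^ n * norm x"
      using t[OF that, of 0] by (simp add: t0)
  qed
  show "summable (\<lambda>k. t k x)" using x by (rule s)
  assume y: "norm y \<le> 1/15"
  have "norm ((\<Sum>k. t k x) - (\<Sum>k. t k y)) = norm (\<Sum>k. t k x - t k y)"
    using s[OF x] s[OF y] by (simp add: suminf_diff)
  also have "\<dots> \<le> (\<Sum>k. C * (1/32) ^ k * norm (x - y))"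
    using t[OF x y] sums_summable[OF geo] by (intro norm_suminf_le) auto
  also have "\<dots> = C * (32/31) * norm (x - y)" using geo by (rule sums_unique[symmetric])
  finally show "norm ((\<Sum>k. t k x) - (\<Sum>k. t k y)) \<le> C * (32/31) * norm (x - y)" .
qed

lemma power_terms_lipschitz:
  fixes h :: "complex \<Rightarrow> complex" and i l :: "nat \<Rightarrow> nat"
  assumes h: "\<And>u. norm u \<le> 1/225 \<Longrightarrow> norm (h u) \<le> H"
      "\<And>u v. norm u \<le> 1/225 \<Longrightarrow> norm v \<le> 1/225 \<Longrightarrow> norm (h u - h v) \<le> H' * norm (u - v)"
    and i: "\<And>k. 2 * k + 1 \<le> i k" "\<And>k. i k \<le> 7 ^ k"
    and l: "\<And>k. 2 \<le> l k" "\<And>k. l k \<le> 2 * 7 ^ k"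
    and x: "norm x \<le> 1/15"
  shows "summable (\<lambda>k. x ^ i k * h (x ^ l k))"
    and "norm y \<le> 1/15 \<Longrightarrow> norm ((\<Sum>k. x ^ i k * h (x ^ l k)) - (\<Sum>k. y ^ i k * h (y ^ l k)))
      \<le> (H + 2 * H' / 225) * (32/31) * norm (x - y)"
proof -
  have "i k > 0" for k using i(1)[of k] by simp
  then have 0: "0 ^ i k * h (0 ^ l k) = 0" for k by simp
  note t = term_lipschitz[OF _ _ h i l]
  show "summable (\<lambda>k. x ^ i k * h (x ^ l k))" by (rule series_lipschitz(1)[OF t 0 x])
  show "norm ((\<Sum>k. x ^ i k * h (x ^ l k)) - (\<Sum>k. y ^ i k * h (y ^ l k)))
      \<le> (H + 2 * H' / 225) * (32/31) * norm (x - y)" if "norm y \<le> 1/15"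
    by (rule series_lipschitz(2)[OF t 0 x that])
qed

text \<open>With \<open>\<psi>(w) = w / (1 - w)\<^sup>2\<close>, the differences of the \<open>e\<^sub>i\<close> are combinations of sums of
  \<open>\<psi>(\<plusminus> r\<^sup>n)\<close>. The even powers contribute \<open>fa\<close>; the odd powers are paired as
  \<open>\<psi>(x) + \<psi>(- x)\<close> and \<open>\<psi>(x) - \<psi>(- x)\<close>, which lead to \<open>fb\<close> and \<open>fc\<close>. Altogether
  \<open>8 s = (1 + 8 r fa + 16 r fb) / (r (1 + r fy))\<close>, that is, \<open>8 s = 1 / r + fE\<close>.\<close>

definition fa :: "complex \<Rightarrow> complex" where
  "fa r = (\<Sum>k. r ^ (2 * k + 1) * (1 / (1 + r ^ (2 * k + 2))\<^sup>2))"

definition fb :: "complex \<Rightarrow> complex" where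
  "fb r = (\<Sum>k. r ^ (4 * k + 1) * (1 / (1 - r ^ (4 * k + 2))\<^sup>2))"

definition fc :: "complex \<Rightarrow> complex" where
  "fc r = (\<Sum>k. r ^ (6 * k + 1) * ((3 - r ^ (4 * k + 2)) / (1 - r ^ (4 * k + 2))\<^sup>2))"

text \<open>Bernoulli's inequality. The exponents \<open>6 * k + 1\<close> of \<open>fc\<close> are
  the largest outer ones that occur, which fixes the base 7 of the growth bound.\<close>

lemma seven_power_ge: "6 * k + 1 \<le> 7 ^ k" for k :: nat
  by (induction k) auto

text \<open>225/224 is the maximum of \<open>norm (1 / (1 - z))\<close> on the disc of radius 1/225.
  The constants 1.01 and 2.1 used later are its square and twice its cube, rounded up.\<close>

lemma inverse_diff_bound:
  fixes u v :: complex
  assumes "norm u \<le> 1/225" "norm v \<le> 1/225"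
  shows "norm (1 / (1 - u)) \<le> 225/224" "norm (1 / (1 - u) - 1 / (1 - v)) \<le> (225/224)\<^sup>2 * norm (u - v)"
proof -
  have low: "norm (1 - z) \<ge> 224/225" if "norm z \<le> 1/225" for z :: complex
    using norm_triangle_ineq2[of 1 z] that by simp
  have b: "norm (1 / (1 - z)) \<le> 225/224" if "norm z \<le> 1/225" for z :: complex
    using low[OF that] frac_le[of 1 1 "224/225" "norm (1 - z)"] by (simp add: norm_divide)
  show "norm (1 / (1 - u)) \<le> 225/224" using assms by (intro b)
  have nz: "1 - u \<noteq> 0" "1 - v \<noteq> 0" using low assms by fastforce+
  have "1 / (1 - u) - 1 / (1 - v) = (1 / (1 - u)) * (1 / (1 - v)) * (u - v)"
    using nz by (simp add: field_simps)
  also have "norm \<dots> \<le> (225/224) * (225/224) * norm (u - v)"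
    unfolding norm_mult using b assms by (intro mult_mono) auto
  finally show "norm (1 / (1 - u) - 1 / (1 - v)) \<le> (225/224)\<^sup>2 * norm (u - v)"
    by (simp add: power2_eq_square)
qed

lemma inverse_square_diff_bound:
  fixes u v :: complex
  assumes "norm u \<le> 1/225" "norm v \<le> 1/225"
  shows "norm (1 / (1 - u)\<^sup>2) \<le> 1.01" "norm (1 / (1 - u)\<^sup>2 - 1 / (1 - v)\<^sup>2) \<le> 2.1 * norm (u - v)"
proof -
  note b = inverse_diff_bound[OF assms] inverse_diff_bound[OF assms(2,1)]
  have "norm (1 / (1 - u)\<^sup>2) = norm (1 / (1 - u)) ^ 2" by (simp add: norm_divide norm_power power_divide)
  also have "\<dots> \<le> (225/224)\<^sup>2" using b by (intro power_mono) auto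
  finally show "norm (1 / (1 - u)\<^sup>2) \<le> 1.01" by (simp add: power2_eq_square)
  have "1 / (1 - u)\<^sup>2 - 1 / (1 - v)\<^sup>2 = (1 / (1 - u) - 1 / (1 - v)) * (1 / (1 - u) + 1 / (1 - v))"
    by (simp add: power2_eq_square algebra_simps)
  also have "norm \<dots> \<le> ((225/224)\<^sup>2 * norm (u - v)) * (225/224 + 225/224)"
    unfolding norm_mult using b by (intro mult_mono norm_triangle_le add_mono) auto
  also have "\<dots> \<le> 2.1 * norm (u - v)" by (simp add: power2_eq_square)
  finally show "norm (1 / (1 - u)\<^sup>2 - 1 / (1 - v)\<^sup>2) \<le> 2.1 * norm (u - v)" .
qed

lemma fa_bounds:
  assumes "norm x \<le> 1/15"
  shows "summable (\<lambda>k. x ^ (2 * k + 1) * (1 / (1 + x ^ (2 * k + 2))\<^sup>2))"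
    and "norm y \<le> 1/15 \<Longrightarrow> norm (fa x - fa y) \<le> 1.07 * norm (x - y)"
proof -
  have h: "norm (1 / (1 + u)\<^sup>2) \<le> 1.01" "norm (1 / (1 + u)\<^sup>2 - 1 / (1 + v)\<^sup>2) \<le> 2.1 * norm (u - v)"
    if "norm u \<le> 1/225" "norm v \<le> 1/225" for u v :: complex
    using that inverse_square_diff_bound[of "- u" "- v"] by (simp_all add: norm_minus_commute)
  have h1: "norm (1 / (1 + u)\<^sup>2) \<le> 1.01" if "norm u \<le> 1/225" for u :: complex
    by (rule h(1)[OF that that])
  have e: "2 * k + 1 \<le> 7 ^ k" "2 * k + 2 \<le> 2 * 7 ^ k" for k :: nat using seven_power_ge[of k] by auto
  note L = power_terms_lipschitz[OF h1 h(2) _ e(1) _ e(2) assms]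
  show "summable (\<lambda>k. x ^ (2 * k + 1) * (1 / (1 + x ^ (2 * k + 2))\<^sup>2))" by (rule L(1)) auto
  assume "norm y \<le> 1/15"
  then have "norm (fa x - fa y) \<le> (1.01 + 2 * 2.1 / 225) * (32/31) * norm (x - y)"
    unfolding fa_def by (intro L(2)) auto
  also have "\<dots> \<le> 1.07 * norm (x - y)" by (intro mult_right_mono) auto
  finally show "norm (fa x - fa y) \<le> 1.07 * norm (x - y)" .
qed

lemma fb_bounds:
  assumes "norm x \<le> 1/15"
  shows "summable (\<lambda>k. x ^ (4 * k + 1) * (1 / (1 - x ^ (4 * k + 2))\<^sup>2))"
    and "norm y \<le> 1/15 \<Longrightarrow> norm (fb x - fb y) \<le> 1.07 * norm (x - y)"
proof -
  have h1: "norm (1 / (1 - u)\<^sup>2) \<le> 1.01" if "norm u \<le> 1/225" for u :: complex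
    by (rule inverse_square_diff_bound(1)[OF that that])
  have e: "4 * k + 1 \<le> 7 ^ k" "4 * k + 2 \<le> 2 * 7 ^ k" for k :: nat using seven_power_ge[of k] by auto
  note L = power_terms_lipschitz[OF h1 inverse_square_diff_bound(2) _ e(1) _ e(2) assms]
  show "summable (\<lambda>k. x ^ (4 * k + 1) * (1 / (1 - x ^ (4 * k + 2))\<^sup>2))" by (rule L(1)) auto
  assume "norm y \<le> 1/15"
  then have "norm (fb x - fb y) \<le> (1.01 + 2 * 2.1 / 225) * (32/31) * norm (x - y)"
    unfolding fb_def by (intro L(2)) auto
  also have "\<dots> \<le> 1.07 * norm (x - y)" by (intro mult_right_mono) auto
  finally show "norm (fb x - fb y) \<le> 1.07 * norm (x - y)" .
qed

lemma fc_bounds: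
  assumes "norm x \<le> 1/15"
  shows "summable (\<lambda>k. x ^ (6 * k + 1) * ((3 - x ^ (4 * k + 2)) / (1 - x ^ (4 * k + 2))\<^sup>2))"
    and "norm y \<le> 1/15 \<Longrightarrow> norm (fc x - fc y) \<le> 3.25 * norm (x - y)"
proof -
  have h: "norm ((3 - u) / (1 - u)\<^sup>2) \<le> 3.04"
    "norm ((3 - u) / (1 - u)\<^sup>2 - (3 - v) / (1 - v)\<^sup>2) \<le> 5.3 * norm (u - v)"
    if u: "norm u \<le> 1/225" and v: "norm v \<le> 1/225" for u v :: complex
  proof -
    note b = inverse_diff_bound[OF u v] inverse_square_diff_bound[OF u v]
    \<comment> \<open>Partial fractions, which reduce the function in \<open>fc\<close> to the two
      already estimated.\<close>
    have eq: "(3 - z) / (1 - z)\<^sup>2 = 2 * (1 / (1 - z)\<^sup>2) + 1 / (1 - z)" if "norm z \<le> 1/225" for z :: complex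
    proof -
      have "z \<noteq> 1" using that by auto
      then show ?thesis by (simp add: divide_simps power2_eq_square) (simp add: algebra_simps)
    qed
    have "norm ((3 - u) / (1 - u)\<^sup>2) \<le> 2 * 1.01 + 225/224"
      unfolding eq[OF u] using b by (intro norm_triangle_le add_mono) (simp_all only: norm_mult, auto)
    then show "norm ((3 - u) / (1 - u)\<^sup>2) \<le> 3.04" by simp
    have "(3 - u) / (1 - u)\<^sup>2 - (3 - v) / (1 - v)\<^sup>2 = 2 * (1 / (1 - u)\<^sup>2 - 1 / (1 - v)\<^sup>2) + (1 / (1 - u) - 1 / (1 - v))"
      unfolding eq[OF u] eq[OF v] by (simp add: algebra_simps)
    also have "norm \<dots> \<le> 2 * (2.1 * norm (u - v)) + (225/224)\<^sup>2 * norm (u - v)"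
      using b by (intro norm_triangle_le add_mono) (simp_all only: norm_mult, auto)
    also have "\<dots> \<le> 5.3 * norm (u - v)" by (simp add: power2_eq_square)
    finally show "norm ((3 - u) / (1 - u)\<^sup>2 - (3 - v) / (1 - v)\<^sup>2) \<le> 5.3 * norm (u - v)" .
  qed
  have h1: "norm ((3 - u) / (1 - u)\<^sup>2) \<le> 3.04" if "norm u \<le> 1/225" for u :: complex
    by (rule h(1)[OF that that])
  have e: "4 * k + 2 \<le> 2 * 7 ^ k" for k :: nat using seven_power_ge[of k] by auto
  note L = power_terms_lipschitz[OF h1 h(2) _ seven_power_ge _ e assms]
  show "summable (\<lambda>k. x ^ (6 * k + 1) * ((3 - x ^ (4 * k + 2)) / (1 - x ^ (4 * k + 2))\<^sup>2))"
    by (rule L(1)) auto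
  assume "norm y \<le> 1/15"
  then have "norm (fc x - fc y) \<le> (3.04 + 2 * 5.3 / 225) * (32/31) * norm (x - y)"
    unfolding fc_def by (intro L(2)) auto
  also have "\<dots> \<le> 3.25 * norm (x - y)" by (intro mult_right_mono) auto
  finally show "norm (fc x - fc y) \<le> 3.25 * norm (x - y)" .
qed

text \<open>For \<open>x = r ^ (2 * k + 1)\<close>, half of \<open>psi x - psi (- x)\<close> is
  \<open>x\<close> plus a remainder of third order. The terms \<open>x\<close> add up to
  \<open>r / (1 - r^2) = r + r^2 * (r / (1 - r^2))\<close> and the remainders to
  \<open>r^2 * fc r\<close>, so the total is \<open>r + r^2 * fy r\<close>.\<close>

definition fy :: "complex \<Rightarrow> complex" where
  "fy r = fc r + r / (1 - r\<^sup>2)"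

lemma fy_lipschitz:
  assumes "norm x \<le> 1/15" "norm y \<le> 1/15"
  shows "norm (fy x - fy y) \<le> 4.3 * norm (x - y)"
proof -
  have sq: "norm (z\<^sup>2) \<le> 1/225" if "norm z \<le> 1/15" for z :: complex
    using mult_mono[OF that that] by (simp add: power2_eq_square norm_mult)
  have nz: "1 - x\<^sup>2 \<noteq> 0" "1 - y\<^sup>2 \<noteq> 0" using sq[OF assms(1)] sq[OF assms(2)] by auto
  have xy: "norm (1 + x * y) \<le> 226/225"
  proof -
    have "norm (x * y) \<le> 1/15 * (1/15)" unfolding norm_mult using assms by (intro mult_mono) auto
    then show ?thesis using norm_triangle_ineq[of 1 "x * y"] by simp
  qed
  have "x / (1 - x\<^sup>2) - y / (1 - y\<^sup>2) = (1 + x * y) * (1 / (1 - x\<^sup>2)) * (1 / (1 - y\<^sup>2)) * (x - y)"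
    using nz by (simp add: divide_simps) (simp add: power2_eq_square algebra_simps)
  also have "norm \<dots> \<le> (226/225) * (225/224) * (225/224) * norm (x - y)"
    unfolding norm_mult using xy inverse_diff_bound(1)[OF sq[OF assms(1)] sq[OF assms(2)]] inverse_diff_bound(1)[OF sq[OF assms(2)] sq[OF assms(1)]]
    by (intro mult_mono) auto
  also have "\<dots> \<le> 1.02 * norm (x - y)" by (intro mult_right_mono) auto
  finally have "norm (x / (1 - x\<^sup>2) - y / (1 - y\<^sup>2)) \<le> 1.02 * norm (x - y)" .
  then have "norm ((fc x - fc y) + (x / (1 - x\<^sup>2) - y / (1 - y\<^sup>2))) \<le> 3.25 * norm (x - y) + 1.02 * norm (x - y)"
    using fc_bounds(2)[OF assms] by (intro norm_triangle_le add_mono)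
  also have "\<dots> = 4.27 * norm (x - y)" by simp
  also have "\<dots> \<le> 4.3 * norm (x - y)" by (intro mult_right_mono) auto
  finally show ?thesis by (simp add: fy_def algebra_simps)
qed

lemma f_0 [simp]: "fa 0 = 0" "fb 0 = 0" "fc 0 = 0" "fy 0 = 0"
  by (simp_all add: fa_def fb_def fc_def fy_def)

definition fE :: "complex \<Rightarrow> complex" where
  "fE r = (8 * fa r + 16 * fb r - fy r) / (1 + r * fy r)"

lemma norm_den_ge:
  assumes "norm x \<le> 1/15"
  shows "norm (fy x) \<le> 4.3 / 15" "norm (1 + x * fy x) \<ge> 0.98"
proof -
  have "norm (fy x - fy 0) \<le> 4.3 * norm (x - 0)" using assms by (intro fy_lipschitz) auto
  then show 1: "norm (fy x) \<le> 4.3 / 15" using assms by simp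
  have "norm (x * fy x) \<le> 1/15 * (4.3 / 15)" unfolding norm_mult using assms 1 by (intro mult_mono) auto
  then show "norm (1 + x * fy x) \<ge> 0.98" using norm_triangle_ineq2[of 1 "- (x * fy x)"] by simp
qed

text \<open>The quotient rule, with Lipschitz constant 24 * 1.07 + 4.3 < 30 and size 30/15 = 2 for
  the numerator, and a denominator of modulus at least 0.98. The outcome is below 32; the 36 is used
  in the form 36/225 = 4/25.\<close>

lemma fE_lipschitz:
  assumes "norm x \<le> 1/15" "norm y \<le> 1/15"
  shows "norm (fE x - fE y) \<le> 36 * norm (x - y)"
proof -
  define W where "W = (\<lambda>r. 8 * fa r + 16 * fb r - fy r)"
  define Y where "Y = (\<lambda>r. 1 + r * fy r)"
  have fE: "fE z = W z / Y z" for z by (simp add: fE_def W_def Y_def)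
  have W: "norm (W x - W y) \<le> 30 * norm (x - y)" if "norm x \<le> 1/15" "norm y \<le> 1/15" for x y
  proof -
    have "W x - W y = (8 * (fa x - fa y) + 16 * (fb x - fb y)) + - (fy x - fy y)" by (simp add: W_def algebra_simps)
    also have "norm \<dots> \<le> (8 * (1.07 * norm (x - y)) + 16 * (1.07 * norm (x - y))) + 4.3 * norm (x - y)"
      using fa_bounds(2)[OF that] fb_bounds(2)[OF that] fy_lipschitz[OF that]
      by (intro norm_triangle_le add_mono) (simp_all only: norm_mult norm_minus_cancel, auto)
    also have "\<dots> = 1499/50 * norm (x - y)" by simp
    also have "\<dots> \<le> 30 * norm (x - y)" by (intro mult_right_mono) auto
    finally show ?thesis .
  qed
  have W0: "norm (W z) \<le> 2" if "norm z \<le> 1/15" for z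
    using W[OF that, of 0] that by (simp add: W_def)
  have Y0: "norm (1 / Y z) \<le> 50/49" if "norm z \<le> 1/15" for z
    using norm_den_ge(2)[OF that] frac_le[of 1 1 "49/50" "norm (Y z)"] by (simp add: norm_divide Y_def)
  have Ynz: "Y z \<noteq> 0" if "norm z \<le> 1/15" for z using norm_den_ge(2)[OF that] by (auto simp: Y_def)
  have Y: "norm (Y x - Y y) \<le> 0.6 * norm (x - y)"
  proof -
    have "Y x - Y y = (x - y) * fy x + y * (fy x - fy y)" by (simp add: Y_def algebra_simps)
    also have "norm \<dots> \<le> norm (x - y) * norm (fy x) + norm y * norm (fy x - fy y)"
      by (rule order_trans[OF norm_triangle_ineq]) (simp add: norm_mult)
    also have "\<dots> \<le> norm (x - y) * (4.3 / 15) + 1/15 * (4.3 * norm (x - y))"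
      using norm_den_ge(1)[OF assms(1)] fy_lipschitz[OF assms] assms
      by (intro add_mono mult_mono) auto
    also have "\<dots> = 43/75 * norm (x - y)" by simp
    also have "\<dots> \<le> 0.6 * norm (x - y)" by (intro mult_right_mono) auto
    finally show ?thesis .
  qed
  have "fE x - fE y = (W x - W y) * (1 / Y x) - W y * (Y x - Y y) * (1 / Y x) * (1 / Y y)"
    using Ynz[OF assms(1)] Ynz[OF assms(2)] unfolding fE by (simp add: field_simps)
  also have "norm \<dots> \<le> norm (W x - W y) * norm (1 / Y x) + norm (W y) * norm (Y x - Y y) * norm (1 / Y x) * norm (1 / Y y)"
    by (rule order_trans[OF norm_triangle_ineq4]) (simp only: norm_mult order_refl)
  also have "\<dots> \<le> (30 * norm (x - y)) * (50/49) + 2 * (0.6 * norm (x - y)) * (50/49) * (50/49)"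
    using W[OF assms] W0[OF assms(2)] Y Y0[OF assms(1)] Y0[OF assms(2)]
    by (intro add_mono mult_mono mult_nonneg_nonneg) auto
  also have "\<dots> = (1500/49 + 3000/2401) * norm (x - y)" by (simp add: algebra_simps)
  also have "\<dots> \<le> 36 * norm (x - y)" by (intro mult_right_mono) auto
  finally show ?thesis .
qed

section \<open>Differences of the roots as series in the nome\<close>

definition psi :: "complex \<Rightarrow> complex" where
  "psi w = w / (1 - w)\<^sup>2"

text \<open>This symmetry folds the rows on the two sides of the real axis onto positive powers of
  the nome. The case \<open>w = 0\<close> holds by the convention \<open>1 / 0 = 0\<close>.\<close>

lemma psi_inverse: "psi (1 / w) = psi w"
proof (cases "w = 0 \<or> w = 1")
  case False
  then have "1 - 1 / w \<noteq> 0" "(1 - 1 / w)\<^sup>2 = (1 - w)\<^sup>2 / w\<^sup>2"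
    by (auto simp: field_simps power2_eq_square)
  then show ?thesis using False by (simp add: psi_def power2_eq_square)
qed (auto simp: psi_def)

text \<open>Euler's formula for the sine. At integers both sides are 0 by the convention on
  division, so the identity holds everywhere.\<close>

lemma csc2_eq_psi: "csc2 u = - 4 * (of_real pi)\<^sup>2 * psi (exp (2 * of_real pi * \<i> * u))"
proof -
  define x where "x = exp (\<i> * (of_real pi * u))"
  have x0: "x \<noteq> 0" by (simp add: x_def)
  have w: "exp (2 * of_real pi * \<i> * u) = x\<^sup>2"
    unfolding x_def exp_of_nat_mult[symmetric] power2_eq_square exp_add[symmetric] by (simp add: algebra_simps)
  have s: "sin (of_real pi * u) = (x - 1 / x) / (2 * \<i>)"
    by (simp add: sin_exp_eq x_def exp_minus inverse_eq_divide)
  show ?thesis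
  proof (cases "x\<^sup>2 = 1")
    case True
    then have "x = 1 / x" using x0 by (simp add: power2_eq_square field_simps)
    then have "sin (of_real pi * u) = 0" unfolding s by simp
    then show ?thesis unfolding csc2_def w psi_def True by simp
  next
    case False
    have d: "x - 1 / x = (x\<^sup>2 - 1) / x" using x0 by (simp add: power2_eq_square field_simps)
    have "(of_real pi / ((x\<^sup>2 - 1) / x / (2 * \<i>)))\<^sup>2 = - 4 * (of_real pi)\<^sup>2 * (x\<^sup>2 / (1 - x\<^sup>2)\<^sup>2)"
      using False x0 by (simp add: field_simps power_mult_distrib power2_commute[of 1])
    then show ?thesis unfolding csc2_def w psi_def s d .
  qed
qed

context period_lattice
begin

definition nome where "nome = exp (\<i> * of_real pi * \<tau>)"

lemma nome_nonzero: "nome \<noteq> 0" by (simp add: nome_def)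

lemma nome_power: "nome ^ n = exp (of_nat n * (\<i> * of_real pi * \<tau>))"
  unfolding nome_def by (simp only: exp_of_nat_mult)

text \<open>The two signs in front of \<open>p\<close> lead to reciprocal arguments of
  \<open>psi\<close>, because \<open>e\<close> is its own inverse.\<close>

lemma csc2_half_shift:
  fixes c :: int
  assumes "exp (\<i> * of_real pi * of_int c) = e" "e = 1 \<or> e = - 1"
  shows "csc2 (of_int c / 2 + of_nat p * \<tau> / 2) = - 4 * (of_real pi)\<^sup>2 * psi (e * nome ^ p)"
    "csc2 (of_int c / 2 - of_nat p * \<tau> / 2) = - 4 * (of_real pi)\<^sup>2 * psi (e * nome ^ p)"
proof -
  have "exp (2 * of_real pi * \<i> * (of_int c / 2 + of_nat p * \<tau> / 2)) =
      exp (\<i> * of_real pi * of_int c + of_nat p * (\<i> * of_real pi * \<tau>))"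
    by (rule arg_cong[of _ _ exp]) (simp add: algebra_simps)
  then show "csc2 (of_int c / 2 + of_nat p * \<tau> / 2) = - 4 * (of_real pi)\<^sup>2 * psi (e * nome ^ p)"
    unfolding csc2_eq_psi nome_power exp_add assms(1) by simp
  have "exp (2 * of_real pi * \<i> * (of_int c / 2 - of_nat p * \<tau> / 2)) =
      exp (\<i> * of_real pi * of_int c + - (of_nat p * (\<i> * of_real pi * \<tau>)))"
    by (rule arg_cong[of _ _ exp]) (simp add: algebra_simps)
  also have "\<dots> = 1 / (e * nome ^ p)"
    unfolding exp_add assms(1) nome_power exp_minus using assms(2) by (auto simp: inverse_eq_divide)
  finally show "csc2 (of_int c / 2 - of_nat p * \<tau> / 2) = - 4 * (of_real pi)\<^sup>2 * psi (e * nome ^ p)"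
    unfolding csc2_eq_psi by (simp only: psi_inverse)
qed

text \<open>The value \<open>c = 0\<close> serves \<open>e2\<close> and \<open>c = - 1\<close>
  serves \<open>e3\<close>. By evenness the second point is replaced by
  \<open>c / 2 - \<tau> / 2\<close>, so that rows \<open>k\<close> and \<open>- k - 1\<close> both
  produce the power \<open>2 * k + 1\<close>; for the point \<open>1 / 2\<close> the same rows
  produce \<open>2 * k\<close> and \<open>2 * k + 2\<close>.\<close>

lemma wp_diff_half_periods:
  fixes c :: int
  assumes c: "exp (\<i> * of_real pi * of_int c) = e" "e = 1 \<or> e = - 1"
    and v: "(\<tau> - of_int c) / 2 \<notin> range L"
  shows "wp (1 / 2) - wp ((\<tau> - of_int c) / 2) =
    - 4 * (of_real pi)\<^sup>2 * ((\<Sum>k. psi (- (nome ^ (2 * k))) - psi (e * nome ^ (2 * k + 1))) +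
            (\<Sum>k. psi (- (nome ^ (2 * k + 2))) - psi (e * nome ^ (2 * k + 1))))"
    (is "_ = ?C * (suminf ?f + suminf ?g)")
proof -
  define v where "v = - ((\<tau> - of_int c) / 2)"
  have h: "1 / 2 \<notin> range L" "v \<notin> range L"
    using half_period_not_lat[of "(1, 0)"] not_lat_uminus[OF assms(3)] by (simp_all add: lat_def v_def)
  have C0: "?C \<noteq> (0 :: complex)" by simp
  have eq: "1 / 2 - of_int (int k) * \<tau> = of_int 1 / 2 - of_nat (2 * k) * \<tau> / 2"
    "1 / 2 - of_int (- int k - 1) * \<tau> = of_int 1 / 2 + of_nat (2 * k + 2) * \<tau> / 2"
    "v - of_int (int k) * \<tau> = of_int c / 2 - of_nat (2 * k + 1) * \<tau> / 2"
    "v - of_int (- int k - 1) * \<tau> = of_int c / 2 + of_nat (2 * k + 1) * \<tau> / 2" for k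
    by (simp_all add: field_simps v_def)
  define F where "F n = csc2 (1 / 2 - of_int n * \<tau>) - csc2 (v - of_int n * \<tau>)" for n :: int
  have "exp (\<i> * of_real pi * of_int 1) = - 1" by simp
  note half = csc2_half_shift[OF this disjI2[OF refl]] csc2_half_shift[OF c]
  have F: "F (int k) = ?C * ?f k" "F (- int k - 1) = ?C * ?g k" for k
    unfolding F_def eq half by (simp_all only: mult_minus1 right_diff_distrib)
  have sF: "F summable_on UNIV" unfolding F_def[abs_def] by (rule wp_diff_csc2(2)[OF h])
  then have "(F \<circ> int) summable_on UNIV" "(F \<circ> (\<lambda>k. - int k - 1)) summable_on UNIV"
    by (auto simp: inj_def summable_on_reindex[symmetric] intro!: summable_on_reindex[THEN iffD1] summable_on_subset_banach[OF sF])
  then have "summable (\<lambda>k. ?C * ?f k)" "summable (\<lambda>k. ?C * ?g k)"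
    by (auto dest!: summable_on_imp_summable simp: o_def F)
  then have "summable ?f" "summable ?g" using C0 by (simp_all only: summable_cmult_iff simp_thms)
  note s = this[THEN suminf_mult]
  have "wp (1 / 2) - wp ((\<tau> - of_int c) / 2) = wp (1 / 2) - wp v" unfolding v_def wp_even ..
  also have "\<dots> = ?C * (suminf ?f + suminf ?g)"
    unfolding wp_diff_csc2(1)[OF h] F_def[symmetric] infsum_int_split[OF sF] F s distrib_left ..
  finally show ?thesis .
qed

lemma e_diffs:
  "e1 - e2 = - 4 * (of_real pi)\<^sup>2 * ((\<Sum>k. psi (- (nome ^ (2 * k))) - psi (nome ^ (2 * k + 1))) +
            (\<Sum>k. psi (- (nome ^ (2 * k + 2))) - psi (nome ^ (2 * k + 1))))"
  "e1 - e3 = - 4 * (of_real pi)\<^sup>2 * ((\<Sum>k. psi (- (nome ^ (2 * k))) - psi (- (nome ^ (2 * k + 1)))) +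
            (\<Sum>k. psi (- (nome ^ (2 * k + 2))) - psi (- (nome ^ (2 * k + 1)))))"
proof -
  have "exp (\<i> * of_real pi * of_int 0) = 1" "exp (\<i> * of_real pi * of_int (- 1)) = - 1"
    by (simp_all add: exp_minus)
  from this[THEN wp_diff_half_periods] show
    "e1 - e2 = - 4 * (of_real pi)\<^sup>2 * ((\<Sum>k. psi (- (nome ^ (2 * k))) - psi (nome ^ (2 * k + 1))) +
            (\<Sum>k. psi (- (nome ^ (2 * k + 2))) - psi (nome ^ (2 * k + 1))))"
    "e1 - e3 = - 4 * (of_real pi)\<^sup>2 * ((\<Sum>k. psi (- (nome ^ (2 * k))) - psi (- (nome ^ (2 * k + 1)))) +
            (\<Sum>k. psi (- (nome ^ (2 * k + 2))) - psi (- (nome ^ (2 * k + 1)))))"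
    using half_period_not_lat[of "(0, 1)"] half_period_not_lat[of "(1, 1)"]
    by (simp_all add: lat_def e1_def e2_def e3_def add.commute)
qed

end

lemma psi_sums:
  fixes r :: complex
  assumes r: "norm r \<le> 1/15"
  shows "(\<lambda>k. psi (- (r ^ (2 * k + 2)))) sums (- (r * fa r))"
    "(\<lambda>k. psi (- (r ^ (2 * k)))) sums (- (r * fa r) - 1 / 4)"
    "(\<lambda>k. psi (r ^ (2 * k + 1))) sums (2 * (r * fb r) + r * (1 + r * fy r))"
    "(\<lambda>k. psi (- (r ^ (2 * k + 1)))) sums (2 * (r * fb r) - r * (1 + r * fy r))"
proof -
  have "(\<lambda>k. r ^ (2 * k + 1) * (1 / (1 + r ^ (2 * k + 2))\<^sup>2)) sums fa r"
    unfolding fa_def using fa_bounds(1)[OF r] by (rule summable_sums)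
  then have "(\<lambda>k. - (r * (r ^ (2 * k + 1) * (1 / (1 + r ^ (2 * k + 2))\<^sup>2)))) sums (- (r * fa r))"
    by (intro sums_minus sums_mult)
  moreover have "- (r * (r ^ (2 * k + 1) * (1 / (1 + r ^ (2 * k + 2))\<^sup>2))) = psi (- (r ^ (2 * k + 2)))" for k
    by (simp add: psi_def)
  ultimately show 1: "(\<lambda>k. psi (- (r ^ (2 * k + 2)))) sums (- (r * fa r))" by simp
  \<comment> \<open>The contribution of the row through the half period \<open>1 / 2\<close> itself.
    This constant becomes the pole \<open>1 / r\<close> of \<open>8 * s\<close>.\<close>
  have "psi (- 1) = - (1 / 4)" by (simp add: psi_def)
  then show "(\<lambda>k. psi (- (r ^ (2 * k)))) sums (- (r * fa r) - 1 / 4)"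
    using 1 sums_Suc_iff[of "\<lambda>k. psi (- (r ^ (2 * k)))" "- (r * fa r)"] by (simp add: algebra_simps)
  have nz: "r ^ (2 * k + 1) \<noteq> 1" "r ^ (2 * k + 1) \<noteq> - 1" "r ^ (4 * k + 2) \<noteq> 1" "r ^ (4 * k + 2) = (r ^ (2 * k + 1))\<^sup>2" for k
  proof -
    have "norm (r ^ (2 * k + 1)) \<le> 1/15 * 1"
      unfolding power_add power_one_right norm_mult using r power_le_one[of "norm r" "2 * k"]
      by (subst mult.commute) (intro mult_mono, auto simp: norm_power)
    then show "r ^ (2 * k + 1) \<noteq> 1" "r ^ (2 * k + 1) \<noteq> - 1" by auto
    moreover show "r ^ (4 * k + 2) = (r ^ (2 * k + 1))\<^sup>2" unfolding power_mult[symmetric] by simp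
    ultimately show "r ^ (4 * k + 2) \<noteq> 1" by (metis power2_eq_1_iff)
  qed
  have sum: "(\<lambda>k. psi (r ^ (2 * k + 1)) + psi (- (r ^ (2 * k + 1)))) sums (4 * (r * fb r))"
  proof -
    have "(\<lambda>k. r ^ (4 * k + 1) * (1 / (1 - r ^ (4 * k + 2))\<^sup>2)) sums fb r"
      unfolding fb_def using fb_bounds(1)[OF r] by (rule summable_sums)
    then have "(\<lambda>k. 4 * (r * (r ^ (4 * k + 1) * (1 / (1 - r ^ (4 * k + 2))\<^sup>2)))) sums (4 * (r * fb r))"
      by (intro sums_mult)
    moreover have "4 * (r * (r ^ (4 * k + 1) * (1 / (1 - r ^ (4 * k + 2))\<^sup>2))) = psi (r ^ (2 * k + 1)) + psi (- (r ^ (2 * k + 1)))" for k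
    proof -
      define x where "x = r ^ (2 * k + 1)"
      have x: "1 - x \<noteq> 0" "1 + x \<noteq> 0" "1 - x\<^sup>2 \<noteq> 0" using nz[of k] by (auto simp: x_def eq_neg_iff_add_eq_0 add.commute)
      have f: "1 - x\<^sup>2 = (1 - x) * (1 + x)" by (simp add: power2_eq_square algebra_simps)
      have "psi x + psi (- x) = 4 * (x\<^sup>2 / (1 - x\<^sup>2)\<^sup>2)"
        unfolding psi_def f power_mult_distrib using x(1,2) by (simp add: divide_simps) (simp add: power2_eq_square algebra_simps)
      moreover have "r * r ^ (4 * k + 1) = x\<^sup>2" unfolding x_def nz(4)[symmetric] by simp
      ultimately show ?thesis unfolding nz(4) x_def[symmetric] by (simp add: mult.assoc[symmetric])
    qed
    ultimately show ?thesis by simp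
  qed
  have diff: "(\<lambda>k. psi (r ^ (2 * k + 1)) - psi (- (r ^ (2 * k + 1)))) sums (2 * (r * (1 + r * fy r)))"
  proof -
    have "(\<lambda>k. r ^ (6 * k + 1) * ((3 - r ^ (4 * k + 2)) / (1 - r ^ (4 * k + 2))\<^sup>2)) sums fc r"
      unfolding fc_def using fc_bounds(1)[OF r] by (rule summable_sums)
    moreover have sq: "norm (r\<^sup>2) < 1"
      using r power_strict_mono[of "norm r" 1 2] by (simp add: norm_power)
    then have "(\<lambda>k. (r\<^sup>2) ^ k) sums (1 / (1 - r\<^sup>2))" by (rule geometric_sums)
    ultimately have "(\<lambda>k. 2 * (r * ((r\<^sup>2) ^ k + r * (r ^ (6 * k + 1) * ((3 - r ^ (4 * k + 2)) / (1 - r ^ (4 * k + 2))\<^sup>2)))))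
      sums (2 * (r * (1 / (1 - r\<^sup>2) + r * fc r)))"
      by (intro sums_mult sums_add)
    moreover have "2 * (r * ((r\<^sup>2) ^ k + r * (r ^ (6 * k + 1) * ((3 - r ^ (4 * k + 2)) / (1 - r ^ (4 * k + 2))\<^sup>2))))
       = psi (r ^ (2 * k + 1)) - psi (- (r ^ (2 * k + 1)))" for k
    proof -
      define x where "x = r ^ (2 * k + 1)"
      have x: "1 - x \<noteq> 0" "1 + x \<noteq> 0" "1 - x\<^sup>2 \<noteq> 0" using nz[of k] by (auto simp: x_def eq_neg_iff_add_eq_0 add.commute)
      have f: "1 - x\<^sup>2 = (1 - x) * (1 + x)" by (simp add: power2_eq_square algebra_simps)
      have e: "psi x - psi (- x) = 2 * (x + x ^ 3 * ((3 - x\<^sup>2) / (1 - x\<^sup>2)\<^sup>2))"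
      proof -
        have "psi x - psi (- x) = 2 * x * (1 + x\<^sup>2) / (1 - x\<^sup>2)\<^sup>2"
          unfolding psi_def f power_mult_distrib using x(1,2) by (simp add: divide_simps) (simp add: power2_eq_square algebra_simps)
        also have "\<dots> = 2 * (x + x ^ 3 * ((3 - x\<^sup>2) / (1 - x\<^sup>2)\<^sup>2))"
          using x(3) by (simp add: divide_simps) algebra
        finally show ?thesis .
      qed
      have p: "r * (r\<^sup>2) ^ k = x" "r * (r * r ^ (6 * k + 1)) = x ^ 3"
      proof -
        show "r * (r\<^sup>2) ^ k = x" by (simp add: x_def power_mult[symmetric])
        have "r * (r * r ^ (6 * k + 1)) = r ^ ((2 * k + 1) * 3)"
          by (simp add: numeral_3_eq_3)
        then show "r * (r * r ^ (6 * k + 1)) = x ^ 3" unfolding x_def by (simp only: power_mult)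
      qed
      have "2 * (r * ((r\<^sup>2) ^ k + r * (r ^ (6 * k + 1) * ((3 - x\<^sup>2) / (1 - x\<^sup>2)\<^sup>2)))) =
         2 * (r * (r\<^sup>2) ^ k + (r * (r * r ^ (6 * k + 1))) * ((3 - x\<^sup>2) / (1 - x\<^sup>2)\<^sup>2))"
        by (simp only: distrib_left mult.assoc)
      then show ?thesis unfolding nz(4) x_def[symmetric] e p .
    qed
    moreover have "1 / (1 - r\<^sup>2) + r * fc r = 1 + r * fy r"
    proof -
      have "1 - r\<^sup>2 \<noteq> 0" using sq by auto
      then show ?thesis unfolding fy_def by (simp add: divide_simps) (simp add: power2_eq_square algebra_simps)
    qed
    ultimately show ?thesis by simp
  qed
  have "(\<lambda>k. ((psi (r ^ (2 * k + 1)) + psi (- (r ^ (2 * k + 1)))) + (psi (r ^ (2 * k + 1)) - psi (- (r ^ (2 * k + 1))))) / 2) sums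
     ((4 * (r * fb r) + 2 * (r * (1 + r * fy r))) / 2)"
    by (intro sums_divide sums_add sum diff)
  then show "(\<lambda>k. psi (r ^ (2 * k + 1))) sums (2 * (r * fb r) + r * (1 + r * fy r))"
    by (simp add: add_divide_distrib)
  have "(\<lambda>k. ((psi (r ^ (2 * k + 1)) + psi (- (r ^ (2 * k + 1)))) - (psi (r ^ (2 * k + 1)) - psi (- (r ^ (2 * k + 1))))) / 2) sums
     ((4 * (r * fb r) - 2 * (r * (1 + r * fy r))) / 2)"
    by (intro sums_divide sums_diff sum diff)
  then show "(\<lambda>k. psi (- (r ^ (2 * k + 1)))) sums (2 * (r * fb r) - r * (1 + r * fy r))"
    by (simp add: diff_divide_distrib)
qed

definition s_of :: "complex \<Rightarrow> complex" where
  "s_of r = (1 / r + fE r) / 8"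

lemma (in period_lattice) s_par_eq:
  assumes r: "norm nome \<le> 1/15"
  shows "e3 \<noteq> e2" "s_par = s_of nome"
proof -
  define r where "r = nome"
  have r0: "r \<noteq> 0" "norm r \<le> 1/15" using nome_nonzero assms by (auto simp: r_def)
  define C where "C = - 4 * (of_real pi :: complex)\<^sup>2"
  have C0: "C \<noteq> 0" by (simp add: C_def)
  define Y where "Y = 1 + r * fy r"
  have Y0: "Y \<noteq> 0" using norm_den_ge(2)[OF r0(2)] by (auto simp: Y_def)
  note p = psi_sums[OF r0(2), folded Y_def]
  have d12: "e1 - e2 = C * ((- (r * fa r) - 1 / 4 - (2 * (r * fb r) + r * Y)) + (- (r * fa r) - (2 * (r * fb r) + r * Y)))"
    unfolding e_diffs(1) C_def r_def[symmetric]
    using sums_unique[OF sums_diff[OF p(2) p(3)]] sums_unique[OF sums_diff[OF p(1) p(3)]] by simp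
  have d13: "e1 - e3 = C * ((- (r * fa r) - 1 / 4 - (2 * (r * fb r) - r * Y)) + (- (r * fa r) - (2 * (r * fb r) - r * Y)))"
    unfolding e_diffs(2) C_def r_def[symmetric]
    using sums_unique[OF sums_diff[OF p(2) p(4)]] sums_unique[OF sums_diff[OF p(1) p(4)]] by simp
  have "e3 - e2 = (e1 - e2) - (e1 - e3)" by simp
  also have "\<dots> = C * (- 4 * (r * Y))" unfolding d12 d13 by (simp add: algebra_simps)
  finally have e32: "e3 - e2 = C * (- 4 * (r * Y))" .
  then show "e3 \<noteq> e2" using C0 r0 Y0 by auto
  have "2 * e1 - e2 - e3 = (e1 - e2) + (e1 - e3)" by simp
  also have "\<dots> = C * (- (1 / 2) - 4 * (r * fa r) - 8 * (r * fb r))" unfolding d12 d13 by (simp add: algebra_simps)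
  finally have "s_par = (- (1 / 2) - 4 * (r * fa r) - 8 * (r * fb r)) / (- 4 * (r * Y))"
    unfolding s_par_def e32 using C0 by simp
  also have "\<dots> = (1 / r + (8 * fa r + 16 * fb r - fy r) / Y) / 8"
  proof -
    have "(1 / r + (8 * fa r + 16 * fb r - fy r) / Y) / 8 = (Y + r * (8 * fa r + 16 * fb r - fy r)) / (8 * (r * Y))"
      using r0 Y0 by (simp add: field_simps)
    also have "Y + r * (8 * fa r + 16 * fb r - fy r) = 1 + 8 * (r * fa r) + 16 * (r * fb r)"
      by (simp add: Y_def algebra_simps)
    also have "(1 + 8 * (r * fa r) + 16 * (r * fb r)) / (8 * (r * Y)) = (- (1 / 2) - 4 * (r * fa r) - 8 * (r * fb r)) / (- 4 * (r * Y))"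
      using r0 Y0 by (simp add: divide_simps)
    finally show ?thesis ..
  qed
  also have "\<dots> = s_of nome" unfolding s_of_def fE_def Y_def r_def ..
  finally show "s_par = s_of nome" .
qed

section \<open>The Hauptmodul on the fundamental domain\<close>

text \<open>Otherwise \<open>pi / 6\<close> would be at most 0.52342, where a Taylor estimate keeps
  the sine under 1/2. With the next two bounds this gives
  \<open>exp (pi * sqrt 3 / 2) >= 15\<close>.\<close>

lemma pi_lower_bound: "pi \<ge> 3.1405"
proof (rule ccontr)
  assume "\<not> ?thesis"
  then have small: "pi / 6 \<le> 0.52342" by simp
  have taylor: "(\<Sum>m<5. sin_coeff m * x ^ m) = x - x ^ 3 / 6" for x :: real
    by (simp add: lessThan_nat_numeral lessThan_Suc sin_coeff_def fact_numeral)
  have bound: "\<bar>sin x - (x - x ^ 3 / 6)\<bar> \<le> 1 / 120 * \<bar>x\<bar> ^ 5" for x :: real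
    using Maclaurin_sin_bound[of x 5] unfolding taylor by (simp add: fact_numeral inverse_eq_divide)
  define c :: real where "c = 0.52342"
  have "sin c - (c - c ^ 3 / 6) \<le> 1 / 120 * \<bar>c\<bar> ^ 5"
    by (rule order_trans[OF abs_ge_self bound])
  moreover have "c - c ^ 3 / 6 + 1 / 120 * \<bar>c\<bar> ^ 5 < 1 / 2"
    by (simp add: c_def eval_nat_numeral)
  ultimately have "sin (0.52342 :: real) < 1 / 2" unfolding c_def by linarith
  moreover have "sin (pi / 6) \<le> sin 0.52342"
    using small pi_ge_two by (intro sin_monotone_2pi_le) auto
  ultimately show False by (simp add: sin_30)
qed

text \<open>2.718 is 20 * 0.1359, and the quadratic Taylor polynomial of \<open>exp\<close> at
  0.1359 exceeds 1.1451.\<close>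

lemma exp_lower_bound: "exp (2.718 :: real) \<ge> 15"
proof -
  have "(15 :: real) \<le> 1.1451 ^ 20" by (simp add: eval_nat_numeral)
  also have "\<dots> \<le> exp 0.1359 ^ 20"
    using exp_lower_Taylor_quadratic[of "0.1359"] by (intro power_mono) (simp_all add: power2_eq_square)
  also have "\<dots> = exp 2.718" by (simp flip: exp_of_nat_mult)
  finally show ?thesis .
qed

lemma sqrt3_lower_bound: "sqrt 3 \<ge> 1.732"
  by (rule real_le_rsqrt) (simp add: power2_eq_square)

lemma Im_fundamental:
  assumes "\<bar>Re t\<bar> \<le> 1 / 2" "norm t \<ge> 1" "Im t > 0"
  shows "Im t \<ge> sqrt 3 / 2"
proof -
  have "(Re t)\<^sup>2 \<le> (1 / 2)\<^sup>2" using assms by (intro abs_le_square_iff[THEN iffD1]) auto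
  moreover have "(norm t)\<^sup>2 \<ge> 1" using assms by (simp add: one_le_power)
  ultimately have "(sqrt 3 / 2)\<^sup>2 \<le> (Im t)\<^sup>2"
    unfolding cmod_power2 by (simp add: power2_eq_square field_simps)
  then show ?thesis by (rule power2_le_imp_le) (use assms in auto)
qed

definition nome_of :: "complex \<Rightarrow> complex" where
  "nome_of t = exp (\<i> * of_real pi * t)"

lemma norm_nome_of: "norm (nome_of t) = exp (- pi * Im t)"
  by (simp add: nome_of_def norm_exp_eq_Re)

text \<open>Origin of the radius 1/15: the nome is largest at the lowest height
  \<open>sqrt 3 / 2\<close>, where its reciprocal has modulus about 15.19.\<close>

lemma norm_nome_of_le:
  assumes "Im t \<ge> sqrt 3 / 2"
  shows "norm (nome_of t) \<le> 1 / 15" "exp (pi * Im t) \<ge> 15"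
proof -
  have "2.718 \<le> 3.1405 * (1.732 / 2 :: real)" by simp
  also have "\<dots> \<le> pi * Im t"
    using pi_lower_bound sqrt3_lower_bound assms by (intro mult_mono) auto
  finally have "exp 2.718 \<le> exp (pi * Im t)" by simp
  then show "exp (pi * Im t) \<ge> 15" using exp_lower_bound by linarith
  then show "norm (nome_of t) \<le> 1 / 15"
    unfolding norm_nome_of by (simp add: exp_minus field_simps)
qed

lemma nome_of_nonzero [simp]: "nome_of t \<noteq> 0" by (simp add: nome_of_def)

lemma nome_of_cnj: "nome_of (- cnj t) = cnj (nome_of t)"
  by (simp add: nome_of_def exp_cnj)

lemma nome_of_add_1: "nome_of (t + 1) = - nome_of t"
  by (simp add: nome_of_def distrib_left exp_add)

lemma nome_of_diff_1: "nome_of (t - 1) = - nome_of t"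
  by (simp add: nome_of_def right_diff_distrib exp_diff)

lemma fE_minus:
  assumes "norm r \<le> 1 / 15"
  shows "fE (- r) = - fE r"
proof -
  have o: "(- r) ^ (2 * k + 1) = - (r ^ (2 * k + 1))" "(- r) ^ (4 * k + 1) = - (r ^ (4 * k + 1))"
      "(- r) ^ (6 * k + 1) = - (r ^ (6 * k + 1))" for k
    by (auto intro!: power_minus_odd)
  have e: "(- r) ^ (2 * k + 2) = r ^ (2 * k + 2)" "(- r) ^ (4 * k + 2) = r ^ (4 * k + 2)" for k
    by (auto intro!: power_minus_even)
  have f: "fa (- r) = - fa r" "fb (- r) = - fb r" "fc (- r) = - fc r"
    unfolding fa_def fb_def fc_def o e mult_minus_left
    using fa_bounds(1)[OF assms] fb_bounds(1)[OF assms] fc_bounds(1)[OF assms]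
    by (simp_all only: suminf_minus)
  have fy: "fy (- r) = - fy r" unfolding fy_def f by simp
  have num: "8 * fa (- r) + 16 * fb (- r) - fy (- r) = - (8 * fa r + 16 * fb r - fy r)"
    unfolding f fy by simp
  have den: "1 + (- r) * fy (- r) = 1 + r * fy r" unfolding fy by simp
  show ?thesis unfolding fE_def num den by (rule minus_divide_left[symmetric])
qed

lemma suminf_complex_cnj:
  assumes "summable f"
  shows "(\<Sum>k. cnj (f k)) = cnj (\<Sum>k. f k)"
  using summable_sums[OF assms] by (metis sums_cnj sums_unique)

lemma fE_cnj:
  assumes "norm r \<le> 1 / 15"
  shows "fE (cnj r) = cnj (fE r)"
proof -
  have "fa (cnj r) = cnj (fa r)" "fb (cnj r) = cnj (fb r)" "fc (cnj r) = cnj (fc r)"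
    unfolding fa_def fb_def fc_def
    using fa_bounds(1)[OF assms] fb_bounds(1)[OF assms] fc_bounds(1)[OF assms]
    by (simp_all flip: suminf_complex_cnj)
  then show ?thesis unfolding fE_def fy_def by simp
qed

text \<open>A sign change of the nome is a translation of the point by 1, so this is how translation
  acts on \<open>s\<close>.\<close>

lemma s_of_minus:
  assumes "norm r \<le> 1 / 15"
  shows "s_of (- r) = - s_of r"
proof -
  have "s_of (- r) = - (1 / r + fE r) / 8" by (simp add: s_of_def fE_minus[OF assms])
  then show ?thesis by (simp only: s_of_def minus_divide_left)
qed

lemma s_of_cnj: "norm r \<le> 1 / 15 \<Longrightarrow> s_of (cnj r) = cnj (s_of r)"
  by (simp add: s_of_def fE_cnj)

text \<open>As \<open>x - y\<close> is, up to sign, \<open>x * y\<close> times the difference of the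
  reciprocals, the variation of \<open>fE\<close> is at most 36/225 = 4/25 of that difference; (1 -
  4/25) / 8 = 21/200 is left.\<close>

lemma s_of_separation:
  assumes "norm x \<le> 1 / 15" "norm y \<le> 1 / 15" "x \<noteq> 0" "y \<noteq> 0"
  shows "norm (s_of x - s_of y) \<ge> 21 / 200 * norm (1 / x - 1 / y)"
proof -
  have "norm (x - y) = norm x * norm y * norm (1 / x - 1 / y)"
  proof -
    have "x - y = - (x * y * (1 / x - 1 / y))" using assms by (simp add: field_simps)
    then show ?thesis by (metis norm_minus_cancel norm_mult)
  qed
  also have "\<dots> \<le> (1/15 * (1/15)) * norm (1 / x - 1 / y)"
    using assms by (intro mult_right_mono mult_mono) auto
  finally have "36 * norm (x - y) \<le> 4 / 25 * norm (1 / x - 1 / y)" by simp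
  then have "norm (fE x - fE y) \<le> 4 / 25 * norm (1 / x - 1 / y)"
    using fE_lipschitz[OF assms(1,2)] by linarith
  moreover have "norm (1 / x - 1 / y) - norm (fE x - fE y) \<le> norm ((1 / x - 1 / y) + (fE x - fE y))"
    by (rule norm_diff_ineq)
  moreover have "s_of x - s_of y = ((1 / x - 1 / y) + (fE x - fE y)) / 8"
    by (simp add: s_of_def diff_divide_distrib add_divide_distrib)
  then have "norm (s_of x - s_of y) = norm ((1 / x - 1 / y) + (fE x - fE y)) / 8"
    by (metis norm_divide norm_numeral)
  ultimately show ?thesis by simp
qed

lemma fE_norm_le:
  assumes "norm x \<le> 1 / 15"
  shows "norm (fE x) \<le> 36 * norm x"
  using fE_lipschitz[OF assms, of 0] by (simp add: fE_def)

text \<open>Reflection in the imaginary axis: \<open>fE\<close> is odd and commutes with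
  conjugation, so its Lipschitz bound between \<open>r\<close> and \<open>- cnj r\<close> limits
  \<open>Re (fE r)\<close> to \<open>36 * Re r\<close>, whereas \<open>Re (1 / r)\<close> is at
  least \<open>225 * Re r\<close>.\<close>

lemma Re_s_of_nonneg:
  assumes "norm r \<le> 1 / 15" "r \<noteq> 0" "Re r \<ge> 0"
  shows "Re (s_of r) \<ge> 0"
proof -
  have "norm (fE r - fE (- cnj r)) \<le> 36 * norm (r - - cnj r)"
    using assms by (intro fE_lipschitz) auto
  also have "r - - cnj r = of_real (2 * Re r)" by (simp add: complex_add_cnj)
  also have "norm \<dots> = 2 * Re r" using assms(3) by simp
  also have "fE r - fE (- cnj r) = of_real (2 * Re (fE r))"
    using assms by (simp add: fE_minus fE_cnj complex_add_cnj)
  finally have "\<bar>Re (fE r)\<bar> \<le> 36 * Re r" by simp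
  moreover have "Re (1 / r) = Re r * (1 / (norm r)\<^sup>2)" by (simp add: Re_divide cmod_power2)
  moreover have "Re r * 36 \<le> Re r * (1 / (norm r)\<^sup>2)"
  proof (rule mult_left_mono)
    have "(norm r)\<^sup>2 \<le> (1/15)\<^sup>2" using assms by (intro power_mono) auto
    then have "36 * (norm r)\<^sup>2 \<le> 1" by (simp add: power2_eq_square)
    then show "36 \<le> 1 / (norm r)\<^sup>2" using assms(2) by (simp add: field_simps)
  qed (rule assms)
  ultimately have "Re (1 / r) + Re (fE r) \<ge> 0" by (simp add: abs_le_iff)
  then show ?thesis by (simp add: s_of_def)
qed

lemma Re_nome_of_nonneg:
  assumes "\<bar>Re t\<bar> \<le> 1 / 2"
  shows "Re (nome_of t) \<ge> 0"
proof -
  have "\<bar>pi * Re t\<bar> \<le> pi / 2" using assms by (simp add: abs_mult)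
  then have "cos (pi * Re t) \<ge> 0" by (intro cos_ge_zero) linarith+
  then show ?thesis by (simp add: nome_of_def Re_exp)
qed

text \<open>\<open>8 * c - fE r\<close> has modulus at most 8 + 36/15, while \<open>1 / r\<close>
  has modulus at least 15.\<close>

lemma s_of_ne_1:
  assumes "norm r \<le> 1 / 15" "r \<noteq> 0" "c = 1 \<or> c = - 1"
  shows "s_of r \<noteq> c"
proof
  assume "s_of r = c"
  then have "1 / r = 8 * c - fE r" by (simp add: s_of_def field_simps)
  then have "norm (1 / r) \<le> 8 + 36 * norm r"
    using norm_triangle_ineq4[of "8 * c" "fE r"] fE_norm_le[OF assms(1)] assms(3) by (auto simp: norm_mult)
  moreover have "norm (1 / r) \<ge> 15" using assms frac_le[of 1 1 "norm r" "1/15"] by (simp add: norm_divide)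
  ultimately show False using assms(1) by simp
qed

context period_lattice
begin

lemma nome_eq: "nome = nome_of \<tau>" by (simp add: nome_def nome_of_def)

lemma klein_j_s_of:
  assumes "norm (nome_of \<tau>) \<le> 1 / 15"
  shows "klein_j \<tau> = j_of_s (s_of (nome_of \<tau>))"
proof -
  note s = s_par_eq[unfolded nome_eq, OF assms]
  show ?thesis
    using klein_j_eq_j_of_s[OF s(1)] s_of_ne_1[OF assms] by (simp add: s(2))
qed

text \<open>On the unit circle \<open>- 1 / \<tau>\<close> equals \<open>- cnj \<tau>\<close>, where
  \<open>s\<close> takes the conjugate value, so the relation for inversion turns into
  \<open>norm (s - 1) ^ 2 = 4\<close>.\<close>

lemma s_of_arc:
  assumes "norm (nome_of \<tau>) \<le> 1 / 15" "norm \<tau> = 1"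
  shows "norm (s_of (nome_of \<tau>) - 1) = 2"
proof -
  have inv: "- 1 / \<tau> = - cnj \<tau>"
  proof -
    have "\<tau> * cnj \<tau> = 1" "\<tau> \<noteq> 0" using complex_norm_square[of \<tau>] assms(2) by auto
    then have "cnj \<tau> = 1 / \<tau>" by (simp add: field_simps)
    then show ?thesis by simp
  qed
  interpret inv: period_lattice "- 1 / \<tau>"
    using Im_pos unfolding inv by unfold_locales simp
  note s = s_par_eq[unfolded nome_eq, OF assms(1)]
  have "norm (nome_of (- 1 / \<tau>)) \<le> 1 / 15" unfolding inv nome_of_cnj using assms by simp
  from inv.s_par_eq(2)[unfolded inv.nome_eq, OF this]
  have "inv.s_par = cnj (s_of (nome_of \<tau>))"
    unfolding inv nome_of_cnj using assms by (simp add: s_of_cnj)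
  then have "(cnj (s_of (nome_of \<tau>)) - 1) * (s_of (nome_of \<tau>) - 1) = 4"
    using s_par_invert[OF s(1)] s_of_ne_1[OF assms(1)] unfolding s(2) by simp
  then have "cnj (s_of (nome_of \<tau>) - 1) * (s_of (nome_of \<tau>) - 1) = 4"
    unfolding complex_cnj_diff complex_cnj_one .
  then have "complex_of_real ((norm (s_of (nome_of \<tau>) - 1))\<^sup>2) = of_real (2\<^sup>2)"
    unfolding complex_norm_square by (simp add: mult.commute)
  then have "(norm (s_of (nome_of \<tau>) - 1))\<^sup>2 = 2\<^sup>2" by (simp only: of_real_eq_iff)
  then show ?thesis by (rule power2_eq_imp_eq) auto
qed

end

text \<open>Moving up from the unit circle along a vertical line, \<open>8 s\<close> is dominated by \<open>1 / r\<close>,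
  so its distance to \<open>8\<close> grows from the value \<open>16\<close>.\<close>

lemma s_of_vertical:
  assumes t: "\<bar>Re t\<bar> \<le> 1 / 2" "norm t \<ge> 1" "Im t > 0"
  shows "norm (s_of (nome_of t) - 1) \<ge> 2 + 5 / 4 * (Im t - sqrt (1 - (Re t)\<^sup>2))"
proof -
  define y0 where "y0 = sqrt (1 - (Re t)\<^sup>2)"
  have re: "(Re t)\<^sup>2 \<le> (1 / 2)\<^sup>2" using t by (intro abs_le_square_iff[THEN iffD1]) auto
  then have y0_sq: "y0\<^sup>2 = 1 - (Re t)\<^sup>2" by (simp add: y0_def power2_eq_square)
  have "sqrt (3 / 4) \<le> y0" unfolding y0_def using re by (intro real_sqrt_le_mono) (simp add: power2_eq_square)
  then have "y0 \<ge> sqrt 3 / 2" by (simp add: real_sqrt_divide)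
  moreover have "sqrt 3 / 2 > 0" by simp
  ultimately have y0: "y0 \<ge> sqrt 3 / 2" "y0 > 0" by linarith+
  have "y0\<^sup>2 \<le> (Im t)\<^sup>2"
    unfolding y0_sq using t(2) by (simp add: cmod_def real_le_rsqrt real_sqrt_ge_1_iff)
  then have y: "y0 \<le> Im t" by (rule power2_le_imp_le) (use t in auto)
  define t0 where "t0 = Complex (Re t) y0"
  define r0 where "r0 = nome_of t0"
  \<comment> \<open>\<open>t0\<close> is the point of the unit circle on the vertical line through
    \<open>t\<close>, and the nome of \<open>t\<close> is \<open>e\<close> times that of
    \<open>t0\<close>.\<close>
  define e where "e = exp (- pi * (Im t - y0))"
  have e: "0 < e" "e \<le> 1" using y by (auto simp: e_def)
  have r0: "norm r0 \<le> 1 / 15" "r0 \<noteq> 0" using norm_nome_of_le[of t0] y0 by (auto simp: r0_def t0_def)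
  have r: "nome_of t = of_real e * r0"
  proof -
    have "\<i> * of_real pi * t = of_real (- pi * (Im t - y0)) + \<i> * of_real pi * t0"
      by (simp add: t0_def complex_eq_iff algebra_simps)
    then show ?thesis unfolding nome_of_def e_def r0_def exp_of_real[symmetric] by (simp only: exp_add)
  qed
  have rn: "norm (of_real e * r0) \<le> 1 / 15"
    using mult_mono[OF e(2) r0(1)] e by (simp add: norm_mult)
  interpret period_lattice t0 using y0 by unfold_locales (simp add: t0_def)
  have n0: "norm t0 = 1" using y0_sq by (simp add: t0_def cmod_def)
  have arc: "norm (s_of r0 - 1) = 2" using s_of_arc[OF _ n0] r0 by (simp add: r0_def)
  \<comment> \<open>Multiplying \<open>8 * (s - 1)\<close> by \<open>e\<close> gives it the same
    pole term as at \<open>r0\<close>. \<open>U\<close> collects the known value on the arc and the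
    change of the constant 8, \<open>V\<close> the deviation of \<open>fE\<close>.\<close>
  define U where "U = 8 * (s_of r0 - 1) + 8 * complex_of_real (1 - e)"
  define V where "V = of_real e * (fE (of_real e * r0) - fE r0) - of_real (1 - e) * fE r0"
  have "8 * of_real e * (s_of (of_real e * r0) - 1) = U + V"
    using e r0 by (simp add: s_of_def U_def V_def field_simps)
  then have "norm (8 * complex_of_real e * (s_of (of_real e * r0) - 1)) = norm (U + V)" by (simp only:)
  moreover have "norm (8 * complex_of_real e * (s_of (of_real e * r0) - 1)) = 8 * (e * norm (s_of (of_real e * r0) - 1))"
    using e by (simp add: norm_mult)
  moreover have "norm U \<ge> 16 - 8 * (1 - e)"
  proof -
    have "norm (8 * (s_of r0 - 1)) = 16" by (simp only: norm_mult arc norm_numeral)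
    moreover have "norm (8 * complex_of_real (1 - e)) = 8 * (1 - e)"
      using e by (simp only: norm_mult norm_of_real norm_numeral abs_of_nonneg)
    ultimately show ?thesis using norm_diff_ineq[of "8 * (s_of r0 - 1)" "8 * complex_of_real (1 - e)"] unfolding U_def by linarith
  qed
  moreover have "norm V \<le> 24 / 5 * (1 - e)"
  proof -
    have "norm (fE (of_real e * r0) - fE r0) \<le> 36 * norm (of_real e * r0 - r0)"
      using rn r0 by (intro fE_lipschitz) auto
    also have "of_real e * r0 - r0 = - (of_real (1 - e) * r0)" by (simp add: algebra_simps)
    also have "norm \<dots> = (1 - e) * norm r0" using e by (simp add: norm_mult del: of_real_diff)
    also have "36 * ((1 - e) * norm r0) \<le> 36 * ((1 - e) * (1 / 15))"
      using e r0 by (intro mult_left_mono) auto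
    finally have 1: "norm (fE (of_real e * r0) - fE r0) \<le> 12 / 5 * (1 - e)" by simp
    have 2: "norm (fE r0) \<le> 12 / 5" using fE_norm_le[OF r0(1)] r0(1) by simp
    have "norm V \<le> e * norm (fE (of_real e * r0) - fE r0) + (1 - e) * norm (fE r0)"
      unfolding V_def using e by (intro order_trans[OF norm_triangle_ineq4]) (simp add: norm_mult del: of_real_diff)
    also have "\<dots> \<le> 1 * (12 / 5 * (1 - e)) + (1 - e) * (12 / 5)"
      using e 1 2 by (intro add_mono mult_mono) auto
    also have "\<dots> = 24 / 5 * (1 - e)" by (simp add: field_simps)
    finally show ?thesis .
  qed
  ultimately have "16 - 8 * (1 - e) - 24 / 5 * (1 - e) \<le> 8 * (e * norm (s_of (of_real e * r0) - 1))"
    using norm_diff_ineq[of U V] by linarith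
  then have "2 / 5 + 8 / 5 * e \<le> e * norm (s_of (nome_of t) - 1)" unfolding r by (simp add: field_simps)
  \<comment> \<open>This is 16 - (8 + 24/5) * (1 - e), divided by \<open>8 * e\<close>. Below,
    \<open>1 / e >= 1 + 25/8 * (Im t - y0)\<close> turns 2/5 into the slope 5/4.\<close>
  then have main: "8 / 5 + 2 / 5 * (1 / e) \<le> norm (s_of (nome_of t) - 1)"
    using e by (simp add: field_simps)
  have "1 / e = exp (pi * (Im t - y0))"
    by (simp only: e_def mult_minus_left exp_minus divide_inverse inverse_inverse_eq mult_1_left)
  also have "\<dots> \<ge> 1 + pi * (Im t - y0)" by (rule exp_ge_add_one_self)
  finally have "1 / e \<ge> 1 + pi * (Im t - y0)" .
  moreover have "25 / 8 * (Im t - y0) \<le> pi * (Im t - y0)"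
    using pi_lower_bound y by (intro mult_right_mono) auto
  ultimately have "1 + 25 / 8 * (Im t - y0) \<le> 1 / e" by (rule order_trans[OF add_left_mono, rotated])
  then have "2 / 5 * (1 + 25 / 8 * (Im t - y0)) \<le> 2 / 5 * (1 / e)" by (intro mult_left_mono) auto
  then have "2 + 5 / 4 * (Im t - y0) \<le> 8 / 5 + 2 / 5 * (1 / e)" by (simp add: field_simps)
  also note main
  finally show ?thesis unfolding y0_def .
qed

text \<open>For \<open>R >= 1\<close> the point is at least as far from 1 as its projection to the
  unit circle, that is, as a chord of length \<open>2 * sin (pi * \<bar>\<delta>\<bar> / 2)\<close>.
  With \<open>sin x >= 5/6 * x\<close> at \<open>x = 3 * pi / (4 * d)\<close> this is at least
  \<open>5 * pi / (4 * d)\<close>, and \<open>5 * pi / 4\<close> exceeds 39/10.\<close>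

lemma chord_lower_bound:
  fixes \<delta> d R :: real
  assumes "3 \<le> d" "3 / (2 * d) \<le> \<bar>\<delta>\<bar>" "\<bar>\<delta>\<bar> \<le> 1" "R \<ge> 1"
  shows "norm (of_real R * cis (pi * \<delta>) - 1) \<ge> 39 / (10 * d)"
proof -
  define x where "x = 3 * pi / (4 * d)"
  have x: "0 < x" "x \<le> 1" using assms pi_less_4 by (auto simp: x_def field_simps)
  have "\<bar>sin x - x\<bar> \<le> 1 / 6 * \<bar>x\<bar> ^ 3"
  proof -
    have "(\<Sum>m<3. sin_coeff m * x ^ m) = x"
      by (simp add: lessThan_nat_numeral lessThan_Suc sin_coeff_def)
    then show ?thesis using Maclaurin_sin_bound[of x 3] by (simp add: fact_numeral inverse_eq_divide)
  qed
  moreover have "\<bar>x\<bar> ^ 3 \<le> x"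
    using x by (simp add: power3_eq_cube mult_le_one)
  moreover have "x - sin x \<le> \<bar>sin x - x\<bar>" by simp
  ultimately have "sin x \<ge> 5 / 6 * x" by linarith
  moreover have "sin x \<le> sin (pi * \<bar>\<delta>\<bar> / 2)"
  proof (rule sin_monotone_2pi_le)
    have "x = pi * (3 / (2 * d)) / 2" by (simp add: x_def)
    also have "\<dots> \<le> pi * \<bar>\<delta>\<bar> / 2" using assms by (intro divide_right_mono mult_left_mono) auto
    finally show "x \<le> pi * \<bar>\<delta>\<bar> / 2" .
    show "pi * \<bar>\<delta>\<bar> / 2 \<le> pi / 2" using assms by simp
    show "- (pi / 2) \<le> x" using x(1) pi_gt_zero by linarith
  qed
  moreover have "2 * (5 / 6 * x) \<ge> 39 / (10 * d)"
    using pi_lower_bound assms(1) by (simp add: x_def field_simps)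
  ultimately have s: "2 * sin (pi * \<bar>\<delta>\<bar> / 2) \<ge> 39 / (10 * d)" by linarith
  have "cos (pi * \<delta>) = cos (pi * \<bar>\<delta>\<bar>)" by (cases "\<delta> \<ge> 0") auto
  also have "\<dots> = 1 - 2 * (sin (pi * \<bar>\<delta>\<bar> / 2))\<^sup>2"
    using cos_double_sin[of "pi * \<bar>\<delta>\<bar> / 2"] by simp
  finally have c: "cos (pi * \<delta>) = 1 - 2 * (sin (pi * \<bar>\<delta>\<bar> / 2))\<^sup>2" .
  have "(R - 1) * (R + 1 - 2 * cos (pi * \<delta>)) \<ge> 0"
    using assms(4) cos_le_one[of "pi * \<delta>"] by (intro mult_nonneg_nonneg) linarith+
  moreover have "(norm (of_real R * cis (pi * \<delta>) - 1))\<^sup>2 = R\<^sup>2 - 2 * R * cos (pi * \<delta>) + 1"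
  proof -
    have "(norm (of_real R * cis (pi * \<delta>) - 1))\<^sup>2 = (R * cos (pi * \<delta>) - 1)\<^sup>2 + (R * sin (pi * \<delta>))\<^sup>2"
      unfolding cmod_power2 by simp
    also have "(R * sin (pi * \<delta>))\<^sup>2 = R\<^sup>2 * (1 - (cos (pi * \<delta>))\<^sup>2)"
      by (simp add: power_mult_distrib sin_squared_eq)
    finally show ?thesis by (simp add: power2_eq_square algebra_simps)
  qed
  ultimately have "(norm (of_real R * cis (pi * \<delta>) - 1))\<^sup>2 \<ge> 2 - 2 * cos (pi * \<delta>)"
    by (simp add: power2_eq_square algebra_simps)
  then have "(2 * sin (pi * \<bar>\<delta>\<bar> / 2))\<^sup>2 \<le> (norm (of_real R * cis (pi * \<delta>) - 1))\<^sup>2"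
    unfolding c by (simp add: power_mult_distrib)
  then have "2 * sin (pi * \<bar>\<delta>\<bar> / 2) \<le> norm (of_real R * cis (pi * \<delta>) - 1)"
    by (rule power2_le_imp_le) simp
  then show ?thesis using s by linarith
qed

section \<open>Separation of imaginary quadratic points\<close>

text \<open>The real part is left free so that integer translates and reflections in the imaginary
  axis stay in the class; the lower bound on the height keeps the nome in the disc where
  \<open>s_of\<close> is controlled.\<close>

definition reduced_point :: "real \<Rightarrow> complex \<Rightarrow> bool" where
  "reduced_point d z \<longleftrightarrow> Im z \<ge> sqrt 3 / 2 \<and> (\<exists>a b c :: int. a > 0 \<and>
     of_int a * z\<^sup>2 + of_int b * z + of_int c = 0 \<and> of_int (4 * a * c - b\<^sup>2) \<le> d)"

lemma reduced_point_translate: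
  assumes "reduced_point d z"
  shows "reduced_point d (z + of_int n)"
proof -
  from assms obtain a b c :: int where abc: "Im z \<ge> sqrt 3 / 2" "a > 0"
    "of_int a * z\<^sup>2 + of_int b * z + of_int c = 0" "of_int (4 * a * c - b\<^sup>2) \<le> d"
    unfolding reduced_point_def by blast
  have "of_int a * (z + of_int n)\<^sup>2 + of_int (b - 2 * a * n) * (z + of_int n) + of_int (a * n\<^sup>2 - b * n + c) =
     of_int a * z\<^sup>2 + of_int b * z + of_int c"
    by (simp add: power2_eq_square algebra_simps)
  moreover have "4 * a * (a * n\<^sup>2 - b * n + c) - (b - 2 * a * n)\<^sup>2 = 4 * a * c - b\<^sup>2"
    by (simp add: power2_eq_square algebra_simps)
  ultimately show ?thesis unfolding reduced_point_def
    using abc by (intro conjI exI[of _ a] exI[of _ "b - 2 * a * n"] exI[of _ "a * n\<^sup>2 - b * n + c"]) simp_all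
qed

lemma reduced_point_reflect:
  assumes "reduced_point d z"
  shows "reduced_point d (- cnj z)"
proof -
  from assms obtain a b c :: int where abc: "Im z \<ge> sqrt 3 / 2" "a > 0"
    "of_int a * z\<^sup>2 + of_int b * z + of_int c = 0" "of_int (4 * a * c - b\<^sup>2) \<le> d"
    unfolding reduced_point_def by blast
  have "of_int a * (- cnj z)\<^sup>2 + of_int (- b) * (- cnj z) + of_int c = cnj (of_int a * z\<^sup>2 + of_int b * z + of_int c)"
    by simp
  then show ?thesis unfolding reduced_point_def
    using abc by (intro conjI exI[of _ a] exI[of _ "- b"] exI[of _ c]) simp_all
qed

text \<open>Distinct real parts are fractions with denominators \<open>2 * a\<close> and
  \<open>2 * a'\<close>, and the heights force \<open>3 * a * a' <= d\<close>. If the real parts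
  agree, the squares of the heights differ by a nonzero integer over \<open>a * a'\<close>, while
  \<open>a * a'\<close> times the sum of the heights is at most \<open>d / sqrt 3\<close>.\<close>

lemma quadratic_separation:
  fixes a b c a' b' c' :: int
  assumes z: "Im z \<ge> sqrt 3 / 2" "a > 0" "of_int a * z\<^sup>2 + of_int b * z + of_int c = 0" "of_int (4 * a * c - b\<^sup>2) \<le> d"
    and w: "Im w \<ge> sqrt 3 / 2" "a' > 0" "of_int a' * w\<^sup>2 + of_int b' * w + of_int c' = 0" "of_int (4 * a' * c' - b'\<^sup>2) \<le> d"
    and ne: "z \<noteq> w"
  shows "d \<ge> 3" "3 / (2 * d) \<le> \<bar>Re z - Re w\<bar> \<or> Re z = Re w \<and> sqrt 3 / d \<le> \<bar>Im z - Im w\<bar>"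
proof -
  have s3: "sqrt 3 / 2 > 0" by simp
  have pos: "Im z > 0" "Im w > 0" using z(1) w(1) s3 by linarith+
  have aI: "2 * (p * Im v) \<le> sqrt d" "p * sqrt 3 \<le> sqrt d" "3 * (real_of_int p)\<^sup>2 \<le> d"
    if "Im v \<ge> sqrt 3 / 2" "p > 0" "of_int p * v\<^sup>2 + of_int q * v + of_int r = 0" "of_int (4 * p * r - q\<^sup>2) \<le> d"
    for p q r :: int and v
  proof -
    have "Im v > 0" using that(1) s3 by linarith
    from quadratic_disc(2)[OF this that(2,3)] have "4 * (p * Im v)\<^sup>2 \<le> d" using that(4) by simp
    then show 1: "2 * (p * Im v) \<le> sqrt d" by (intro real_le_rsqrt) (simp add: power_mult_distrib)
    have "p * (sqrt 3 / 2) \<le> p * Im v" using that by (intro mult_left_mono) auto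
    then show 2: "p * sqrt 3 \<le> sqrt d" using 1 by simp
    have "0 \<le> d" using \<open>4 * (p * Im v)\<^sup>2 \<le> d\<close> zero_le_power2[of "p * Im v"] by linarith
    moreover have "(p * sqrt 3)\<^sup>2 \<le> (sqrt d)\<^sup>2" using 2 that by (intro power_mono) auto
    ultimately show "3 * (real_of_int p)\<^sup>2 \<le> d" by (simp add: power_mult_distrib)
  qed
  note az = aI[OF z] and aw = aI[OF w]
  have a1: "real_of_int a \<ge> 1" "real_of_int a' \<ge> 1" using z w by simp_all
  show d: "d \<ge> 3" using az(3) one_le_power[OF a1(1), of 2] by linarith
  define P where "P = real_of_int a * real_of_int a'"
  have P0: "P > 0" using z w by (simp add: P_def)
  have P: "3 * P \<le> d"
  proof -
    have "(a * sqrt 3) * (a' * sqrt 3) \<le> sqrt d * sqrt d"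
      using az(2) aw(2) z w d by (intro mult_mono) auto
    moreover have "(a * sqrt 3) * (a' * sqrt 3) = (sqrt 3 * sqrt 3) * P"
      unfolding P_def by (simp only: mult_ac)
    ultimately show ?thesis using d by simp
  qed
  note re_z = quadratic_disc(1)[OF pos(1) z(2,3)] and re_w = quadratic_disc(1)[OF pos(2) w(2,3)]
  show "3 / (2 * d) \<le> \<bar>Re z - Re w\<bar> \<or> Re z = Re w \<and> sqrt 3 / d \<le> \<bar>Im z - Im w\<bar>"
  proof (cases "b' * a = b * a'")
    case False
    have "Re z - Re w = of_int (b' * a - b * a') / (2 * P)"
      unfolding re_z re_w P_def using z(2) w(2) by (simp add: field_simps)
    then have "\<bar>Re z - Re w\<bar> = of_int \<bar>b' * a - b * a'\<bar> / (2 * P)"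
      using P0 by (simp add: abs_divide)
    moreover have "1 \<le> \<bar>b' * a - b * a'\<bar>" using False by linarith
    then have "1 \<le> real_of_int \<bar>b' * a - b * a'\<bar>" by (simp only: of_int_1_le_iff)
    ultimately have "1 / (2 * P) \<le> \<bar>Re z - Re w\<bar>"
      using P0 by (simp only: divide_right_mono)
    moreover have "3 / (2 * d) \<le> 1 / (2 * P)"
      using P P0 d by (simp add: field_simps)
    ultimately show ?thesis by linarith
  next
    case True
    have re: "Re z = Re w"
    proof -
      have "real_of_int b' * a = b * a'" using arg_cong[OF True, of real_of_int] by simp
      then show ?thesis unfolding re_z re_w using z(2) w(2) by (simp add: field_simps)
    qed
    have im: "Im z \<noteq> Im w" using re ne by (auto simp: complex_eq_iff)
    have "(Im z)\<^sup>2 - (Im w)\<^sup>2 = (norm z)\<^sup>2 - (norm w)\<^sup>2" unfolding cmod_power2 re by simp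
    also have "\<dots> = of_int (c * a' - c' * a) / P"
    proof -
      have "(norm z)\<^sup>2 = c / a" "(norm w)\<^sup>2 = c' / a'"
        using quadratic_disc(3)[OF pos(1) z(2,3)] quadratic_disc(3)[OF pos(2) w(2,3)] z(2) w(2)
        by (simp_all add: field_simps)
      then show ?thesis unfolding P_def using z(2) w(2) by (simp add: field_simps)
    qed
    finally have eq: "(Im z - Im w) * (Im z + Im w) = of_int (c * a' - c' * a) / P"
      by (simp add: power2_eq_square algebra_simps)
    have "c * a' - c' * a \<noteq> 0"
    proof
      assume "c * a' - c' * a = 0"
      then have "(Im z - Im w) * (Im z + Im w) = 0" unfolding eq by simp
      then show False using im pos by auto
    qed
    then have "1 \<le> \<bar>c * a' - c' * a\<bar>" by linarith
    then have one: "1 \<le> real_of_int \<bar>c * a' - c' * a\<bar>" by (simp only: of_int_1_le_iff)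
    have "\<bar>Im z - Im w\<bar> * (Im z + Im w) = \<bar>(Im z - Im w) * (Im z + Im w)\<bar>"
      using pos by (simp add: abs_mult)
    also have "\<dots> = of_int \<bar>c * a' - c' * a\<bar> / P" unfolding eq using P0 by (simp add: abs_divide)
    also have "\<dots> * P = of_int \<bar>c * a' - c' * a\<bar>" using P0 by simp
    finally have low: "1 \<le> \<bar>Im z - Im w\<bar> * (P * (Im z + Im w))" using one by (simp add: mult_ac)
    have "(2 * (a * Im z)) * (a' * sqrt 3) + (a * sqrt 3) * (2 * (a' * Im w)) \<le> sqrt d * sqrt d + sqrt d * sqrt d"
      using az aw z w pos d by (intro add_mono mult_mono) auto
    moreover have "(2 * (a * Im z)) * (a' * sqrt 3) + (a * sqrt 3) * (2 * (a' * Im w)) = 2 * (sqrt 3 * (P * (Im z + Im w)))"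
      by (simp add: P_def algebra_simps)
    moreover have "sqrt d * sqrt d = d" using d by simp
    ultimately have sum: "sqrt 3 * (P * (Im z + Im w)) \<le> d" by linarith
    have "sqrt 3 * 1 \<le> sqrt 3 * (\<bar>Im z - Im w\<bar> * (P * (Im z + Im w)))"
      using low by (intro mult_left_mono) auto
    also have "\<dots> = \<bar>Im z - Im w\<bar> * (sqrt 3 * (P * (Im z + Im w)))" by (simp only: mult_ac)
    also have "\<dots> \<le> \<bar>Im z - Im w\<bar> * d" using sum by (intro mult_left_mono) auto
    finally have "sqrt 3 / d \<le> \<bar>Im z - Im w\<bar>" using d by (simp add: field_simps)
    then show ?thesis using re by blast
  qed
qed

text \<open>With \<open>w\<close> the lower point, factor out \<open>1 / nome_of w\<close>, of
  modulus at least 15. The quotient of the nomes is then \<open>R * cis (pi * \<delta>)\<close> with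
  \<open>R >= 1\<close>, and 15 * 39/10 = 117/2.\<close>

lemma inverse_nome_separation:
  assumes z: "reduced_point d z" and w: "reduced_point d w" and ne: "z \<noteq> w" and re: "\<bar>Re z - Re w\<bar> \<le> 1"
  shows "norm (1 / nome_of z - 1 / nome_of w) \<ge> 117 / (2 * d)"
proof -
  have main: "norm (1 / nome_of z - 1 / nome_of w) \<ge> 117 / (2 * d)"
    if "reduced_point d z" "reduced_point d w" "z \<noteq> w" "\<bar>Re z - Re w\<bar> \<le> 1" "Im w \<le> Im z" for z w
  proof -
    from that(1) obtain a b c :: int where abc: "Im z \<ge> sqrt 3 / 2" "a > 0"
      "of_int a * z\<^sup>2 + of_int b * z + of_int c = 0" "of_int (4 * a * c - b\<^sup>2) \<le> d"
      unfolding reduced_point_def by blast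
    from that(2) obtain a' b' c' :: int where abc': "Im w \<ge> sqrt 3 / 2" "a' > 0"
      "of_int a' * w\<^sup>2 + of_int b' * w + of_int c' = 0" "of_int (4 * a' * c' - b'\<^sup>2) \<le> d"
      unfolding reduced_point_def by blast
    note sep = quadratic_separation[OF abc abc' that(3)]
    define R where "R = exp (pi * (Im z - Im w))"
    define \<delta> where "\<delta> = Re w - Re z"
    have R: "R \<ge> 1" unfolding R_def using that(5) by simp
    have "nome_of w / nome_of z = exp (of_real (pi * (Im z - Im w)) + \<i> * of_real (pi * \<delta>))"
      unfolding nome_of_def exp_diff[symmetric] \<delta>_def
      by (rule arg_cong[of _ _ exp]) (simp add: complex_eq_iff algebra_simps)
    then have quot: "nome_of w / nome_of z = of_real R * cis (pi * \<delta>)"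
      by (simp only: exp_add R_def cis_conv_exp exp_of_real)
    have core: "norm (of_real R * cis (pi * \<delta>) - 1) \<ge> 39 / (10 * d)"
    proof (cases "3 / (2 * d) \<le> \<bar>\<delta>\<bar>")
      case True
      then show ?thesis using sep(1) R that(4) by (intro chord_lower_bound) (auto simp: \<delta>_def)
    next
      case False
      then have *: "Re z = Re w" "sqrt 3 / d \<le> \<bar>Im z - Im w\<bar>"
        using sep(2) by (auto simp: \<delta>_def abs_minus_commute)
      have "39 / (10 * d) = 39 / 10 / d" by simp
      also have "\<dots> \<le> 3.1405 * 1.732 / d" using sep(1) by (intro divide_right_mono) auto
      also have "\<dots> \<le> pi * sqrt 3 / d"
        using pi_lower_bound sqrt3_lower_bound sep(1) by (intro divide_right_mono mult_mono) auto
      also have "\<dots> = pi * (sqrt 3 / d)" by simp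
      also have "\<dots> \<le> pi * (Im z - Im w)" using * that(5) by (intro mult_left_mono) auto
      also have "\<dots> \<le> R - 1" unfolding R_def using exp_ge_add_one_self[of "pi * (Im z - Im w)"] by linarith
      also have "\<dots> = norm (of_real R * cis (pi * \<delta>) - 1)"
      proof -
        have "of_real R * cis (pi * \<delta>) - 1 = of_real (R - 1)" using * by (simp add: \<delta>_def)
        then show ?thesis using R by (simp only: norm_of_real)
      qed
      finally show ?thesis .
    qed
    have "1 / nome_of z - 1 / nome_of w = 1 / nome_of w * (of_real R * cis (pi * \<delta>) - 1)"
      unfolding quot[symmetric] by (simp add: field_simps)
    then have eq: "norm (1 / nome_of z - 1 / nome_of w) = norm (1 / nome_of w) * norm (of_real R * cis (pi * \<delta>) - 1)"
      by (simp only: norm_mult)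
    have "norm (1 / nome_of w) \<ge> 15"
      using norm_nome_of_le(2)[OF abc'(1)] by (simp add: norm_divide norm_nome_of exp_minus field_simps)
    then have "15 * (39 / (10 * d)) \<le> norm (1 / nome_of w) * norm (of_real R * cis (pi * \<delta>) - 1)"
      using core sep(1) by (intro mult_mono) auto
    then show ?thesis unfolding eq by simp
  qed
  show ?thesis
  proof (cases "Im w \<le> Im z")
    case True
    then show ?thesis using main[OF assms] by simp
  next
    case False
    then have "norm (1 / nome_of w - 1 / nome_of z) \<ge> 117 / (2 * d)"
      using assms by (intro main) auto
    then show ?thesis by (simp add: norm_minus_commute)
  qed
qed

text \<open>The 6 is 21/200 * 117/2 = 6.1425, rounded down.\<close>

lemma s_of_nome_separation:
  assumes "reduced_point d z" "reduced_point d w" "z \<noteq> w" "\<bar>Re z - Re w\<bar> \<le> 1" "d > 0"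
  shows "norm (s_of (nome_of z) - s_of (nome_of w)) \<ge> 6 / d"
proof -
  have "6 / d \<le> 21 / 200 * (117 / (2 * d))" using assms(5) by (simp add: field_simps)
  also have "\<dots> \<le> 21 / 200 * norm (1 / nome_of z - 1 / nome_of w)"
    using inverse_nome_separation[OF assms(1-4)] by (intro mult_left_mono) auto
  also have "\<dots> \<le> norm (s_of (nome_of z) - s_of (nome_of w))"
    using assms by (intro s_of_separation norm_nome_of_le) (auto simp: reduced_point_def)
  finally show ?thesis .
qed

theorem theorem1p1:
  fixes x y :: complex
  assumes "singular_modulus x" and "singular_modulus y" and "x \<noteq> y"
  shows "norm (x - y) \<ge>
    800 * (real_of_int (max \<bar>sm_discriminant x\<bar> \<bar>sm_discriminant y\<bar>)) powi (-4)"
proof -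
  define d where "d = real_of_int (max \<bar>sm_discriminant x\<bar> \<bar>sm_discriminant y\<bar>)"
  from assms(1) obtain z and a b c :: int where z: "Im z > 0" "a > 0" "of_int a * z\<^sup>2 + of_int b * z + of_int c = 0"
    "\<bar>Re z\<bar> \<le> 1 / 2" "norm z \<ge> 1" "x = klein_j z" "\<bar>sm_discriminant x\<bar> = 4 * a * c - b\<^sup>2"
    by (rule singular_modulus_reduced)
  from assms(2) obtain w and a' b' c' :: int where w: "Im w > 0" "a' > 0" "of_int a' * w\<^sup>2 + of_int b' * w + of_int c' = 0"
    "\<bar>Re w\<bar> \<le> 1 / 2" "norm w \<ge> 1" "y = klein_j w" "\<bar>sm_discriminant y\<bar> = 4 * a' * c' - b'\<^sup>2"
    by (rule singular_modulus_reduced)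
  have Im: "Im z \<ge> sqrt 3 / 2" "Im w \<ge> sqrt 3 / 2" by (rule Im_fundamental[OF z(4,5,1)], rule Im_fundamental[OF w(4,5,1)])
  have dz: "of_int (4 * a * c - b\<^sup>2) \<le> d" and dw: "of_int (4 * a' * c' - b'\<^sup>2) \<le> d"
    unfolding d_def z(7)[symmetric] w(7)[symmetric] by (simp_all only: of_int_le_iff max.cobounded1 max.cobounded2)
  have rz: "reduced_point d z" and rw: "reduced_point d w"
    unfolding reduced_point_def using Im z(2,3) w(2,3) dz dw by blast+
  have ne: "z \<noteq> w + of_int n" for n
    using assms(3) klein_j_translate[of w n] unfolding z(6) w(6) by metis
  have ne0: "z \<noteq> w" using ne[of 0] by simp
  have d3: "d \<ge> 3" by (rule quadratic_separation(1)[OF Im(1) z(2,3) dz Im(2) w(2,3) dw ne0])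
  have nz: "norm (nome_of z) \<le> 1 / 15" and nw: "norm (nome_of w) \<le> 1 / 15"
    by (rule norm_nome_of_le(1)[OF Im(1)], rule norm_nome_of_le(1)[OF Im(2)])
  define s where "s = s_of (nome_of z)"
  define t where "t = s_of (nome_of w)"
  interpret z: period_lattice z using z(1) by unfold_locales
  interpret w: period_lattice w using w(1) by unfold_locales
  have far: "norm (s_of (nome_of v) - 1) \<ge> 2" if "\<bar>Re v\<bar> \<le> 1 / 2" "norm v \<ge> 1" "Im v > 0" for v
  proof -
    have "1 \<le> (norm v)\<^sup>2" using that(2) by (simp add: one_le_power)
    then have "1 - (Re v)\<^sup>2 \<le> (Im v)\<^sup>2" unfolding cmod_power2 by simp
    then have "sqrt (1 - (Re v)\<^sup>2) \<le> sqrt ((Im v)\<^sup>2)" by (rule real_sqrt_le_mono)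
    then have "sqrt (1 - (Re v)\<^sup>2) \<le> Im v" using that(3) by simp
    then have "2 \<le> 2 + 5 / 4 * (Im v - sqrt (1 - (Re v)\<^sup>2))" by simp
    also have "\<dots> \<le> norm (s_of (nome_of v) - 1)" by (rule s_of_vertical[OF that])
    finally show ?thesis .
  qed
  have "norm (j_of_s s - j_of_s t) \<ge> 36 / 25 * (6 / d) ^ 3"
  proof (rule j_of_s_separation)
    show "Re s \<ge> 0" "Re t \<ge> 0" unfolding s_def t_def
      by (rule Re_s_of_nonneg[OF nz nome_of_nonzero Re_nome_of_nonneg[OF z(4)]],
          rule Re_s_of_nonneg[OF nw nome_of_nonzero Re_nome_of_nonneg[OF w(4)]])
    show s2: "norm (s - 1) \<ge> 2" and t2: "norm (t - 1) \<ge> 2"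
      unfolding s_def t_def by (rule far[OF z(4,5,1)], rule far[OF w(4,5,1)])
    show "0 < 6 / d" "6 / d \<le> 2" using d3 by (auto simp: field_simps)
    show "6 / d \<le> norm (s - t)"
      unfolding s_def t_def using z(4) w(4) d3 by (intro s_of_nome_separation rz rw ne0) linarith+
    show "6 / d \<le> norm (s + t)"
    proof -
      \<comment> \<open>\<open>- t\<close> is the value of \<open>s\<close> both at
        \<open>w + 1\<close> and at \<open>w - 1\<close>; the sign is chosen so that the real parts
        still differ by at most 1.\<close>
      define n :: int where "n = (if Re z \<ge> Re w then 1 else - 1)"
      have "nome_of (w + of_int n) = - nome_of w"
        using nome_of_add_1[of w] nome_of_diff_1[of w] by (simp add: n_def)
      moreover have "6 / d \<le> norm (s_of (nome_of z) - s_of (nome_of (w + of_int n)))"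
      proof (rule s_of_nome_separation[OF rz reduced_point_translate[OF rw] ne])
        show "\<bar>Re z - Re (w + of_int n)\<bar> \<le> 1" using z(4) w(4) by (auto simp: n_def abs_le_iff)
        show "0 < d" using d3 by simp
      qed
      ultimately show ?thesis by (simp add: s_of_minus[OF nw] s_def t_def)
    qed
    show "2 * (6 / d) \<le> norm ((s - 1) * (t - 1) - 4)"
    \<comment> \<open>\<open>cnj t\<close> is the value of \<open>s\<close> at
      \<open>- cnj w\<close>, so the bound by \<open>norm (s - cnj t)\<close> gives information
      exactly when that point differs from \<open>z\<close>.\<close>
    proof (cases "z = - cnj w")
      case False
      have "6 / d \<le> norm (s_of (nome_of z) - s_of (nome_of (- cnj w)))"
        using z(4) w(4) d3 False by (intro s_of_nome_separation reduced_point_reflect rz rw) auto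
      then have "2 * (6 / d) \<le> 2 * norm (s - 1 - cnj (t - 1))"
        unfolding nome_of_cnj by (simp add: s_of_cnj[OF nw] s_def t_def)
      also have "\<dots> \<le> norm ((s - 1) * (t - 1) - 4)"
        using s2 t2 by (rule norm_mult_minus_4_ge)
      finally show ?thesis .
    next
      case True
      then have w_eq: "w = - cnj z" by simp
      \<comment> \<open>On the unit circle \<open>- cnj z\<close> is the image of \<open>z\<close>
        under inversion, and the two values of \<open>j\<close> would coincide.\<close>
      have "norm z \<noteq> 1"
      proof
        assume "norm z = 1"
        then have "z * cnj z = 1" "z \<noteq> 0" using complex_norm_square[of z] by auto
        then have "w = - 1 / z" unfolding w_eq by (simp add: field_simps)
        then show False using klein_j_invert[OF \<open>z \<noteq> 0\<close>] assms(3) z(6) w(6) by simp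
      qed
      then have "norm z > 1" using z(5) by simp
      then have "(norm z)\<^sup>2 > 1" by (simp add: one_less_power)
      then have "real_of_int a < c"
        using quadratic_disc(3)[OF z(1,2,3)] mult_strict_left_mono[of 1 "(norm z)\<^sup>2" "real_of_int a"] z(2) by simp
      then have ca: "c \<ge> a + 1" by simp
      then have ca': "real_of_int c \<ge> a + 1" by (metis of_int_1 of_int_add of_int_le_iff)
      have ba: "\<bar>b\<bar> \<le> a"
      proof -
        have "\<bar>- real_of_int b / (2 * a)\<bar> \<le> 1 / 2"
          using z(4) unfolding quadratic_disc(1)[OF z(1,2,3)] by simp
        then have "\<bar>real_of_int b\<bar> \<le> a" using z(2) by (simp add: abs_mult field_simps)
        then show ?thesis by linarith
      qed
      \<comment> \<open>From \<open>c >= a + 1\<close> and \<open>|b| <= a\<close> one gets at least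
        \<open>3 * a^2 + 4 * a\<close>. The bound 7 gives \<open>12 / 5 <= sqrt d\<close>, which
        turns a gap of order \<open>1 / sqrt d\<close> into \<open>12 / d\<close>.\<close>
      have "7 \<le> 4 * a * c - b\<^sup>2"
      proof -
        have "b\<^sup>2 \<le> a\<^sup>2" using ba by (intro abs_le_square_iff[THEN iffD1]) auto
        moreover have "a * (a + 1) \<le> a * c" using ca z(2) by (intro mult_left_mono) auto
        moreover have "a * 1 \<le> a * a" using z(2) by (intro mult_left_mono) auto
        ultimately have "7 \<le> 4 * (a * c) - b * b"
          using z(2) unfolding power2_eq_square distrib_left by linarith
        then show ?thesis by (simp add: power2_eq_square mult.assoc)
      qed
      then have "real_of_int 7 \<le> of_int (4 * a * c - b\<^sup>2)" by (simp only: of_int_le_iff)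
      also note dz
      finally have d7: "d \<ge> 7" by simp
      \<comment> \<open>The height of the unit circle above \<open>Re z\<close>. The gap
        \<open>Im z - y0\<close> is at least \<open>1 / sqrt d\<close>, because
        \<open>a * ((Im z)^2 - y0^2) = c - a >= 1\<close> and
        \<open>2 * a * Im z <= sqrt d\<close>.\<close>
      define y0 where "y0 = sqrt (1 - (Re z)\<^sup>2)"
      have "(Re z)\<^sup>2 \<le> (1 / 2)\<^sup>2" using z(4) by (intro abs_le_square_iff[THEN iffD1]) auto
      then have "y0\<^sup>2 = 1 - (Re z)\<^sup>2" "y0 \<ge> 0" by (simp_all add: y0_def power2_eq_square)
      then have e: "(Im z)\<^sup>2 - y0\<^sup>2 = (norm z)\<^sup>2 - 1" unfolding cmod_power2 by simp
      have "a * ((Im z)\<^sup>2 - y0\<^sup>2) = c - a"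
        unfolding e using quadratic_disc(3)[OF z(1,2,3)] by (simp add: algebra_simps)
      moreover have "a * ((Im z)\<^sup>2 - y0\<^sup>2) = (Im z - y0) * (a * (Im z + y0))"
        by (simp add: power2_eq_square algebra_simps)
      ultimately have step: "1 \<le> (Im z - y0) * (a * (Im z + y0))" using ca' by linarith
      have y0: "y0 < Im z"
      proof (rule ccontr)
        assume "\<not> ?thesis"
        then have "(Im z - y0) * (a * (Im z + y0)) \<le> 0"
          using z(1,2) \<open>y0 \<ge> 0\<close> by (intro mult_nonpos_nonneg) auto
        then show False using step by linarith
      qed
      have "a * (Im z + y0) \<le> 2 * (a * Im z)" using y0 z(2) by simp
      also have "\<dots> \<le> sqrt d"
        using quadratic_disc(2)[OF z(1,2,3)] dz by (intro real_le_rsqrt) (simp add: power_mult_distrib)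
      finally have "(Im z - y0) * (a * (Im z + y0)) \<le> (Im z - y0) * sqrt d"
        using y0 by (intro mult_left_mono) auto
      then have "1 \<le> (Im z - y0) * sqrt d" using step by linarith
      then have gap: "Im z - y0 \<ge> 1 / sqrt d" using d7 by (simp add: field_simps)
      have "12 / d \<le> 5 * (1 / sqrt d)"
      proof -
        have "12 / 5 \<le> sqrt d" using d7 by (intro real_le_rsqrt) (simp add: power2_eq_square)
        then have "12 / sqrt d \<le> 5" using d7 by (simp add: field_simps)
        then have "(12 / sqrt d) * (1 / sqrt d) \<le> 5 * (1 / sqrt d)" using d7 by (intro mult_right_mono) auto
        moreover have "(12 / sqrt d) * (1 / sqrt d) = 12 / d" using d7 by simp
        ultimately show ?thesis by simp
      qed
      also have "\<dots> \<le> 5 * (Im z - y0)" using gap by simp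
      also have "\<dots> \<le> (norm (s - 1))\<^sup>2 - 4"
      proof -
        have "2 + 5 / 4 * (Im z - y0) \<le> norm (s - 1)"
          using s_of_vertical[OF z(4,5,1)] by (simp add: s_def y0_def)
        then have "(2 + 5 / 4 * (Im z - y0))\<^sup>2 \<le> (norm (s - 1))\<^sup>2" using y0 by (intro power_mono) auto
        moreover have "(2 + 5 / 4 * (Im z - y0))\<^sup>2 = 4 + 5 * (Im z - y0) + (5 / 4 * (Im z - y0))\<^sup>2"
          by (simp add: power2_eq_square algebra_simps)
        ultimately show ?thesis using zero_le_power2[of "5 / 4 * (Im z - y0)"] by linarith
      qed
      also have "\<dots> \<le> norm ((s - 1) * (t - 1) - 4)"
      proof -
        have "t = cnj s" unfolding t_def s_def w_eq nome_of_cnj using nz by (rule s_of_cnj)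
        then have "(s - 1) * (t - 1) = of_real ((norm (s - 1))\<^sup>2)"
          unfolding complex_norm_square by simp
        then have "(s - 1) * (t - 1) - 4 = of_real ((norm (s - 1))\<^sup>2 - 4)" by simp
        then show ?thesis by (simp only: norm_of_real)
      qed
      finally show ?thesis by simp
    qed
  qed
  moreover have "x = j_of_s s" "y = j_of_s t"
    unfolding z(6) w(6) s_def t_def using z.klein_j_s_of[OF nz] w.klein_j_s_of[OF nw] by simp_all
  \<comment> \<open>For \<open>d >= 3\<close>, 36/25 * 216 * d is at least 933.12.\<close>
  moreover have "36 / 25 * (6 / d) ^ 3 \<ge> 800 * d powi (-4)"
  proof -
    have "800 / d ^ 4 \<le> 36 / 25 * (216 * d) / d ^ 4" using d3 by (intro divide_right_mono) auto
    also have "\<dots> = 36 / 25 * (6 / d) ^ 3" using d3 by (simp add: power_divide eval_nat_numeral)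
    finally have "800 / d ^ 4 \<le> 36 / 25 * (6 / d) ^ 3" .
    moreover have "d powi (-4) = inverse (d ^ 4)" by (simp add: power_int_def power_inverse)
    ultimately show ?thesis by (simp only: divide_inverse)
  qed
  ultimately show ?thesis unfolding d_def by simp
qed

end
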